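(* Let $(M,g)$ be an oriented three-dimensional Riemannian manifold with Levi-Civita connection $\nabla$, Schouten tensor $P$, Cotton tensor $C_{ijk}=\nabla_kP_{ij}-\nabla_jP_{ik}$ and volume form $\mu$. Define the symmetric two-tensors $$V_{ij}=\nabla^kC_{ijk},\qquad \mathcal{C}_{ij}=\mu_i{}^{k\ell}C_{jk\ell}.$$ Then $\langle V,\mathcal{C}\rangle_g$ and $|\mathcal{C}|_g^2$ are pointwise conformal invariants: if $\widetilde g=e^{2w_0}g$ with $w_0\in C^\infty(M)$, and $\widetilde V,\widetilde{\mathcal C}$ denote the corresponding tensors of $\widetilde g$, then $$\langle\widetilde V,\widetilde{\mathcal C}\rangle_{\widetilde g}=e^{-7w_0}\langle V,\mathcal C\rangle_g,\qquad |\widetilde{\mathcal C}|^2_{\widetilde g}=e^{-6w_0}|\mathcal C|_g^2 .$$ Consequently, when it converges, $$I(M^3,[g])=\int_M\frac{\langle V,\mathcal C\rangle}{|\mathcal C|^{4/3}}\,dv_g$$ is an integral conformal invariant, i.e. it depends only on the conformal class $[g]$.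
   Context: In dimension three the Schouten tensor is $P=\mathrm{Ric}-\frac{R}{4}g$. Indices are raised with $g$; $\langle V,\mathcal C\rangle_g=V_{ij}\mathcal C^{ij}$ and $|\mathcal C|_g^2=\mathcal C_{ij}\mathcal C^{ij}$. The tensors for $\widetilde g$ are computed with the same orientation. The integrand of $I$ is understood to be $0$ at points where $\mathcal C=0$. *)

theory Defs
  imports "HOL-Analysis.Analysis"
begin

section \<open>Smooth functions on open subsets of coordinate space\<close>

definition partial :: "3 \<Rightarrow> (real^3 \<Rightarrow> real) \<Rightarrow> real^3 \<Rightarrow> real" where
  "partial i f x = frechet_derivative f (at x) (axis i 1)"

primrec Ck_on :: "nat \<Rightarrow> (real^3) set \<Rightarrow> (real^3 \<Rightarrow> real) \<Rightarrow> bool" where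
  "Ck_on 0 S f \<longleftrightarrow> continuous_on S f"
| "Ck_on (Suc k) S f \<longleftrightarrow> (\<forall>x\<in>S. f differentiable (at x)) \<and> (\<forall>i. Ck_on k S (partial i f))"

text \<open>Only used for open \<open>S\<close>.\<close>

definition smooth_on :: "(real^3) set \<Rightarrow> (real^3 \<Rightarrow> real) \<Rightarrow> bool" where
  "smooth_on S f \<longleftrightarrow> (\<forall>k. Ck_on k S f)"


section \<open>Oriented three-manifolds\<close>

text \<open>
  The manifold is a whole type \<open>'a\<close> (Hausdorff and second countable by its type classes).
  A chart is a pair of an open domain and a coordinate map on it.  Smooth structure and
  orientation are given by an atlas whose transition maps are smooth with positive Jacobian
  determinant.
\<close>

type_synonym 'a chart = "'a set \<times> ('a \<Rightarrow> real^3)"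

definition chart_dom :: "'a chart \<Rightarrow> 'a set" where
  "chart_dom c = fst c"

definition coord :: "'a chart \<Rightarrow> 'a \<Rightarrow> real^3" where
  "coord c = snd c"

definition chart_image :: "'a chart \<Rightarrow> (real^3) set" where
  "chart_image c = coord c ` chart_dom c"

definition chart_inv :: "'a chart \<Rightarrow> real^3 \<Rightarrow> 'a" where
  "chart_inv c = inv_into (chart_dom c) (coord c)"

definition is_chart :: "'a::topological_space chart \<Rightarrow> bool" where
  "is_chart c \<longleftrightarrow> open (chart_dom c) \<and> open (chart_image c) \<and>
     homeomorphism (chart_dom c) (chart_image c) (coord c) (chart_inv c)"

definition overlap :: "'a chart \<Rightarrow> 'a chart \<Rightarrow> (real^3) set" where
  "overlap c d = coord c ` (chart_dom c \<inter> chart_dom d)"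

definition transition :: "'a chart \<Rightarrow> 'a chart \<Rightarrow> real^3 \<Rightarrow> real^3" where
  "transition c d x = coord d (chart_inv c x)"

definition jacobian :: "'a chart \<Rightarrow> 'a chart \<Rightarrow> real^3 \<Rightarrow> real^3^3" where
  "jacobian c d x = matrix (frechet_derivative (transition c d) (at x))"

definition oriented_atlas :: "'a::topological_space chart set \<Rightarrow> bool" where
  "oriented_atlas A \<longleftrightarrow>
     (\<forall>c\<in>A. is_chart c) \<and> (\<Union>c\<in>A. chart_dom c) = UNIV \<and>
     (\<forall>c\<in>A. \<forall>d\<in>A. (\<forall>a. smooth_on (overlap c d) (\<lambda>x. transition c d x $ a)) \<and>
        (\<forall>x\<in>overlap c d. det (jacobian c d x) > 0))"

definition smooth_function :: "'a chart set \<Rightarrow> ('a \<Rightarrow> real) \<Rightarrow> bool" where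
  "smooth_function A f \<longleftrightarrow> (\<forall>c\<in>A. smooth_on (chart_image c) (\<lambda>x. f (chart_inv c x)))"


section \<open>Riemannian metrics\<close>

text \<open>
  A metric \<open>g\<close> assigns to each chart \<open>c\<close> the matrix function \<open>g c\<close> of its components on
  \<^term>\<open>chart_image c\<close>; the last condition is the transformation law of a covariant two-tensor.
  Values outside the atlas and the chart images are irrelevant.
\<close>

type_synonym 'a metric = "'a chart \<Rightarrow> real^3 \<Rightarrow> real^3^3"

definition riemannian_metric :: "'a chart set \<Rightarrow> 'a metric \<Rightarrow> bool" where
  "riemannian_metric A g \<longleftrightarrow>
     (\<forall>c\<in>A. (\<forall>i j. smooth_on (chart_image c) (\<lambda>x. g c x $ i $ j)) \<and>
        (\<forall>x\<in>chart_image c. transpose (g c x) = g c x \<and>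
           (\<forall>v. v \<noteq> 0 \<longrightarrow> v \<bullet> (g c x *v v) > 0))) \<and>
     (\<forall>c\<in>A. \<forall>d\<in>A. \<forall>x\<in>overlap c d.
        g c x = transpose (jacobian c d x) ** g d (transition c d x) ** jacobian c d x)"

text \<open>\<open>h = e\<^sup>2\<^sup>w g\<close>\<close>

definition conformal_change :: "'a chart set \<Rightarrow> ('a \<Rightarrow> real) \<Rightarrow> 'a metric \<Rightarrow> 'a metric \<Rightarrow> bool" where
  "conformal_change A w g h \<longleftrightarrow>
     (\<forall>c\<in>A. \<forall>x\<in>chart_image c. h c x = exp (2 * w (chart_inv c x)) *\<^sub>R g c x)"


section \<open>Curvature tensors in local coordinates\<close>

text \<open>
  Here \<open>h\<close> is the component matrix of the metric in one chart, and a tensor field is given by its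
  components \<open>T i j \<dots> x\<close> in the same index order as in the usual notation.
\<close>

type_synonym local_metric = "real^3 \<Rightarrow> real^3^3"
type_synonym tensor2 = "3 \<Rightarrow> 3 \<Rightarrow> real^3 \<Rightarrow> real"
type_synonym tensor3 = "3 \<Rightarrow> 3 \<Rightarrow> 3 \<Rightarrow> real^3 \<Rightarrow> real"

definition lower :: "local_metric \<Rightarrow> tensor2" where
  "lower h i j x = h x $ i $ j"

definition upper :: "local_metric \<Rightarrow> tensor2" where
  "upper h i j x = matrix_inv (h x) $ i $ j"

text \<open>\<open>christoffel h k i j\<close> is \<open>\<Gamma>\<^sup>k\<^sub>i\<^sub>j\<close>, the coefficients of the Levi-Civita connection.\<close>

definition christoffel :: "local_metric \<Rightarrow> tensor3" where
  "christoffel h k i j x = (1/2) * (\<Sum>l\<in>UNIV. upper h k l x *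
     (partial i (lower h j l) x + partial j (lower h i l) x - partial l (lower h i j) x))"

text \<open>\<open>nabla2 h k T i j = \<nabla>\<^sub>k T\<^sub>i\<^sub>j\<close>, and likewise for three indices.\<close>

definition nabla2 :: "local_metric \<Rightarrow> 3 \<Rightarrow> tensor2 \<Rightarrow> tensor2" where
  "nabla2 h k T i j x = partial k (T i j) x
     - (\<Sum>m\<in>UNIV. christoffel h m k i x * T m j x)
     - (\<Sum>m\<in>UNIV. christoffel h m k j x * T i m x)"

definition nabla3 :: "local_metric \<Rightarrow> 3 \<Rightarrow> tensor3 \<Rightarrow> tensor3" where
  "nabla3 h l T i j k x = partial l (T i j k) x
     - (\<Sum>m\<in>UNIV. christoffel h m l i x * T m j k x)
     - (\<Sum>m\<in>UNIV. christoffel h m l j x * T i m k x)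
     - (\<Sum>m\<in>UNIV. christoffel h m l k x * T i j m x)"

text \<open>
  \<open>riemann h l k i j\<close> is the \<open>\<partial>\<^sub>l\<close>-component of \<open>R(\<partial>\<^sub>i, \<partial>\<^sub>j) \<partial>\<^sub>k\<close>, where
  \<open>R(X, Y) = [\<nabla>\<^sub>X, \<nabla>\<^sub>Y] - \<nabla>\<^bsub>[X, Y]\<^esub>\<close>.  The Ricci tensor is the trace over \<open>l = i\<close>,
  so it is positive on round spheres.
\<close>

definition riemann :: "local_metric \<Rightarrow> 3 \<Rightarrow> 3 \<Rightarrow> 3 \<Rightarrow> 3 \<Rightarrow> real^3 \<Rightarrow> real" where
  "riemann h l k i j x =
     partial i (christoffel h l j k) x - partial j (christoffel h l i k) x
     + (\<Sum>m\<in>UNIV. christoffel h l i m x * christoffel h m j k x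
                 - christoffel h l j m x * christoffel h m i k x)"

definition ricci :: "local_metric \<Rightarrow> tensor2" where
  "ricci h j k x = (\<Sum>i\<in>UNIV. riemann h i k i j x)"

definition scalar_curv :: "local_metric \<Rightarrow> real^3 \<Rightarrow> real" where
  "scalar_curv h x = (\<Sum>i\<in>UNIV. \<Sum>j\<in>UNIV. upper h i j x * ricci h i j x)"

definition schouten :: "local_metric \<Rightarrow> tensor2" where
  "schouten h i j x = ricci h i j x - scalar_curv h x / 4 * lower h i j x"

definition cotton :: "local_metric \<Rightarrow> tensor3" where
  "cotton h i j k x = nabla2 h k (schouten h) i j x - nabla2 h j (schouten h) i k x"

definition V_tensor :: "local_metric \<Rightarrow> tensor2" where
  "V_tensor h i j x = (\<Sum>k\<in>UNIV. \<Sum>l\<in>UNIV. upper h k l x * nabla3 h l (cotton h) i j k x)"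

text \<open>
  The determinant is the permutation symbol of \<open>i, j, k\<close>; the formula is that of the volume form
  in a positively oriented chart.
\<close>

definition volume_form :: "local_metric \<Rightarrow> tensor3" where
  "volume_form h i j k x =
     sqrt (det (h x)) * det (vector [axis i 1, axis j 1, axis k 1] :: real^3^3)"

text \<open>The tensor \<open>\<C>\<^sub>i\<^sub>j = \<mu>\<^sub>i\<^sup>k\<^sup>l C\<^sub>j\<^sub>k\<^sub>l\<close>:\<close>

definition C_tensor :: "local_metric \<Rightarrow> tensor2" where
  "C_tensor h i j x = (\<Sum>k\<in>UNIV. \<Sum>l\<in>UNIV.
     (\<Sum>a\<in>UNIV. \<Sum>b\<in>UNIV. upper h k a x * upper h l b x * volume_form h i a b x)
     * cotton h j k l x)"

definition tensor_inner :: "local_metric \<Rightarrow> tensor2 \<Rightarrow> tensor2 \<Rightarrow> real^3 \<Rightarrow> real" where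
  "tensor_inner h S T x = (\<Sum>i\<in>UNIV. \<Sum>j\<in>UNIV. S i j x *
     (\<Sum>a\<in>UNIV. \<Sum>b\<in>UNIV. upper h i a x * upper h j b x * T a b x))"

definition V_inner_C :: "local_metric \<Rightarrow> real^3 \<Rightarrow> real" where
  "V_inner_C h x = tensor_inner h (V_tensor h) (C_tensor h) x"

definition C_norm_sq :: "local_metric \<Rightarrow> real^3 \<Rightarrow> real" where
  "C_norm_sq h x = tensor_inner h (C_tensor h) (C_tensor h) x"


section \<open>The integral\<close>

definition local_integrand :: "local_metric \<Rightarrow> real^3 \<Rightarrow> real" where
  "local_integrand h x =
     (if \<forall>i j. C_tensor h i j x = 0 then 0
      else V_inner_C h x / sqrt (C_norm_sq h x) powr (4/3))"

text \<open>
  The local expression above is a full contraction of tensors, so its value at a point does not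
  depend on the positively oriented chart used to compute it.
\<close>

definition integrand :: "'a chart set \<Rightarrow> 'a metric \<Rightarrow> 'a \<Rightarrow> real" where
  "integrand A g p =
     (let c = (SOME c. c \<in> A \<and> p \<in> chart_dom c) in local_integrand (g c) (coord c p))"

text \<open>
  The Riemannian measure \<open>dv\<^sub>g\<close>: the unique Borel measure on the manifold that is
  \<open>sqrt (det g) dx\<close> in every chart of the atlas.
\<close>

definition volume_measure :: "'a::topological_space chart set \<Rightarrow> 'a metric \<Rightarrow> 'a measure" where
  "volume_measure A g = (THE \<mu>. sets \<mu> = sets borel \<and>
     (\<forall>c\<in>A. \<forall>B\<in>sets borel. B \<subseteq> chart_dom c \<longrightarrow>
        emeasure \<mu> B = (\<integral>\<^sup>+x\<in>coord c ` B. ennreal (sqrt (det (g c x))) \<partial>lborel)))"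

definition I_converges :: "'a::topological_space chart set \<Rightarrow> 'a metric \<Rightarrow> bool" where
  "I_converges A g \<longleftrightarrow> integrable (volume_measure A g) (integrand A g)"

definition I_integral :: "'a::topological_space chart set \<Rightarrow> 'a metric \<Rightarrow> real" where
  "I_integral A g = (LINT p|volume_measure A g. integrand A g p)"

end

theory Submission
  imports Defs
begin

text \<open>
  In dimension three the Riemann tensor is determined by the Schouten tensor \<open>P\<close>.  Hence for
  \<open>e\<^sup>2\<^sup>w g\<close> the change of \<open>P\<close> by \<open>- \<nabla>\<^sup>2w + dw dw - |dw|\<^sup>2 g / 2\<close>
  cancels the change of the connection, and the Cotton tensor \<open>C\<close> is invariant.  Consequently
  \<open>\<C>\<close> is multiplied by \<open>e\<^sup>-\<^sup>w\<close>, while \<open>V\<^sub>i\<^sub>j\<close> becomes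
  \<open>e\<^sup>-\<^sup>2\<^sup>w (V\<^sub>i\<^sub>j - w\<^sup>m (C\<^sub>i\<^sub>j\<^sub>m + C\<^sub>j\<^sub>i\<^sub>m))\<close>.  By the contracted second Bianchi identity \<open>C\<close> is
  trace-free, so its dual \<open>\<C>\<close> is symmetric, and \<open>C\<^sub>i\<^sub>j\<^sub>m \<C>\<^sup>i\<^sup>j\<close> is the contraction of a symmetric
  tensor with the volume form; thus the correction term does not contribute to \<open>\<langle>V, \<C>\<rangle>\<close>.
  The symmetry of \<open>V\<close> amounts to \<open>\<nabla>\<^sup>k C\<^sub>k\<^sub>i\<^sub>j = 0\<close>, because \<open>C\<close> is cyclic.
  The integrand of \<open>I\<close> scales by \<open>e\<^sup>-\<^sup>3\<^sup>w\<close> and the Riemannian measure by \<open>e\<^sup>3\<^sup>w\<close>.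
\<close>

section \<open>Calculus of partial derivatives\<close>

text \<open>The exponent 4/3 is forced by counting powers of e^w: the pairing of \<open>V\<close>
  with \<open>\<C>\<close> has weight -7, the norm of \<open>\<C>\<close> weight -3 and the measure
  weight 3, and -7 + 3 * 4/3 + 3 = 0. The obstacle to the invariance of the Cotton tensor is the
  third derivatives of w, which enter through the derivative of the Hessian. Antisymmetrisation
  leaves only their commutator, the curvature applied to dw, and this must match the terms in which
  the change of connection multiplies dw by P. So the vanishing of the Weyl part is wanted in
  explicit form; it comes from linear algebra, a polynomial identity in which the determinant of the
  inverse metric appears as a factor. Tensors are handled as components: each identity is either
  assembled from contraction lemmas or expanded over the index values 1, 2, 3 into a polynomial
  identity. On the manifold the measure is characterised chart by chart, so its existence and
  uniqueness have to be shown before its conformal factor can be read off in charts.\<close>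

lemma partial_eqI: "(f has_derivative f') (at x) \<Longrightarrow> partial i f x = f' (axis i 1)"
  unfolding partial_def using frechet_derivative_at by metis

text \<open>\<open>frechet_derivative\<close> is a choice from the set of derivatives at the point.
  Functions agreeing near \<open>x\<close> have the same set, so the same choice is made even if the
  set is empty.\<close>

lemma partial_cong_open:
  assumes "open S" "x \<in> S" "\<And>y. y \<in> S \<Longrightarrow> f y = g y"
  shows "partial i f x = partial i g x"
proof -
  have "(f has_derivative D) (at x) \<longleftrightarrow> (g has_derivative D) (at x)" for D
    using has_derivative_transform_within_open[of f D x UNIV S g]
      has_derivative_transform_within_open[of g D x UNIV S f] assms by auto
  then show ?thesis unfolding partial_def frechet_derivative_def by simp
qed

lemma differentiable_cong_open:
  assumes "open S" "x \<in> S" "\<And>y. y \<in> S \<Longrightarrow> f y = g y" "f differentiable (at x)"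
  shows "g differentiable (at x)"
  using assms has_derivative_transform_within_open[of f _ x UNIV S g]
  unfolding differentiable_def by auto

lemma partial_const [simp]: "partial i (\<lambda>_. c) x = 0"
  using partial_eqI[OF has_derivative_const] by simp

lemma partial_add:
  assumes "f differentiable (at x)" "g differentiable (at x)"
  shows "partial i (\<lambda>x. f x + g x) x = partial i f x + partial i g x"
  using partial_eqI[OF has_derivative_add[OF assms[unfolded frechet_derivative_works]]]
  unfolding partial_def .

lemma partial_mult:
  assumes "f differentiable (at x)" "g differentiable (at x)"
  shows "partial i (\<lambda>x. f x * g x) x = partial i f x * g x + f x * partial i g x"
  using partial_eqI[OF has_derivative_mult[OF assms[unfolded frechet_derivative_works]]]
  unfolding partial_def by (simp add: mult.commute)

lemma partial_inverse:
  assumes "f differentiable (at x)" "f x \<noteq> 0"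
  shows "partial i (\<lambda>x. inverse (f x)) x = - (inverse (f x) * partial i f x * inverse (f x))"
  using partial_eqI[OF Deriv.has_derivative_inverse[OF assms(2) assms(1)[unfolded frechet_derivative_works]]]
  unfolding partial_def by simp

lemma partial_exp:
  assumes "f differentiable (at x)"
  shows "partial i (\<lambda>x. exp (f x)) x = exp (f x) * partial i f x"
  using partial_eqI[OF has_derivative_exp[OF assms[unfolded frechet_derivative_works]]]
  unfolding partial_def by (simp add: mult.commute)

section \<open>Closure properties of C^k and smooth functions\<close>

lemma Ck_on_cong:
  assumes "open S" "\<And>x. x \<in> S \<Longrightarrow> f x = g x" "Ck_on k S f"
  shows "Ck_on k S g"
  using assms(2,3)
proof (induction k arbitrary: f g)
  case 0
  then show ?case using continuous_on_cong[of S S f g] by simp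
next
  case (Suc k)
  have "Ck_on k S (partial i g)" for i
  proof (rule Suc.IH)
    show "partial i f x = partial i g x" if "x \<in> S" for x
      using partial_cong_open[OF assms(1) that] Suc.prems(1) by blast
    show "Ck_on k S (partial i f)" using Suc.prems(2) by simp
  qed
  moreover have "\<forall>x\<in>S. g differentiable (at x)"
    using Suc.prems differentiable_cong_open[OF assms(1), of _ f g] by simp
  ultimately show ?case by simp
qed

lemma Ck_on_SucD: "Ck_on (Suc k) S f \<Longrightarrow> Ck_on k S f"
proof (induction k arbitrary: f)
  case 0
  then show ?case
    by (auto intro!: continuous_at_imp_continuous_on differentiable_imp_continuous_within)
qed auto

lemma Ck_on_const: "Ck_on k S (\<lambda>_. c)"
proof (induction k arbitrary: c)
  case (Suc k)
  have "partial i (\<lambda>_. c) = (\<lambda>_. 0)" for i by (rule ext) simp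
  then show ?case using Suc[of 0] by simp
qed simp

lemma Ck_on_add:
  assumes "open S" "Ck_on k S f" "Ck_on k S g"
  shows "Ck_on k S (\<lambda>x. f x + g x)"
  using assms(2,3)
proof (induction k arbitrary: f g)
  case 0
  then show ?case by (auto intro: continuous_on_add)
next
  case (Suc k)
  have "Ck_on k S (partial i (\<lambda>x. f x + g x))" for i
    by (rule Ck_on_cong[OF assms(1), of "\<lambda>x. partial i f x + partial i g x"])
       (use Suc in \<open>auto simp: partial_add\<close>)
  then show ?case using Suc.prems by (auto intro: differentiable_add)
qed

lemma Ck_on_mult:
  assumes "open S" "Ck_on k S f" "Ck_on k S g"
  shows "Ck_on k S (\<lambda>x. f x * g x)"
  using assms(2,3)
proof (induction k arbitrary: f g)
  case 0
  then show ?case by (auto intro: continuous_on_mult)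
next
  case (Suc k)
  have "Ck_on k S (\<lambda>x. partial i f x * g x + f x * partial i g x)" for i
    using Suc.prems[THEN Ck_on_SucD] Suc.prems by (intro Ck_on_add[OF assms(1)] Suc.IH) simp_all
  then have "Ck_on k S (partial i (\<lambda>x. f x * g x))" for i
    by (rule Ck_on_cong[OF assms(1), rotated]) (use Suc.prems in \<open>simp add: partial_mult\<close>)
  then show ?case using Suc.prems by (auto intro: differentiable_mult)
qed

text \<open>The partial derivative of 1/f contains 1/f again; written as a product it has order k by
  the induction hypothesis for 1/f and the product rule of order k.\<close>

lemma Ck_on_inverse:
  assumes "open S" "\<And>x. x \<in> S \<Longrightarrow> f x \<noteq> 0" "Ck_on k S f"
  shows "Ck_on k S (\<lambda>x. inverse (f x))"
  using assms(3)
proof (induction k)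
  case 0
  then show ?case using assms(2) by (auto intro: continuous_on_inverse)
next
  case (Suc k)
  have "Ck_on k S (\<lambda>x. (-1) * (inverse (f x) * partial i f x * inverse (f x)))" for i
    using Suc Ck_on_SucD by (intro Ck_on_mult[OF assms(1)] Ck_on_const) auto
  then have "Ck_on k S (partial i (\<lambda>x. inverse (f x)))" for i
    by (rule Ck_on_cong[OF assms(1), rotated]) (use Suc assms(2) in \<open>auto simp: partial_inverse\<close>)
  moreover have "(\<lambda>x. inverse (f x)) differentiable (at x)" if "x \<in> S" for x
    using Suc.prems assms(2)[OF that] that by (auto intro: differentiable_inverse)
  ultimately show ?case by auto
qed

lemma smooth_on_const [simp]: "smooth_on S (\<lambda>_. c)"
  unfolding smooth_on_def by (simp add: Ck_on_const)

lemma smooth_on_add: "open S \<Longrightarrow> smooth_on S f \<Longrightarrow> smooth_on S g \<Longrightarrow> smooth_on S (\<lambda>x. f x + g x)"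
  unfolding smooth_on_def by (simp add: Ck_on_add)

lemma smooth_on_mult: "open S \<Longrightarrow> smooth_on S f \<Longrightarrow> smooth_on S g \<Longrightarrow> smooth_on S (\<lambda>x. f x * g x)"
  unfolding smooth_on_def by (simp add: Ck_on_mult)

lemma smooth_on_minus: "open S \<Longrightarrow> smooth_on S f \<Longrightarrow> smooth_on S (\<lambda>x. - f x)"
  using smooth_on_mult[of S "\<lambda>_. -1" f] by simp

lemma smooth_on_diff: "open S \<Longrightarrow> smooth_on S f \<Longrightarrow> smooth_on S g \<Longrightarrow> smooth_on S (\<lambda>x. f x - g x)"
  using smooth_on_add[of S f "\<lambda>x. - g x"] smooth_on_minus[of S g] by simp

lemma smooth_on_sum:
  assumes "open S" "\<And>i. i \<in> I \<Longrightarrow> smooth_on S (f i)"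
  shows "smooth_on S (\<lambda>x. \<Sum>i\<in>I. f i x)"
  using assms(2) by (induction I rule: infinite_finite_induct) (auto intro: smooth_on_add[OF assms(1)])

lemma smooth_on_inverse:
  "open S \<Longrightarrow> (\<And>x. x \<in> S \<Longrightarrow> f x \<noteq> 0) \<Longrightarrow> smooth_on S f \<Longrightarrow> smooth_on S (\<lambda>x. inverse (f x))"
  unfolding smooth_on_def by (simp add: Ck_on_inverse)

lemma smooth_on_divide:
  assumes "open S" "smooth_on S f" "smooth_on S g" "\<And>x. x \<in> S \<Longrightarrow> g x \<noteq> 0"
  shows "smooth_on S (\<lambda>x. f x / g x)"
  using smooth_on_mult[OF assms(1,2) smooth_on_inverse[OF assms(1,4,3)]]
  by (simp add: divide_inverse)

lemma smooth_on_cong: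
  "open S \<Longrightarrow> (\<And>x. x \<in> S \<Longrightarrow> f x = g x) \<Longrightarrow> smooth_on S f \<Longrightarrow> smooth_on S g"
  unfolding smooth_on_def using Ck_on_cong by blast

lemma smooth_on_partial: "smooth_on S f \<Longrightarrow> smooth_on S (partial i f)"
  unfolding smooth_on_def using Ck_on.simps(2) by blast

lemma smooth_on_differentiable: "smooth_on S f \<Longrightarrow> x \<in> S \<Longrightarrow> f differentiable (at x)"
  unfolding smooth_on_def using Ck_on.simps(2) by blast

lemma smooth_on_continuous: "smooth_on S f \<Longrightarrow> continuous_on S f"
  unfolding smooth_on_def using Ck_on.simps(1) by blast

lemma partial_minus:
  assumes "f differentiable (at x)"
  shows "partial i (\<lambda>x. - f x) x = - partial i f x"
  using partial_mult[of "\<lambda>_. -1" x f i] assms by simp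

lemma partial_diff:
  assumes "f differentiable (at x)" "g differentiable (at x)"
  shows "partial i (\<lambda>x. f x - g x) x = partial i f x - partial i g x"
  using partial_eqI[OF has_derivative_diff[OF assms[unfolded frechet_derivative_works]]]
  unfolding partial_def .

lemma partial_sum:
  assumes "\<And>j. j \<in> J \<Longrightarrow> f j differentiable (at x)"
  shows "partial i (\<lambda>x. \<Sum>j\<in>J. f j x) x = (\<Sum>j\<in>J. partial i (f j) x)"
  using assms
  by (induction J rule: infinite_finite_induct) (auto simp: partial_add differentiable_sum)

section \<open>Symmetry of second partial derivatives\<close>

lemma has_real_derivative_along_axis:
  assumes "f differentiable (at (a + s *\<^sub>R axis i 1))"
  shows "((\<lambda>s. f (a + s *\<^sub>R axis i 1)) has_real_derivative partial i f (a + s *\<^sub>R axis i 1)) (at s)"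
proof -
  let ?y = "a + s *\<^sub>R axis i 1"
  have g: "((\<lambda>s. a + s *\<^sub>R axis i (1::real)) has_derivative (\<lambda>s. 0 + s *\<^sub>R axis i 1)) (at s)"
    by (intro has_derivative_add has_derivative_const has_derivative_scaleR_left has_derivative_ident)
  have "((\<lambda>s. f (a + s *\<^sub>R axis i 1)) has_derivative
      (\<lambda>s. frechet_derivative f (at ?y) (s *\<^sub>R axis i 1))) (at s)"
    using has_derivative_compose[OF g, of f "frechet_derivative f (at ?y)"] assms
    unfolding frechet_derivative_works by simp
  moreover have "linear (frechet_derivative f (at ?y))"
    using assms by (rule linear_frechet_derivative)
  ultimately show ?thesis
    unfolding has_field_derivative_def partial_def by (simp add: linear_scale mult_commute_abs)
qed

text \<open>The second difference quotient in the directions \<open>i\<close>, \<open>j\<close> is symmetric in them and tends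
  to either iterated partial derivative.\<close>

lemma second_difference_estimate:
  fixes f :: "real^3 \<Rightarrow> real"
  assumes "open S" "x \<in> S" and f: "\<And>y. y \<in> S \<Longrightarrow> f differentiable (at y)"
    and F: "partial i f differentiable (at x)" and e: "e > 0"
  shows "\<exists>d>0. \<forall>t. 0 < t \<and> t < d \<longrightarrow>
    \<bar>f (x + t *\<^sub>R axis i 1 + t *\<^sub>R axis j 1) - f (x + t *\<^sub>R axis i 1) - f (x + t *\<^sub>R axis j 1) + f x
       - t\<^sup>2 * partial j (partial i f) x\<bar> \<le> e * t\<^sup>2"
proof -
  let ?F = "partial i f" and ?D = "frechet_derivative (partial i f) (at x)"
  let ?a = "axis i 1 :: real^3" and ?b = "axis j 1 :: real^3"
  have D: "(?F has_derivative ?D) (at x)" using F frechet_derivative_works by blast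
  have lin: "linear ?D" using F by (rule linear_frechet_derivative)
  obtain d1 where d1: "d1 > 0" "\<And>y. norm (y - x) < d1 \<Longrightarrow>
      norm (?F y - ?F x - ?D (y - x)) \<le> e/3 * norm (y - x)"
    using D e unfolding has_derivative_at_alt by (metis divide_pos_pos zero_less_numeral)
  obtain d2 where d2: "d2 > 0" "ball x d2 \<subseteq> S" using assms(1,2) openE by blast
  \<comment> \<open>The half is due to the far corner x + t a + t b of the square, whose distance
    from x is at most 2 t.\<close>
  let ?d = "min d1 d2 / 2"
  show ?thesis
  proof (intro exI[of _ ?d] conjI allI impI)
    show "?d > 0" using d1 d2 by simp
    fix t assume t: "0 < t \<and> t < ?d"
    have nrm: "norm (s *\<^sub>R ?a + r *\<^sub>R ?b) \<le> s + r" if "0 \<le> s" "0 \<le> r" for s r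
      using norm_triangle_ineq[of "s *\<^sub>R ?a" "r *\<^sub>R ?b"] that by simp
    have inS: "x + s *\<^sub>R ?a + r *\<^sub>R ?b \<in> S" if "0 \<le> s" "s \<le> t" "0 \<le> r" "r \<le> t" for s r
    proof -
      have "norm (s *\<^sub>R ?a + r *\<^sub>R ?b) < d2" using nrm[of s r] that t by auto
      moreover have "dist x (x + s *\<^sub>R ?a + r *\<^sub>R ?b) = norm (s *\<^sub>R ?a + r *\<^sub>R ?b)"
        by (metis add.assoc add_diff_cancel_left' dist_commute dist_norm)
      ultimately have "x + s *\<^sub>R ?a + r *\<^sub>R ?b \<in> ball x d2" by simp
      then show ?thesis using d2 by blast
    qed
    \<comment> \<open>The second difference is the increment along direction i of this first
      difference in direction j. One application of the mean value theorem turns it into a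
      difference of values of \<open>partial i f\<close>, to which differentiability at x
      applies.\<close>
    let ?h = "\<lambda>s. f (x + t *\<^sub>R ?b + s *\<^sub>R ?a) - f (x + s *\<^sub>R ?a)"
    have "\<exists>z>0. z < t \<and> ?h t - ?h 0 = (t - 0) * (?F (x + t *\<^sub>R ?b + z *\<^sub>R ?a) - ?F (x + z *\<^sub>R ?a))"
    proof (rule MVT2)
      fix s assume s: "0 \<le> s" "s \<le> t"
      have "f differentiable (at (x + t *\<^sub>R ?b + s *\<^sub>R ?a))" "f differentiable (at (x + s *\<^sub>R ?a))"
        using f inS[of s t] inS[of s 0] s t by (simp_all add: ac_simps)
      then show "(?h has_real_derivative ?F (x + t *\<^sub>R ?b + s *\<^sub>R ?a) - ?F (x + s *\<^sub>R ?a)) (at s)"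
        by (intro DERIV_diff has_real_derivative_along_axis)
    qed (use t in simp)
    then obtain z where z: "0 < z" "z < t"
      "?h t - ?h 0 = t * (?F (x + t *\<^sub>R ?b + z *\<^sub>R ?a) - ?F (x + z *\<^sub>R ?a))" by auto
    let ?y1 = "x + t *\<^sub>R ?b + z *\<^sub>R ?a" and ?y2 = "x + z *\<^sub>R ?a"
    have n1: "norm (?y1 - x) \<le> 2 * t" using nrm[of z t] z t by (simp add: add.commute)
    have n2: "norm (?y2 - x) \<le> t" using nrm[of z 0] z t by simp
    \<comment> \<open>The two points lie at distance at most 2 t and t from x, so the two errors
      with factor e/3 add up to e * t.\<close>
    have b1: "\<bar>?F ?y1 - ?F x - ?D (?y1 - x)\<bar> \<le> e/3 * (2 * t)"
      using d1(2)[of ?y1] n1 t e by (smt (verit) divide_nonneg_nonneg field_sum_of_halves mult_left_mono real_norm_def)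
    have b2: "\<bar>?F ?y2 - ?F x - ?D (?y2 - x)\<bar> \<le> e/3 * t"
      using d1(2)[of ?y2] n2 t e by (smt (verit) divide_nonneg_nonneg field_sum_of_halves mult_left_mono real_norm_def)
    have "?D (?y1 - x) - ?D (?y2 - x) = t * ?D ?b"
      using lin by (simp add: linear_add linear_scale linear_diff)
    then have "\<bar>?F ?y1 - ?F ?y2 - t * partial j ?F x\<bar> \<le> e * t"
      using b1 b2 unfolding partial_def[of j ?F] by linarith
    then have "t * \<bar>?F ?y1 - ?F ?y2 - t * partial j ?F x\<bar> \<le> t * (e * t)"
      using t by (intro mult_left_mono) auto
    also have "t * \<bar>?F ?y1 - ?F ?y2 - t * partial j ?F x\<bar>
        = \<bar>(?h t - ?h 0) - t\<^sup>2 * partial j ?F x\<bar>"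
      unfolding z(3) using t by (simp add: abs_mult_pos' right_diff_distrib power2_eq_square mult.assoc)
    also have "(?h t - ?h 0) - t\<^sup>2 * partial j ?F x = f (x + t *\<^sub>R ?a + t *\<^sub>R ?b)
        - f (x + t *\<^sub>R ?a) - f (x + t *\<^sub>R ?b) + f x - t\<^sup>2 * partial j ?F x"
      by (simp add: add.assoc add.commute[of "t *\<^sub>R ?b"])
    finally show "\<bar>f (x + t *\<^sub>R ?a + t *\<^sub>R ?b) - f (x + t *\<^sub>R ?a) - f (x + t *\<^sub>R ?b) + f x
       - t\<^sup>2 * partial j (partial i f) x\<bar> \<le> e * t\<^sup>2"
      by (simp add: power2_eq_square mult.left_commute)
  qed
qed

lemma partial_commute:
  assumes "open S" "smooth_on S f" "x \<in> S"
  shows "partial i (partial j f) x = partial j (partial i f) x"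
proof (rule ccontr)
  let ?p = "partial i (partial j f) x" and ?q = "partial j (partial i f) x"
  assume "?p \<noteq> ?q"
  \<comment> \<open>With a third of the gap the two estimates bound the gap by 2 e, while it equals
    3 e.\<close>
  define e where "e = \<bar>?p - ?q\<bar> / 3"
  have e: "e > 0" using \<open>?p \<noteq> ?q\<close> by (simp add: e_def)
  have D: "f differentiable (at y)" "partial k f differentiable (at y)" if "y \<in> S" for y k
    using assms that smooth_on_differentiable smooth_on_partial by blast+
  obtain d1 where d1: "d1 > 0" "\<And>t. 0 < t \<and> t < d1 \<Longrightarrow>
      \<bar>f (x + t *\<^sub>R axis i 1 + t *\<^sub>R axis j 1) - f (x + t *\<^sub>R axis i 1) - f (x + t *\<^sub>R axis j 1) + f x
       - t\<^sup>2 * ?q\<bar> \<le> e * t\<^sup>2"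
    using second_difference_estimate[OF assms(1,3) D(1) D(2)[OF assms(3)] e] by blast
  obtain d2 where d2: "d2 > 0" "\<And>t. 0 < t \<and> t < d2 \<Longrightarrow>
      \<bar>f (x + t *\<^sub>R axis j 1 + t *\<^sub>R axis i 1) - f (x + t *\<^sub>R axis j 1) - f (x + t *\<^sub>R axis i 1) + f x
       - t\<^sup>2 * ?p\<bar> \<le> e * t\<^sup>2"
    using second_difference_estimate[OF assms(1,3) D(1) D(2)[OF assms(3)] e] by blast
  define t where "t = min d1 d2 / 2"
  have t: "0 < t" "t < d1" "t < d2" using d1 d2 by (auto simp: t_def)
  have "\<bar>t\<^sup>2 * ?p - t\<^sup>2 * ?q\<bar> \<le> 2 * (e * t\<^sup>2)"
    using d1(2)[of t] d2(2)[of t] t by (simp add: ac_simps abs_le_iff)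
  then have "t\<^sup>2 * \<bar>?p - ?q\<bar> \<le> t\<^sup>2 * (2 * e)"
    by (simp add: right_diff_distrib[symmetric] abs_mult ac_simps)
  then have "\<bar>?p - ?q\<bar> \<le> 2 * e" using t by simp
  then show False using e by (simp add: e_def)
qed

section \<open>Curvature identities in a coordinate chart\<close>

lemma matrix_inv_mult:
  fixes A :: "real^3^3"
  assumes "det A \<noteq> 0"
  shows "A ** matrix_inv A = mat 1" "matrix_inv A ** A = mat 1"
proof -
  have "invertible A" using assms by (simp add: invertible_det_nz)
  then have "\<exists>B. A ** B = mat 1 \<and> B ** A = mat 1" unfolding invertible_def .
  then have "A ** matrix_inv A = mat 1 \<and> matrix_inv A ** A = mat 1"
    unfolding matrix_inv_def by (rule someI_ex)
  then show "A ** matrix_inv A = mat 1" "matrix_inv A ** A = mat 1" by auto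
qed

lemma matrix_inv_unique:
  fixes A B :: "real^3^3"
  assumes "det A \<noteq> 0" "A ** B = mat 1"
  shows "matrix_inv A = B"
  by (metis assms matrix_inv_mult(2) matrix_mul_assoc matrix_mul_lid matrix_mul_rid)

definition cyc :: "3 \<Rightarrow> 3" where
  "cyc i = (if i = 1 then 2 else if i = 2 then 3 else 1)"

lemma cyc_simps [simp]: "cyc 1 = 2" "cyc 2 = 3" "cyc 3 = 1"
  by (simp_all add: cyc_def)

text \<open>Advancing rows and columns cyclically builds the sign (-1)^(i+j) into the 2 by 2
  minor.\<close>

definition cofactor3 :: "real^3^3 \<Rightarrow> 3 \<Rightarrow> 3 \<Rightarrow> real" where
  "cofactor3 A i j = A $ cyc i $ cyc j * A $ cyc (cyc i) $ cyc (cyc j)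
     - A $ cyc i $ cyc (cyc j) * A $ cyc (cyc i) $ cyc j"

lemma matrix_inv_cofactor:
  fixes A :: "real^3^3"
  assumes "det A \<noteq> 0"
  shows "matrix_inv A $ i $ j = cofactor3 A j i / det A"
proof -
  let ?B = "\<chi> i j. cofactor3 A j i / det A"
  have "A ** ?B = (\<chi> i j. (\<Sum>k\<in>UNIV. A$i$k * cofactor3 A j k) / det A)"
    by (simp add: matrix_matrix_mult_def sum_divide_distrib)
  also have "\<dots> = (\<chi> i j. (if i = j then det A else 0) / det A)"
  proof -
    have "\<forall>i j. (\<Sum>k\<in>UNIV. A$i$k * cofactor3 A j k) = (if i = j then det A else 0)"
      unfolding forall_3 cofactor3_def sum_3 det_3 by (simp add: algebra_simps)
    then show ?thesis by simp
  qed
  also have "\<dots> = mat 1" using assms by (simp add: mat_def vec_eq_iff)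
  finally have "matrix_inv A = ?B" by (rule matrix_inv_unique[OF assms])
  then show ?thesis by simp
qed

section \<open>Connection and curvature of a metric on an open set\<close>

definition riemann_low :: "local_metric \<Rightarrow> 3 \<Rightarrow> 3 \<Rightarrow> 3 \<Rightarrow> 3 \<Rightarrow> real^3 \<Rightarrow> real" where
  "riemann_low h l k i j x = (\<Sum>m\<in>UNIV. lower h l m x * riemann h m k i j x)"

text \<open>Covariant derivative in direction \<open>p\<close> of the (1,3) curvature tensor. With
  the first index kept raised, the Ricci trace is a plain sum without the metric.\<close>

definition nabla_riemann :: "local_metric \<Rightarrow> 3 \<Rightarrow> 3 \<Rightarrow> 3 \<Rightarrow> 3 \<Rightarrow> 3 \<Rightarrow> real^3 \<Rightarrow> real" where
  "nabla_riemann h p l k i j x = partial p (riemann h l k i j) x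
     + (\<Sum>s\<in>UNIV. christoffel h l p s x * riemann h s k i j x)
     - (\<Sum>s\<in>UNIV. christoffel h s p k x * riemann h l s i j x)
     - (\<Sum>s\<in>UNIV. christoffel h s p i x * riemann h l k s j x)
     - (\<Sum>s\<in>UNIV. christoffel h s p j x * riemann h l k i s x)"

definition nabla1 :: "local_metric \<Rightarrow> 3 \<Rightarrow> (3 \<Rightarrow> real^3 \<Rightarrow> real) \<Rightarrow> 3 \<Rightarrow> real^3 \<Rightarrow> real" where
  "nabla1 h k Y i x = partial k (Y i) x - (\<Sum>m\<in>UNIV. christoffel h m k i x * Y m x)"

locale local_riemannian =
  fixes U :: "(real^3) set" and h :: local_metric
  assumes open_U: "open U"
    and smooth_metric: "smooth_on U (\<lambda>x. h x $ i $ j)"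
    and metric_sym: "x \<in> U \<Longrightarrow> transpose (h x) = h x"
    and metric_nondeg: "x \<in> U \<Longrightarrow> det (h x) \<noteq> 0"
begin

lemma smooth_divide_const: "smooth_on U f \<Longrightarrow> smooth_on U (\<lambda>x. f x / c)"
  unfolding divide_inverse by (intro smooth_on_mult[OF open_U] smooth_on_const)

lemmas smooth_simps = smooth_divide_const smooth_on_add[OF open_U] smooth_on_mult[OF open_U] smooth_on_diff[OF open_U]
  smooth_on_minus[OF open_U] smooth_on_sum[OF open_U] smooth_on_partial smooth_on_const

lemmas differentiable_U = smooth_on_differentiable[of U]

lemma partial_simps:
  assumes "x \<in> U"
  shows "smooth_on U f \<Longrightarrow> smooth_on U g \<Longrightarrow> partial i (\<lambda>x. f x + g x) x = partial i f x + partial i g x"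
    "smooth_on U f \<Longrightarrow> smooth_on U g \<Longrightarrow> partial i (\<lambda>x. f x - g x) x = partial i f x - partial i g x"
    "smooth_on U f \<Longrightarrow> smooth_on U g \<Longrightarrow> partial i (\<lambda>x. f x * g x) x = partial i f x * g x + f x * partial i g x"
    "smooth_on U f \<Longrightarrow> partial i (\<lambda>x. - f x) x = - partial i f x"
    "smooth_on U f \<Longrightarrow> partial i (\<lambda>x. f x / c) x = partial i f x / c"
    "(\<And>j. j \<in> J \<Longrightarrow> smooth_on U (F j)) \<Longrightarrow> partial i (\<lambda>x. \<Sum>j\<in>J. F j x) x = (\<Sum>j\<in>J. partial i (F j) x)"
  using assms by (simp_all add: partial_add partial_diff partial_mult partial_minus partial_sum
    divide_inverse differentiable_U)

lemma partial_cong_U: "x \<in> U \<Longrightarrow> (\<And>y. y \<in> U \<Longrightarrow> f y = g y) \<Longrightarrow> partial i f x = partial i g x"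
  by (rule partial_cong_open[OF open_U])

lemma lower_sym: "x \<in> U \<Longrightarrow> lower h i j x = lower h j i x"
  unfolding lower_def using metric_sym[of x] by (simp add: transpose_def vec_eq_iff)

lemma partial_lower_sym: "x \<in> U \<Longrightarrow> partial k (lower h i j) x = partial k (lower h j i) x"
  by (rule partial_cong_U) (auto intro: lower_sym)

lemma upper_lower: "x \<in> U \<Longrightarrow> (\<Sum>m\<in>UNIV. upper h i m x * lower h m j x) = (if i = j then 1 else 0)"
  using matrix_inv_mult(2)[OF metric_nondeg, of x]
  unfolding upper_def lower_def by (simp add: vec_eq_iff matrix_matrix_mult_def mat_def)

lemma lower_upper: "x \<in> U \<Longrightarrow> (\<Sum>m\<in>UNIV. lower h i m x * upper h m j x) = (if i = j then 1 else 0)"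
  using matrix_inv_mult(1)[OF metric_nondeg, of x]
  unfolding upper_def lower_def by (simp add: vec_eq_iff matrix_matrix_mult_def mat_def)

lemma upper_sym:
  assumes "x \<in> U" shows "upper h i j x = upper h j i x"
proof -
  have s: "h x $ i $ j = h x $ j $ i" for i j
    using lower_sym[OF assms] unfolding lower_def .
  show ?thesis
    unfolding upper_def matrix_inv_cofactor[OF metric_nondeg[OF assms]] cofactor3_def
      s[of "cyc i"] s[of "cyc (cyc i)"] by (simp add: mult.commute)
qed

lemma smooth_lower: "smooth_on U (lower h i j)"
  using smooth_metric unfolding lower_def .

text \<open>By Cramer's rule the entries are polynomials in those of the metric divided by the
  nonvanishing determinant.\<close>

lemma smooth_upper: "smooth_on U (upper h i j)"
proof -
  have "smooth_on U (\<lambda>x. cofactor3 (h x) j i / det (h x))"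
    unfolding det_3 cofactor3_def
    by (intro smooth_on_divide[OF open_U] smooth_simps smooth_metric)
       (use metric_nondeg in \<open>simp add: det_3\<close>)
  then show ?thesis
    by (rule smooth_on_cong[OF open_U, rotated])
       (simp add: upper_def matrix_inv_cofactor metric_nondeg)
qed

lemma smooth_christoffel: "smooth_on U (christoffel h k i j)"
  unfolding christoffel_def by (intro smooth_simps smooth_lower smooth_upper)

lemma smooth_riemann: "smooth_on U (riemann h l k i j)"
  unfolding riemann_def by (intro smooth_simps smooth_christoffel)

lemma smooth_ricci: "smooth_on U (ricci h i j)"
  unfolding ricci_def by (intro smooth_simps smooth_riemann)

lemma smooth_scalar_curv: "smooth_on U (scalar_curv h)"
  unfolding scalar_curv_def by (intro smooth_simps smooth_ricci smooth_upper)

lemma smooth_schouten: "smooth_on U (schouten h i j)"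
  unfolding schouten_def
  by (intro smooth_simps smooth_ricci smooth_lower smooth_scalar_curv)

lemma smooth_nabla2:
  assumes "\<And>i j. smooth_on U (T i j)"
  shows "smooth_on U (nabla2 h k T i j)"
  unfolding nabla2_def by (intro smooth_simps smooth_christoffel assms)

lemma smooth_nabla1:
  assumes "\<And>i. smooth_on U (Y i)"
  shows "smooth_on U (nabla1 h k Y i)"
  unfolding nabla1_def by (intro smooth_simps smooth_christoffel assms)

lemma smooth_cotton: "smooth_on U (cotton h i j k)"
  unfolding cotton_def by (intro smooth_simps smooth_nabla2 smooth_schouten)

lemmas smooth_all = smooth_lower smooth_upper smooth_christoffel smooth_riemann smooth_ricci
  smooth_scalar_curv smooth_schouten smooth_cotton

text \<open>Lowering and then raising an index. The array \<open>A\<close> is arbitrary, so the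
  other indices of a tensor can be frozen inside it; many later contractions go through this form or
  its mirror image.\<close>

lemma contract_lower_upper:
  assumes "x \<in> U"
  shows "(\<Sum>j\<in>UNIV. (\<Sum>m\<in>UNIV. A m * lower h m j x) * upper h j a x) = A a"
proof -
  have "(\<Sum>j\<in>UNIV. (\<Sum>m\<in>UNIV. A m * lower h m j x) * upper h j a x)
      = (\<Sum>j\<in>UNIV. \<Sum>m\<in>UNIV. A m * (lower h m j x * upper h j a x))"
    by (simp add: sum_distrib_right mult.assoc)
  also have "\<dots> = (\<Sum>m\<in>UNIV. A m * (\<Sum>j\<in>UNIV. lower h m j x * upper h j a x))"
    by (subst sum.swap) (simp add: sum_distrib_left)
  finally show ?thesis using assms by (simp add: lower_upper mult_delta_right)
qed

lemma contract_upper_lower: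
  assumes "x \<in> U"
  shows "(\<Sum>j\<in>UNIV. (\<Sum>m\<in>UNIV. A m * upper h m j x) * lower h j a x) = A a"
proof -
  have "(\<Sum>j\<in>UNIV. (\<Sum>m\<in>UNIV. A m * upper h m j x) * lower h j a x)
      = (\<Sum>j\<in>UNIV. \<Sum>m\<in>UNIV. A m * (upper h m j x * lower h j a x))"
    by (simp add: sum_distrib_right mult.assoc)
  also have "\<dots> = (\<Sum>m\<in>UNIV. A m * (\<Sum>j\<in>UNIV. upper h m j x * lower h j a x))"
    by (subst sum.swap) (simp add: sum_distrib_left)
  finally show ?thesis using assms by (simp add: upper_lower mult_delta_right)
qed

lemma christoffel_sym: "x \<in> U \<Longrightarrow> christoffel h k i j x = christoffel h k j i x"
  unfolding christoffel_def by (simp add: partial_lower_sym[of x _ i j] add.commute)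

lemma partial_christoffel_sym:
  "x \<in> U \<Longrightarrow> partial l (christoffel h k i j) x = partial l (christoffel h k j i) x"
  by (rule partial_cong_U) (auto intro: christoffel_sym)

lemma christoffel_lower:
  assumes "x \<in> U"
  shows "(\<Sum>m\<in>UNIV. christoffel h m k i x * lower h m j x)
    = (1/2) * (partial k (lower h i j) x + partial i (lower h k j) x - partial j (lower h k i) x)"
proof -
  let ?X = "\<lambda>l. (1/2) * (partial k (lower h i l) x + partial i (lower h k l) x - partial l (lower h k i) x)"
  have "christoffel h m k i x = (\<Sum>l\<in>UNIV. ?X l * upper h l m x)" for m
    unfolding christoffel_def sum_distrib_left
    by (intro sum.cong refl) (simp add: upper_sym[OF assms, of m] mult.left_commute)
  then show ?thesis using contract_upper_lower[OF assms, of ?X j] by simp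
qed

text \<open>Metric compatibility: in the sum of the two Christoffel symbols with lowered index, all
  metric derivatives except those in direction \<open>k\<close> cancel.\<close>

lemma partial_lower:
  assumes "x \<in> U"
  shows "partial k (lower h i j) x = (\<Sum>m\<in>UNIV. christoffel h m k i x * lower h m j x)
    + (\<Sum>m\<in>UNIV. christoffel h m k j x * lower h m i x)"
  unfolding christoffel_lower[OF assms] by (simp add: partial_lower_sym[OF assms, of _ j i] field_simps)

text \<open>The dual of \<open>partial_lower\<close>. Differentiating the constant product of
  inverse and metric gives it with index \<open>b\<close> still lowered (\<open>eq\<close>); that
  index is raised afterwards.\<close>

lemma partial_upper:
  assumes "x \<in> U"
  shows "partial k (upper h i j) x = - (\<Sum>m\<in>UNIV. christoffel h i k m x * upper h m j x)
    - (\<Sum>m\<in>UNIV. christoffel h j k m x * upper h i m x)"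
proof -
  have eq: "(\<Sum>m\<in>UNIV. partial k (upper h i m) x * lower h m b x)
      = - (\<Sum>m\<in>UNIV. (\<Sum>n\<in>UNIV. christoffel h m k n x * upper h i n x) * lower h m b x)
        - christoffel h i k b x" for b
  proof -
    have "0 = partial k (\<lambda>y. \<Sum>m\<in>UNIV. upper h i m y * lower h m b y) x"
      using partial_cong_U[OF assms, of _ "\<lambda>_. if i = b then 1 else 0" k] upper_lower by simp
    also have "\<dots> = (\<Sum>m\<in>UNIV. partial k (upper h i m) x * lower h m b x)
        + (\<Sum>m\<in>UNIV. upper h i m x * partial k (lower h m b) x)"
      using assms by (simp add: partial_simps smooth_simps smooth_all sum.distrib)
    also have "(\<Sum>m\<in>UNIV. upper h i m x * partial k (lower h m b) x)
        = (\<Sum>m\<in>UNIV. upper h i m x * (\<Sum>n\<in>UNIV. christoffel h n k m x * lower h n b x))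
          + (\<Sum>m\<in>UNIV. upper h i m x * (\<Sum>n\<in>UNIV. christoffel h n k b x * lower h n m x))"
      using assms by (simp add: partial_lower sum.distrib distrib_left)
    also have "(\<Sum>m\<in>UNIV. upper h i m x * (\<Sum>n\<in>UNIV. christoffel h n k b x * lower h n m x))
        = christoffel h i k b x"
      using contract_lower_upper[OF assms, of "\<lambda>n. christoffel h n k b x" i]
      by (simp add: mult.commute upper_sym[OF assms, of i])
    also have "(\<Sum>m\<in>UNIV. upper h i m x * (\<Sum>n\<in>UNIV. christoffel h n k m x * lower h n b x))
        = (\<Sum>m\<in>UNIV. (\<Sum>n\<in>UNIV. christoffel h m k n x * upper h i n x) * lower h m b x)"
      by (simp add: sum_3 algebra_simps)
    finally show ?thesis by simp
  qed
  have "partial k (upper h i j) x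
      = (\<Sum>b\<in>UNIV. (\<Sum>m\<in>UNIV. partial k (upper h i m) x * lower h m b x) * upper h b j x)"
    using contract_lower_upper[OF assms, of "\<lambda>m. partial k (upper h i m) x" j] by simp
  also have "\<dots> = - (\<Sum>b\<in>UNIV. (\<Sum>m\<in>UNIV. (\<Sum>n\<in>UNIV. christoffel h m k n x * upper h i n x) * lower h m b x) * upper h b j x)
      - (\<Sum>b\<in>UNIV. christoffel h i k b x * upper h b j x)"
    unfolding eq by (simp add: left_diff_distrib sum_subtractf sum_negf)
  also have "(\<Sum>b\<in>UNIV. (\<Sum>m\<in>UNIV. (\<Sum>n\<in>UNIV. christoffel h m k n x * upper h i n x) * lower h m b x) * upper h b j x)
      = (\<Sum>m\<in>UNIV. christoffel h j k m x * upper h i m x)"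
    by (rule contract_lower_upper[OF assms])
  finally show ?thesis by simp
qed

section \<open>Symmetries of the Riemann tensor\<close>

lemma riemann_skew: "riemann h l k j i x = - riemann h l k i j x"
  unfolding riemann_def by (simp add: sum_subtractf)

lemma riemann_bianchi1:
  assumes "x \<in> U"
  shows "riemann h l k i j x + riemann h l i j k x + riemann h l j k i x = 0"
  using assms unfolding riemann_def sum_3
  by (simp add: christoffel_sym[OF assms, of _ k] christoffel_sym[OF assms, of _ j i]
       partial_christoffel_sym[OF assms, of _ _ k]  partial_christoffel_sym[OF assms, of _ _ j i])

text \<open>Second derivatives of \<open>lower h l k\<close> are expanded by metric compatibility.
  Equality of the two orders of differentiation is then exactly the vanishing of R_lkij +
  R_klij.\<close>

lemma riemann_low_skew1:
  assumes "x \<in> U"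
  shows "riemann_low h k l i j x = - riemann_low h l k i j x"
proof -
  have D: "partial i (partial j (lower h l k)) x =
     (\<Sum>m\<in>UNIV. partial i (christoffel h m j l) x * lower h m k x + christoffel h m j l x * partial i (lower h m k) x)
   + (\<Sum>m\<in>UNIV. partial i (christoffel h m j k) x * lower h m l x + christoffel h m j k x * partial i (lower h m l) x)"
    for i j
  proof -
    have "partial i (partial j (lower h l k)) x = partial i (\<lambda>x. (\<Sum>m\<in>UNIV. christoffel h m j l x * lower h m k x)
      + (\<Sum>m\<in>UNIV. christoffel h m j k x * lower h m l x)) x"
      by (rule partial_cong_U[OF assms]) (rule partial_lower)
    then show ?thesis using assms by (simp add: partial_simps smooth_simps smooth_all)
  qed
  have s: "lower h k 1 x = lower h 1 k x" "lower h k 2 x = lower h 2 k x" "lower h k 3 x = lower h 3 k x"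
    "lower h l 1 x = lower h 1 l x" "lower h l 2 x = lower h 2 l x" "lower h l 3 x = lower h 3 l x"
    "lower h 2 1 x = lower h 1 2 x" "lower h 3 1 x = lower h 1 3 x" "lower h 3 2 x = lower h 2 3 x"
    using lower_sym[OF assms] by blast+
  have "partial i (partial j (lower h l k)) x = partial j (partial i (lower h l k)) x"
    by (rule partial_commute[OF open_U smooth_lower assms])
  then show ?thesis
    unfolding D partial_lower[OF assms] riemann_low_def riemann_def sum_3 s
    by (simp only: algebra_simps)
qed

lemma riemann_low_skew2: "riemann_low h l k j i x = - riemann_low h l k i j x"
  unfolding riemann_low_def by (simp add: riemann_skew[of l k j i] riemann_skew[of _ k j i] sum_negf)

lemma riemann_low_bianchi1:
  assumes "x \<in> U"
  shows "riemann_low h l k i j x + riemann_low h l i j k x + riemann_low h l j k i x = 0"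
  unfolding riemann_low_def sum.distrib[symmetric] distrib_left[symmetric]
  using riemann_bianchi1[OF assms] by simp

text \<open>A linear combination of four cyclic identities, one for each rotation of the four
  indices; skewness in both pairs cancels all other terms.\<close>

lemma riemann_low_pair:
  assumes "x \<in> U"
  shows "riemann_low h l k i j x = riemann_low h i j l k x"
  using riemann_low_bianchi1[OF assms, of l k i j] riemann_low_bianchi1[OF assms, of k i j l]
    riemann_low_bianchi1[OF assms, of i j l k] riemann_low_bianchi1[OF assms, of j l k i]
    riemann_low_skew1[OF assms] riemann_low_skew2[of _ _ _ _ x]
  by (smt (verit))

end

text \<open>The commutator of covariant derivatives with components and partial derivatives replaced
  by independent reals: first derivatives of \<open>T\<close> cancel, and the Christoffel terms
  regroup into the curvature. Second partial derivatives of \<open>T\<close> are left out, since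
  they cancel by symmetry where this is applied.\<close>

lemma ricci_identity2_algebra:
  fixes G dT :: "3 \<Rightarrow> 3 \<Rightarrow> 3 \<Rightarrow> real" and dG :: "3 \<Rightarrow> 3 \<Rightarrow> 3 \<Rightarrow> 3 \<Rightarrow> real"
    and T :: "3 \<Rightarrow> 3 \<Rightarrow> real"
  assumes N: "\<And>k i j. N k i j = dT k i j - (\<Sum>m\<in>UNIV. G m k i * T m j) - (\<Sum>m\<in>UNIV. G m k j * T i m)"
    and sym: "\<And>m. G m l k = G m k l"
  shows "- (\<Sum>m\<in>UNIV. dG l m k i * T m j + G m k i * dT l m j) - (\<Sum>m\<in>UNIV. dG l m k j * T i m + G m k j * dT l i m)
      - (\<Sum>m\<in>UNIV. G m l i * N k m j) - (\<Sum>m\<in>UNIV. G m l j * N k i m) - (\<Sum>m\<in>UNIV. G m l k * N m i j)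
    - (- (\<Sum>m\<in>UNIV. dG k m l i * T m j + G m l i * dT k m j) - (\<Sum>m\<in>UNIV. dG k m l j * T i m + G m l j * dT k i m)
      - (\<Sum>m\<in>UNIV. G m k i * N l m j) - (\<Sum>m\<in>UNIV. G m k j * N l i m) - (\<Sum>m\<in>UNIV. G m k l * N m i j))
   = - (\<Sum>m\<in>UNIV. (dG l m k i - dG k m l i + (\<Sum>n\<in>UNIV. G m l n * G n k i - G m k n * G n l i)) * T m j)
     - (\<Sum>m\<in>UNIV. (dG l m k j - dG k m l j + (\<Sum>n\<in>UNIV. G m l n * G n k j - G m k n * G n l j)) * T i m)"
  unfolding N sum_3 sym by (simp only: algebra_simps)

lemma cotton_skew: "cotton h i k j x = - cotton h i j k x"
  unfolding cotton_def by simp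

section \<open>The second Bianchi identity and its traces\<close>

context local_riemannian begin

lemma partial_riemann:
  assumes "x \<in> U"
  shows "partial p (riemann h l k i j) x =
     partial p (partial i (christoffel h l j k)) x - partial p (partial j (christoffel h l i k)) x
     + (\<Sum>m\<in>UNIV. (partial p (christoffel h l i m) x * christoffel h m j k x
                  + christoffel h l i m x * partial p (christoffel h m j k) x)
                 - (partial p (christoffel h l j m) x * christoffel h m i k x
                  + christoffel h l j m x * partial p (christoffel h m i k) x))"
  unfolding riemann_def[abs_def] using assms
  by (simp add: partial_simps smooth_simps smooth_all)

text \<open>Only \<open>l\<close> and \<open>k\<close> carry connection terms: this is the Bianchi
  identity for the curvature as an endomorphism-valued 2-form. Second derivatives of the Christoffel
  symbols commute, and the remaining products cancel in the cyclic sum.\<close>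

lemma riemann_bianchi2_aux:
  assumes "x \<in> U"
  defines "B \<equiv> \<lambda>p l k i j. partial p (riemann h l k i j) x
     + (\<Sum>s\<in>UNIV. christoffel h l p s x * riemann h s k i j x)
     - (\<Sum>s\<in>UNIV. christoffel h s p k x * riemann h l s i j x)"
  shows "B p l k i j + B i l k j p + B j l k p i = 0"
proof -
  note pc = partial_commute[OF open_U smooth_christoffel assms(1)]
  show ?thesis
    unfolding B_def partial_riemann[OF assms(1)] pc[of j i] pc[of p i] pc[of p j]
      riemann_def sum_3
    by (simp only: algebra_simps)
qed

lemma riemann_bianchi2:
  assumes "x \<in> U"
  shows "nabla_riemann h p l k i j x + nabla_riemann h i l k j p x + nabla_riemann h j l k p i x = 0"
proof -
  have c: "christoffel h s j i x = christoffel h s i j x" "christoffel h s p i x = christoffel h s i p x"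
    "christoffel h s p j x = christoffel h s j p x" for s
    using christoffel_sym[OF assms] by blast+
  have r: "riemann h l k s i x = - riemann h l k i s x" "riemann h l k s j x = - riemann h l k j s x"
    "riemann h l k s p x = - riemann h l k p s x" for s
    by (rule riemann_skew)+
  \<comment> \<open>The connection terms for the form indices cancel in pairs: the Christoffel
    symbols are symmetric and the curvature is skew in these indices.\<close>
  have "(\<Sum>s\<in>UNIV. christoffel h s p i x * riemann h l k s j x) + (\<Sum>s\<in>UNIV. christoffel h s p j x * riemann h l k i s x)
      + (\<Sum>s\<in>UNIV. christoffel h s i j x * riemann h l k s p x) + (\<Sum>s\<in>UNIV. christoffel h s i p x * riemann h l k j s x)
      + (\<Sum>s\<in>UNIV. christoffel h s j p x * riemann h l k s i x) + (\<Sum>s\<in>UNIV. christoffel h s j i x * riemann h l k p s x) = 0"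
    unfolding c sum.distrib[symmetric] by (rule sum.neutral) (simp add: r(1) r(2) r(3))
  then show ?thesis
    using riemann_bianchi2_aux[OF assms, of p l k i j] unfolding nabla_riemann_def by linarith
qed

lemma nabla_riemann_skew:
  assumes "x \<in> U"
  shows "nabla_riemann h p l k j i x = - nabla_riemann h p l k i j x"
proof -
  have "partial p (riemann h l k j i) x = partial p (\<lambda>x. - riemann h l k i j x) x"
    by (rule partial_cong_U[OF assms]) (rule riemann_skew)
  then have "partial p (riemann h l k j i) x = - partial p (riemann h l k i j) x"
    using assms by (simp add: partial_simps smooth_all)
  then show ?thesis
    unfolding nabla_riemann_def
    by (simp add: riemann_skew[of _ _ j] riemann_skew[of _ _ _ i] sum_negf)
qed

text \<open>Tracing an upper against a lower index commutes with the derivative, since their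
  connection terms are equal with opposite signs.\<close>

lemma nabla_riemann_trace:
  assumes "x \<in> U"
  shows "(\<Sum>l\<in>UNIV. nabla_riemann h p l k l j x) = nabla2 h p (ricci h) j k x"
proof -
  have "partial p (ricci h j k) x = (\<Sum>i\<in>UNIV. partial p (riemann h i k i j) x)"
    unfolding ricci_def[abs_def] using assms by (simp add: partial_simps smooth_all)
  then show ?thesis
    unfolding nabla_riemann_def nabla2_def sum_3 ricci_def
    by (simp add: algebra_simps)
qed

lemma smooth_riemann_low: "smooth_on U (riemann_low h l k i j)"
  unfolding riemann_low_def by (intro smooth_simps smooth_all)

text \<open>Metric compatibility lets the metric pass through the derivative. Skewness in the first
  pair, visible only with all indices lowered, can then be carried over to the derivative of the
  curvature.\<close>

lemma nabla_riemann_lower: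
  assumes "x \<in> U"
  shows "(\<Sum>l\<in>UNIV. lower h s l x * nabla_riemann h p l k i j x) =
     partial p (riemann_low h s k i j) x
     - (\<Sum>t\<in>UNIV. christoffel h t p s x * riemann_low h t k i j x)
     - (\<Sum>t\<in>UNIV. christoffel h t p k x * riemann_low h s t i j x)
     - (\<Sum>t\<in>UNIV. christoffel h t p i x * riemann_low h s k t j x)
     - (\<Sum>t\<in>UNIV. christoffel h t p j x * riemann_low h s k i t x)"
proof -
  have "partial p (riemann_low h s k i j) x =
     (\<Sum>m\<in>UNIV. partial p (lower h s m) x * riemann h m k i j x + lower h s m x * partial p (riemann h m k i j) x)"
    unfolding riemann_low_def[abs_def] using assms by (simp add: partial_simps smooth_simps smooth_all)
  moreover have s: "lower h 1 s x = lower h s 1 x" "lower h 2 s x = lower h s 2 x" "lower h 3 s x = lower h s 3 x"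
    "lower h 2 1 x = lower h 1 2 x" "lower h 3 1 x = lower h 1 3 x" "lower h 3 2 x = lower h 2 3 x"
    using lower_sym[OF assms] by blast+
  ultimately show ?thesis
    unfolding partial_lower[OF assms] nabla_riemann_def riemann_low_def sum_3 s
    by (simp add: algebra_simps)
qed

lemma nabla_riemann_low_skew:
  assumes "x \<in> U"
  shows "(\<Sum>l\<in>UNIV. lower h s l x * nabla_riemann h p l k i j x)
       = - (\<Sum>l\<in>UNIV. lower h k l x * nabla_riemann h p l s i j x)"
proof -
  have "partial p (riemann_low h s k i j) x = partial p (\<lambda>x. - riemann_low h k s i j x) x"
    by (rule partial_cong_U[OF assms]) (rule riemann_low_skew1)
  then have "partial p (riemann_low h s k i j) x = - partial p (riemann_low h k s i j) x"
    using assms by (simp add: partial_simps smooth_riemann_low)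
  then show ?thesis
    unfolding nabla_riemann_lower[OF assms]
    by (simp add: riemann_low_skew1[OF assms, of _ s] riemann_low_skew1[OF assms, of k] sum_negf)
qed

text \<open>A metric trace over the second and third index is not the Ricci trace. Lowering the
  first index and exchanging it with the second by skewness makes it one, at the price of the
  sign.\<close>

lemma nabla_riemann_upper_trace:
  assumes "x \<in> U"
  shows "(\<Sum>k\<in>UNIV. \<Sum>j\<in>UNIV. upper h k j x * nabla_riemann h p l k j m x)
    = - (\<Sum>s\<in>UNIV. upper h l s x * nabla2 h p (ricci h) m s x)"
proof -
  let ?N = "\<lambda>l k j. nabla_riemann h p l k j m x"
  have N: "?N l k j = - (\<Sum>s\<in>UNIV. upper h l s x * (\<Sum>t\<in>UNIV. lower h k t x * ?N t s j))" for k j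
  proof -
    have "?N l k j = (\<Sum>s\<in>UNIV. (\<Sum>t\<in>UNIV. ?N t k j * lower h t s x) * upper h s l x)"
      using contract_lower_upper[OF assms, of "\<lambda>t. ?N t k j" l] by simp
    also have "\<dots> = (\<Sum>s\<in>UNIV. (\<Sum>t\<in>UNIV. lower h s t x * ?N t k j) * upper h s l x)"
      by (simp add: lower_sym[OF assms] mult.commute)
    also have "\<dots> = - (\<Sum>s\<in>UNIV. upper h l s x * (\<Sum>t\<in>UNIV. lower h k t x * ?N t s j))"
      unfolding nabla_riemann_low_skew[OF assms, of _ _ k]
      by (simp add: sum_negf upper_sym[OF assms, of l] mult.commute)
    finally show ?thesis .
  qed
  have "(\<Sum>k\<in>UNIV. \<Sum>j\<in>UNIV. upper h k j x * ?N l k j)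
     = - (\<Sum>k\<in>UNIV. \<Sum>j\<in>UNIV. \<Sum>s\<in>UNIV. \<Sum>t\<in>UNIV. upper h l s x * (?N t s j * lower h t k x * upper h k j x))"
    by (subst N) (simp add: sum_distrib_left sum_negf lower_sym[OF assms] ac_simps)
  also have "\<dots> = - (\<Sum>s\<in>UNIV. upper h l s x * (\<Sum>j\<in>UNIV. \<Sum>k\<in>UNIV. (\<Sum>t\<in>UNIV. ?N t s j * lower h t k x) * upper h k j x))"
    unfolding sum_3 by (simp only: algebra_simps)
  finally show ?thesis
    by (simp add: contract_lower_upper[OF assms] nabla_riemann_trace[OF assms])
qed

lemma partial_trace:
  assumes "x \<in> U" "\<And>i j. smooth_on U (T i j)"
  shows "partial p (\<lambda>x. \<Sum>i\<in>UNIV. \<Sum>j\<in>UNIV. upper h i j x * T i j x) x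
    = (\<Sum>i\<in>UNIV. \<Sum>j\<in>UNIV. upper h i j x * nabla2 h p T i j x)"
proof -
  have "partial p (\<lambda>x. \<Sum>i\<in>UNIV. \<Sum>j\<in>UNIV. upper h i j x * T i j x) x =
     (\<Sum>i\<in>UNIV. \<Sum>j\<in>UNIV. partial p (upper h i j) x * T i j x + upper h i j x * partial p (T i j) x)"
    using assms by (simp add: partial_simps smooth_simps smooth_all)
  then show ?thesis
    unfolding partial_upper[OF assms(1)] nabla2_def sum_3 by (simp add: algebra_simps)
qed

lemma riemann_raise:
  assumes "x \<in> U"
  shows "riemann h l k i j x = (\<Sum>s\<in>UNIV. upper h l s x * riemann_low h s k i j x)"
  using contract_lower_upper[OF assms, of "\<lambda>t. riemann h t k i j x" l]
  unfolding riemann_low_def by (simp add: lower_sym[OF assms, of _] upper_sym[OF assms, of l] mult.commute)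

lemma ricci_low:
  assumes "x \<in> U"
  shows "ricci h j k x = (\<Sum>i\<in>UNIV. \<Sum>s\<in>UNIV. upper h i s x * riemann_low h s k i j x)"
  unfolding ricci_def riemann_raise[OF assms] ..

lemma ricci_sym:
  assumes "x \<in> U"
  shows "ricci h i j x = ricci h j i x"
proof -
  have "ricci h i j x = (\<Sum>a\<in>UNIV. \<Sum>s\<in>UNIV. upper h a s x * riemann_low h a i s j x)"
    unfolding ricci_low[OF assms] by (subst riemann_low_pair[OF assms]) simp
  also have "\<dots> = ricci h j i x"
    unfolding ricci_low[OF assms] by (subst sum.swap) (simp add: upper_sym[OF assms])
  finally show ?thesis .
qed

lemma schouten_sym: "x \<in> U \<Longrightarrow> schouten h i j x = schouten h j i x"
  unfolding schouten_def by (simp add: ricci_sym[of x i j] lower_sym[of x i j])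

lemma nabla2_sym:
  assumes "x \<in> U" "\<And>y i j. y \<in> U \<Longrightarrow> T i j y = T j i y"
  shows "nabla2 h k T i j x = nabla2 h k T j i x"
proof -
  have "partial k (T i j) x = partial k (T j i) x"
    by (rule partial_cong_U[OF assms(1) assms(2)])
  then show ?thesis
    unfolding nabla2_def by (simp add: assms(2)[OF assms(1), of i] assms(2)[OF assms(1), of _ j])
qed

lemma nabla2_lower: "x \<in> U \<Longrightarrow> nabla2 h k (lower h) i j x = 0"
  unfolding nabla2_def by (simp add: partial_lower lower_sym[of x i])

text \<open>The twice contracted Bianchi identity: of the three cyclic terms, one gives the
  derivative of the scalar curvature and each of the other two gives minus the divergence of
  Ricci.\<close>

lemma partial_scalar_curv:
  assumes "x \<in> U"
  shows "partial p (scalar_curv h) x = 2 * (\<Sum>l\<in>UNIV. \<Sum>s\<in>UNIV. upper h l s x * nabla2 h l (ricci h) p s x)"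
proof -
  let ?d = "\<Sum>l\<in>UNIV. \<Sum>s\<in>UNIV. upper h l s x * nabla2 h l (ricci h) p s x"
  have "0 = (\<Sum>k\<in>UNIV. \<Sum>j\<in>UNIV. upper h k j x * (\<Sum>l\<in>UNIV.
      nabla_riemann h p l k l j x + nabla_riemann h l l k j p x + nabla_riemann h j l k p l x))"
    by (simp add: riemann_bianchi2[OF assms])
  also have "\<dots> = (\<Sum>k\<in>UNIV. \<Sum>j\<in>UNIV. upper h k j x * (\<Sum>l\<in>UNIV. nabla_riemann h p l k l j x))
     + (\<Sum>l\<in>UNIV. \<Sum>k\<in>UNIV. \<Sum>j\<in>UNIV. upper h k j x * nabla_riemann h l l k j p x)
     - (\<Sum>k\<in>UNIV. \<Sum>j\<in>UNIV. upper h k j x * (\<Sum>l\<in>UNIV. nabla_riemann h j l k l p x))"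
    unfolding nabla_riemann_skew[OF assms, of _ _ _ p] sum_3 by (simp only: algebra_simps)
  also have "(\<Sum>k\<in>UNIV. \<Sum>j\<in>UNIV. upper h k j x * (\<Sum>l\<in>UNIV. nabla_riemann h p l k l j x)) = partial p (scalar_curv h) x"
    unfolding nabla_riemann_trace[OF assms] scalar_curv_def[abs_def]
    using partial_trace[OF assms smooth_ricci, of p] nabla2_sym[OF assms ricci_sym] by simp
  also have "(\<Sum>k\<in>UNIV. \<Sum>j\<in>UNIV. upper h k j x * (\<Sum>l\<in>UNIV. nabla_riemann h j l k l p x)) = ?d"
    unfolding nabla_riemann_trace[OF assms] by (subst sum.swap) (simp add: upper_sym[OF assms])
  also have "(\<Sum>l\<in>UNIV. \<Sum>k\<in>UNIV. \<Sum>j\<in>UNIV. upper h k j x * nabla_riemann h l l k j p x) = - ?d"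
    unfolding nabla_riemann_upper_trace[OF assms] by (simp add: sum_negf)
  finally show ?thesis by simp
qed

lemma nabla2_schouten:
  assumes "x \<in> U"
  shows "nabla2 h k (schouten h) i j x = nabla2 h k (ricci h) i j x - partial k (scalar_curv h) x / 4 * lower h i j x"
proof -
  have "partial k (schouten h i j) x = partial k (ricci h i j) x
     - (partial k (scalar_curv h) x * lower h i j x + scalar_curv h x * partial k (lower h i j) x) / 4"
    unfolding schouten_def[abs_def] using assms
    by (simp add: partial_simps smooth_simps smooth_all)
  then show ?thesis
    unfolding partial_lower[OF assms] nabla2_def schouten_def sum_3
    by (simp add: lower_sym[OF assms, of i] field_simps)
qed

lemma cotton_cyclic:
  assumes "x \<in> U"
  shows "cotton h i j k x + cotton h j k i x + cotton h k i j x = 0"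
  unfolding cotton_def using nabla2_sym[OF assms schouten_sym, where i=j and j=i]
    nabla2_sym[OF assms schouten_sym, where i=k and j=i] nabla2_sym[OF assms schouten_sym, where i=k and j=j]
  by simp

text \<open>The divergence of \<open>P\<close> is dR/2 - dR/4 and the differential of its trace is
  dR - 3 dR/4. Both equal dR/4, and the trace of \<open>cotton\<close> is their difference.\<close>

lemma cotton_trace:
  assumes "x \<in> U"
  shows "(\<Sum>i\<in>UNIV. \<Sum>k\<in>UNIV. upper h i k x * cotton h i j k x) = 0"
proof -
  have a: "(\<Sum>i\<in>UNIV. \<Sum>k\<in>UNIV. upper h i k x * nabla2 h k (ricci h) i j x) = partial j (scalar_curv h) x / 2"
    unfolding partial_scalar_curv[OF assms]
    by (subst sum.swap) (simp add: upper_sym[OF assms] nabla2_sym[OF assms ricci_sym, where j=j])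
  have b: "(\<Sum>i\<in>UNIV. \<Sum>k\<in>UNIV. upper h i k x * nabla2 h j (ricci h) i k x) = partial j (scalar_curv h) x"
    unfolding scalar_curv_def[abs_def] using partial_trace[OF assms smooth_ricci, of j] by simp
  have c: "(\<Sum>i\<in>UNIV. \<Sum>k\<in>UNIV. upper h i k x * (partial k (scalar_curv h) x / 4 * lower h i j x)) = partial j (scalar_curv h) x / 4"
    using contract_upper_lower[OF assms, of "\<lambda>k. partial k (scalar_curv h) x / 4" j]
    by (simp add: sum_distrib_right upper_sym[OF assms] mult.assoc mult.left_commute)
  have d: "(\<Sum>i\<in>UNIV. \<Sum>k\<in>UNIV. upper h i k x * (c * lower h i k x)) = 3 * c" for c
  proof -
    have "(\<Sum>i\<in>UNIV. \<Sum>k\<in>UNIV. upper h i k x * (c * lower h i k x))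
        = c * (\<Sum>i\<in>UNIV. \<Sum>k\<in>UNIV. upper h i k x * lower h k i x)"
      by (simp add: sum_distrib_left lower_sym[OF assms] mult.left_commute)
    then show ?thesis by (simp add: upper_lower[OF assms])
  qed
  show ?thesis
    unfolding cotton_def nabla2_schouten[OF assms]
    using a b c d[of "partial j (scalar_curv h) x / 4"]
    by (simp add: right_diff_distrib sum_subtractf)
qed

section \<open>Commutators of covariant derivatives\<close>

lemma ricci_identity1:
  assumes "x \<in> U" "\<And>i. smooth_on U (Y i)"
  shows "nabla2 h l (\<lambda>i k. nabla1 h k Y i) i k x - nabla2 h k (\<lambda>i k. nabla1 h k Y i) i l x
    = - (\<Sum>m\<in>UNIV. riemann h m i l k x * Y m x)"
proof -
  have D: "partial l (nabla1 h k Y i) x = partial l (partial k (Y i)) x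
    - (\<Sum>m\<in>UNIV. partial l (christoffel h m k i) x * Y m x + christoffel h m k i x * partial l (Y m) x)" for l k i
    unfolding nabla1_def[abs_def] using assms by (simp add: partial_simps smooth_simps smooth_all)
  show ?thesis
    unfolding nabla2_def D nabla1_def riemann_def sum_3 partial_commute[OF open_U assms(2,1), of l k]
      christoffel_sym[OF assms(1), of _ l k]
    by (simp only: algebra_simps)
qed

lemma ricci_identity2:
  assumes "x \<in> U" "\<And>i j. smooth_on U (T i j)"
  shows "nabla3 h l (\<lambda>i j k. nabla2 h k T i j) i j k x - nabla3 h k (\<lambda>i j k. nabla2 h k T i j) i j l x
    = - (\<Sum>m\<in>UNIV. riemann h m i l k x * T m j x) - (\<Sum>m\<in>UNIV. riemann h m j l k x * T i m x)"
proof -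
  have D: "partial l (nabla2 h k T i j) x = partial l (partial k (T i j)) x
    - (\<Sum>m\<in>UNIV. partial l (christoffel h m k i) x * T m j x + christoffel h m k i x * partial l (T m j) x)
    - (\<Sum>m\<in>UNIV. partial l (christoffel h m k j) x * T i m x + christoffel h m k j x * partial l (T i m) x)" for l k i j
    unfolding nabla2_def[abs_def] using assms by (simp add: partial_simps smooth_simps smooth_all)
  show ?thesis
    using ricci_identity2_algebra[where G = "\<lambda>m i j. christoffel h m i j x" and T = "\<lambda>i j. T i j x"
        and N = "\<lambda>k i j. nabla2 h k T i j x"
        and dG = "\<lambda>p m i j. partial p (christoffel h m i j) x" and dT = "\<lambda>p i j. partial p (T i j) x"
        and l = l and k = k and i = i and j = j, OF nabla2_def christoffel_sym[OF assms(1), of _ l k]]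
      partial_commute[OF open_U assms(2)[of i j] assms(1), of l k]
    unfolding nabla3_def D riemann_def by linarith
qed

end

section \<open>Curvature in dimension three\<close>

definition levi :: "3 \<Rightarrow> 3 \<Rightarrow> 3 \<Rightarrow> real" where
  "levi i j k = det (vector [axis i 1, axis j 1, axis k 1] :: real^3^3)"

lemma levi_values [simp]:
  "levi 1 2 3 = 1" "levi 2 3 1 = 1" "levi 3 1 2 = 1" "levi 1 3 2 = -1" "levi 3 2 1 = -1" "levi 2 1 3 = -1"
  "levi i i j = 0" "levi i j i = 0" "levi j i i = 0"
  unfolding levi_def det_3 by (simp_all add: axis_def)

lemma sum_swap_pairs:
  fixes f :: "3 \<Rightarrow> 3 \<Rightarrow> 3 \<Rightarrow> 3 \<Rightarrow> real"
  shows "(\<Sum>k\<in>UNIV. \<Sum>l\<in>UNIV. \<Sum>m\<in>UNIV. \<Sum>s\<in>UNIV. f k l m s) = (\<Sum>k\<in>UNIV. \<Sum>l\<in>UNIV. \<Sum>m\<in>UNIV. \<Sum>s\<in>UNIV. f m s k l)"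
  unfolding sum_3 by (simp only: ac_simps)

lemma sum_reverse4:
  fixes f :: "3 \<Rightarrow> 3 \<Rightarrow> 3 \<Rightarrow> 3 \<Rightarrow> real"
  shows "(\<Sum>k\<in>UNIV. \<Sum>l\<in>UNIV. \<Sum>m\<in>UNIV. \<Sum>s\<in>UNIV. f k l m s) = (\<Sum>k\<in>UNIV. \<Sum>l\<in>UNIV. \<Sum>m\<in>UNIV. \<Sum>s\<in>UNIV. f s m l k)"
  unfolding sum_3 by (simp only: ac_simps)

text \<open>Writing \<open>W\<^sub>l\<^sub>k\<^sub>i\<^sub>j = \<epsilon>\<^sub>l\<^sub>k\<^sub>a \<epsilon>\<^sub>i\<^sub>j\<^sub>b G\<^sub>a\<^sub>b\<close>, the contraction \<open>E\<close> of \<open>W\<close> with \<open>u\<close> determines \<open>G\<close> through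
  \<open>det u G\<^sub>p\<^sub>q = 1/2 u\<^sub>p\<^sub>q \<langle>u, E\<rangle> - (u E u)\<^sub>q\<^sub>p\<close>.\<close>

lemma trace_free_skew_tensor_zero:
  fixes u :: "3 \<Rightarrow> 3 \<Rightarrow> real" and W :: "3 \<Rightarrow> 3 \<Rightarrow> 3 \<Rightarrow> 3 \<Rightarrow> real"
  assumes sym: "\<And>i j. u i j = u j i" and det: "det (\<chi> i j. u i j) \<noteq> 0"
    and skew1: "\<And>l k i j. W k l i j = - W l k i j" and skew2: "\<And>l k i j. W l k j i = - W l k i j"
    and trace: "\<And>k j. (\<Sum>l\<in>UNIV. \<Sum>i\<in>UNIV. u l i * W l k i j) = 0"
  shows "W l k i j = 0"
proof -
  let ?E = "\<lambda>k j. \<Sum>l\<in>UNIV. \<Sum>i\<in>UNIV. u l i * W l k i j"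
  have s: "u 2 1 = u 1 2" "u 3 1 = u 1 3" "u 3 2 = u 2 3" using sym by blast+
  have d1: "W a a i j = 0" for a i j using skew1[of a a i j] by simp
  have d2: "W l k a a = 0" for a l k using skew2[of l k a a] by simp
  have w1: "W 2 1 i j = - W 1 2 i j" "W 1 3 i j = - W 3 1 i j" "W 3 2 i j = - W 2 3 i j" for i j
    by (rule skew1)+
  have w2: "W l k 2 1 = - W l k 1 2" "W l k 1 3 = - W l k 3 1" "W l k 3 2 = - W l k 2 3" for l k
    by (rule skew2)+
  \<comment> \<open>The index pair \<open>cyc p\<close>, \<open>cyc (cyc p)\<close> is dual to
    \<open>p\<close>, so this entry of \<open>W\<close> is G_pq, and the factor 2 clears the 1/2.
    Symmetry of \<open>u\<close> and the skewness rules reduce both sides to polynomials in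
    independent entries.\<close>
  have "\<forall>p q. 2 * (det (\<chi> i j. u i j) * W (cyc p) (cyc (cyc p)) (cyc q) (cyc (cyc q)))
      = u p q * (\<Sum>k\<in>UNIV. \<Sum>j\<in>UNIV. u k j * ?E k j)
        - 2 * (\<Sum>k\<in>UNIV. \<Sum>j\<in>UNIV. u q k * u p j * ?E k j)"
    unfolding forall_3 sum_3 det_3 cyc_simps vec_lambda_beta d1 d2 w1 w2 s
    by (intro conjI; simp only: algebra_simps mult_zero_right mult_zero_left add_0_left add_0_right
          mult_minus_left mult_minus_right)
  then have "W (cyc p) (cyc (cyc p)) (cyc q) (cyc (cyc q)) = 0" for p q
    using trace det by simp
  then have "W 2 3 2 3 = 0" "W 2 3 3 1 = 0" "W 2 3 1 2 = 0" "W 3 1 2 3 = 0" "W 3 1 3 1 = 0" "W 3 1 1 2 = 0"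
    "W 1 2 2 3 = 0" "W 1 2 3 1 = 0" "W 1 2 1 2 = 0"
    by (metis cyc_simps)+
  then have "\<forall>l k i j. W l k i j = 0"
    unfolding forall_3 by (simp add: d1 d2 w1 w2)
  then show ?thesis by blast
qed

context local_riemannian begin

lemma sum_upper_lower_apply:
  assumes "x \<in> U"
  shows "(\<Sum>l\<in>UNIV. \<Sum>i\<in>UNIV. upper h l i x * (lower h l a x * F i)) = F a"
proof -
  have "(\<Sum>l\<in>UNIV. \<Sum>i\<in>UNIV. upper h l i x * (lower h l a x * F i))
      = (\<Sum>l\<in>UNIV. (\<Sum>i\<in>UNIV. F i * upper h i l x) * lower h l a x)"
    by (simp add: sum_distrib_left sum_distrib_right upper_sym[OF assms] ac_simps)
  then show ?thesis by (simp add: contract_upper_lower[OF assms])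
qed

lemma det_upper:
  assumes "x \<in> U" shows "det (\<chi> i j. upper h i j x) \<noteq> 0"
proof -
  have "det (matrix_inv (h x)) * det (h x) = 1"
    using matrix_inv_mult(2)[OF metric_nondeg[OF assms]] by (metis det_I det_mul)
  then show ?thesis unfolding upper_def by (auto simp: vec_lambda_eta)
qed

text \<open>The difference of both sides is the Weyl tensor: it is skew in both pairs, and its trace
  is Ric - 3 P + P + P - (R/4) g = 0, so \<open>trace_free_skew_tensor_zero\<close> applies.\<close>

lemma riemann_low_schouten:
  assumes "x \<in> U"
  shows "riemann_low h l k i j x = lower h l i x * schouten h k j x - lower h l j x * schouten h k i x
    - lower h k i x * schouten h l j x + lower h k j x * schouten h l i x"
proof -
  let ?W = "\<lambda>l k i j. riemann_low h l k i j x - (lower h l i x * schouten h k j x - lower h l j x * schouten h k i x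
    - lower h k i x * schouten h l j x + lower h k j x * schouten h l i x)"
  have ric: "ricci h j k x = schouten h j k x + scalar_curv h x / 4 * lower h j k x" for j k
    unfolding schouten_def by simp
  have tr: "(\<Sum>l\<in>UNIV. \<Sum>i\<in>UNIV. upper h l i x * lower h l i x) = 3"
    using upper_lower[OF assms] by (simp add: lower_sym[OF assms])
  have trP: "(\<Sum>l\<in>UNIV. \<Sum>i\<in>UNIV. upper h l i x * schouten h l i x) = scalar_curv h x / 4"
  proof -
    have "(\<Sum>l\<in>UNIV. \<Sum>i\<in>UNIV. upper h l i x * schouten h l i x) = scalar_curv h x
        - scalar_curv h x / 4 * (\<Sum>l\<in>UNIV. \<Sum>i\<in>UNIV. upper h l i x * lower h l i x)"
      unfolding schouten_def
      by (subst (1) scalar_curv_def) (simp add: right_diff_distrib sum_subtractf sum_distrib_left mult.left_commute)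
    then show ?thesis unfolding tr by simp
  qed
  have "?W l k i j = 0"
  proof (rule trace_free_skew_tensor_zero[where u = "\<lambda>i j. upper h i j x" and W = ?W])
    fix k j
    have "(\<Sum>l\<in>UNIV. \<Sum>i\<in>UNIV. upper h l i x * ?W l k i j) =
        (\<Sum>l\<in>UNIV. \<Sum>i\<in>UNIV. upper h l i x * riemann_low h l k i j x)
        - (\<Sum>l\<in>UNIV. \<Sum>i\<in>UNIV. upper h l i x * lower h l i x) * schouten h k j x
        + (\<Sum>l\<in>UNIV. \<Sum>i\<in>UNIV. upper h l i x * (lower h l j x * schouten h k i x))
        + (\<Sum>l\<in>UNIV. \<Sum>i\<in>UNIV. upper h i l x * (lower h i k x * schouten h l j x))
        - (\<Sum>l\<in>UNIV. \<Sum>i\<in>UNIV. upper h l i x * schouten h l i x) * lower h k j x"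
      by (simp add: sum_distrib_right sum_distrib_left algebra_simps sum.distrib sum_subtractf
          upper_sym[OF assms] lower_sym[OF assms])
    also have "(\<Sum>l\<in>UNIV. \<Sum>i\<in>UNIV. upper h l i x * riemann_low h l k i j x) = ricci h j k x"
      unfolding ricci_low[OF assms] by (subst sum.swap) (simp add: upper_sym[OF assms])
    also have "(\<Sum>l\<in>UNIV. \<Sum>i\<in>UNIV. upper h i l x * (lower h i k x * schouten h l j x)) = schouten h k j x"
      by (subst sum.swap) (rule sum_upper_lower_apply[OF assms])
    finally show "(\<Sum>l\<in>UNIV. \<Sum>i\<in>UNIV. upper h l i x * ?W l k i j) = 0"
      unfolding sum_upper_lower_apply[OF assms] tr trP ric
      by (simp add: schouten_sym[OF assms, of j k] lower_sym[OF assms, of j k])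
  next
    show "det (\<chi> i j. upper h i j x) \<noteq> 0" by (rule det_upper[OF assms])
    show "upper h i j x = upper h j i x" for i j by (rule upper_sym[OF assms])
    show "?W k l i j = - ?W l k i j" for l k i j
      by (subst riemann_low_skew1[OF assms]) simp
    show "?W l k j i = - ?W l k i j" for l k i j
      by (subst riemann_low_skew2) simp
  qed
  then show ?thesis by simp
qed

section \<open>Divergence of the Cotton tensor\<close>

lemma nabla3_diff:
  assumes "x \<in> U" "\<And>i j k. smooth_on U (S i j k)" "\<And>i j k. smooth_on U (T i j k)"
    and "\<And>y i j k. y \<in> U \<Longrightarrow> R i j k y = S i j k y - T i j k y"
  shows "nabla3 h l R i j k x = nabla3 h l S i j k x - nabla3 h l T i j k x"
proof -
  have "partial l (R i j k) x = partial l (\<lambda>x. S i j k x - T i j k x) x"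
    by (rule partial_cong_U[OF assms(1,4)])
  then have "partial l (R i j k) x = partial l (S i j k) x - partial l (T i j k) x"
    using assms by (simp add: partial_simps)
  then show ?thesis
    unfolding nabla3_def assms(4)[OF assms(1)] by (simp add: right_diff_distrib sum_subtractf)
qed

text \<open>The derivative of the vanishing trace is the trace of the derivative, up to a connection
  term for the free index that again contains the trace.\<close>

lemma nabla3_trace_zero:
  assumes "x \<in> U" "\<And>i j k. smooth_on U (T i j k)"
    and "\<And>y i. y \<in> U \<Longrightarrow> (\<Sum>k\<in>UNIV. \<Sum>l\<in>UNIV. upper h k l y * T k i l y) = 0"
  shows "(\<Sum>k\<in>UNIV. \<Sum>l\<in>UNIV. upper h k l x * nabla3 h j T k i l x) = 0"
proof -
  have "0 = partial j (\<lambda>x. \<Sum>k\<in>UNIV. \<Sum>l\<in>UNIV. upper h k l x * T k i l x) x"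
    using partial_cong_U[OF assms(1), of _ "\<lambda>_. 0" j] assms(3) by simp
  also have "\<dots> = (\<Sum>k\<in>UNIV. \<Sum>l\<in>UNIV. upper h k l x * nabla2 h j (\<lambda>k l. T k i l) k l x)"
    by (rule partial_trace[OF assms(1,2)])
  also have "\<dots> = (\<Sum>k\<in>UNIV. \<Sum>l\<in>UNIV. upper h k l x * nabla3 h j T k i l x)
      + (\<Sum>m\<in>UNIV. christoffel h m j i x * (\<Sum>k\<in>UNIV. \<Sum>l\<in>UNIV. upper h k l x * T k m l x))"
    unfolding nabla2_def nabla3_def sum_3 by (simp only: algebra_simps)
  finally show ?thesis by (simp add: assms(3)[OF assms(1)])
qed

lemma cotton_div:
  assumes "x \<in> U"
  shows "(\<Sum>k\<in>UNIV. \<Sum>l\<in>UNIV. upper h k l x * nabla3 h l (cotton h) k i j x) = 0"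
proof -
  let ?P = "schouten h" and ?u = "\<lambda>k l. upper h k l x"
  let ?DP = "\<lambda>i j k. nabla2 h k ?P i j"
  let ?N = "\<lambda>l i j k. nabla3 h l ?DP i j k x"
  let ?R = "\<lambda>m k i j. riemann h m k i j x"
  have smP: "smooth_on U (?P i j)" for i j by (rule smooth_schouten)
  have smDP: "smooth_on U (?DP i j k)" for i j k by (rule smooth_nabla2[OF smP])
  have C: "nabla3 h l (cotton h) a b c x = ?N l a b c - ?N l a c b" for l a b c
  proof -
    have "nabla3 h l (cotton h) a b c x = ?N l a b c - nabla3 h l (\<lambda>a b c. ?DP a c b) a b c x"
      by (rule nabla3_diff[OF assms smDP smDP]) (simp add: cotton_def)
    then show ?thesis by (simp add: nabla3_def)
  qed
  note ri = ricci_identity2[where T = "schouten h", OF assms smP]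
  have tr: "(\<Sum>k\<in>UNIV. \<Sum>l\<in>UNIV. ?u k l * (?N j k i l - ?N j k l i)) = 0" for i j
    using nabla3_trace_zero[where T = "cotton h", OF assms smooth_cotton cotton_trace] unfolding C .
  text \<open>Commuting the derivatives in \<open>\<nabla>\<^sup>k\<nabla>\<^sub>jP\<^sub>k\<^sub>i\<close> reduces the divergence to a derivative of the trace identity
    and to the curvature terms \<open>S1\<close>, \<open>S2\<close>, which are symmetric in \<open>i, j\<close> and so cancel.\<close>
  define S1 where "S1 i j = (\<Sum>k\<in>UNIV. \<Sum>l\<in>UNIV. ?u k l * (\<Sum>m\<in>UNIV. ?R m k l j * ?P m i x))" for i j
  define S2 where "S2 i j = (\<Sum>k\<in>UNIV. \<Sum>l\<in>UNIV. ?u k l * (\<Sum>m\<in>UNIV. ?R m i l j * ?P k m x))" for i j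
  have P: "?P a b x = ?P b a x" for a b by (rule schouten_sym[OF assms])
  have u: "?u a b = ?u b a" for a b by (rule upper_sym[OF assms])
  \<comment> \<open>\<open>S1\<close> is minus the product of Ricci with \<open>P\<close>. Since Ric
    = P + (R/4) g, the two commute, so their product is symmetric.\<close>
  have S1: "S1 i j = S1 j i" for i j
  proof -
    have ric: "(\<Sum>k\<in>UNIV. \<Sum>l\<in>UNIV. ?u k l * riemann_low h k s l j x) = ricci h j s x" for s j
      unfolding ricci_low[OF assms] by (subst sum.swap) (simp add: u)
    have "S1 i j = - (\<Sum>m\<in>UNIV. \<Sum>s\<in>UNIV. ?u m s * ricci h j s x * ?P m i x)" for i j
    proof -
      have "S1 i j = - (\<Sum>k\<in>UNIV. \<Sum>l\<in>UNIV. ?u k l * (\<Sum>m\<in>UNIV. (\<Sum>s\<in>UNIV. ?u m s * riemann_low h k s l j x) * ?P m i x))"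
        unfolding S1_def riemann_raise[OF assms]
        by (subst riemann_low_skew1[OF assms]) (simp add: sum_negf)
      also have "\<dots> = - (\<Sum>m\<in>UNIV. \<Sum>s\<in>UNIV. ?u m s * (\<Sum>k\<in>UNIV. \<Sum>l\<in>UNIV. ?u k l * riemann_low h k s l j x) * ?P m i x)"
        unfolding sum_3 by (simp only: algebra_simps)
      finally show ?thesis unfolding ric .
    qed
    moreover have "(\<Sum>m\<in>UNIV. \<Sum>s\<in>UNIV. ?u m s * ricci h j s x * ?P m i x)
        = (\<Sum>m\<in>UNIV. \<Sum>s\<in>UNIV. ?u m s * ?P j s x * ?P i m x) + scalar_curv h x / 4 * ?P j i x" for i j
    proof -
      have "(\<Sum>m\<in>UNIV. \<Sum>s\<in>UNIV. ?u m s * ricci h j s x * ?P m i x) =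
         (\<Sum>m\<in>UNIV. \<Sum>s\<in>UNIV. ?u m s * ?P j s x * ?P i m x)
         + (\<Sum>m\<in>UNIV. \<Sum>s\<in>UNIV. ?u s m * (lower h s j x * (scalar_curv h x / 4 * ?P m i x)))"
        by (simp add: schouten_def[of h j] P[of i] u lower_sym[OF assms, of j] sum.distrib[symmetric] algebra_simps)
      also have "(\<Sum>m\<in>UNIV. \<Sum>s\<in>UNIV. ?u s m * (lower h s j x * (scalar_curv h x / 4 * ?P m i x)))
          = scalar_curv h x / 4 * ?P j i x"
        by (subst sum.swap) (rule sum_upper_lower_apply[OF assms])
      finally show ?thesis .
    qed
    moreover have "(\<Sum>m\<in>UNIV. \<Sum>s\<in>UNIV. ?u m s * ?P j s x * ?P i m x) = (\<Sum>m\<in>UNIV. \<Sum>s\<in>UNIV. ?u m s * ?P i s x * ?P j m x)"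
      by (subst sum.swap) (simp add: u ac_simps)
    ultimately show ?thesis by (simp add: P[of i j])
  qed
  \<comment> \<open>Renaming (k, l) to (m, s) and back, together with the pair symmetry of the
    curvature, interchanges \<open>i\<close> and \<open>j\<close>.\<close>
  have S2: "S2 i j = S2 j i" for i j
  proof -
    have S2': "S2 i j = (\<Sum>k\<in>UNIV. \<Sum>l\<in>UNIV. \<Sum>m\<in>UNIV. \<Sum>s\<in>UNIV. ?u k l * (?u m s * riemann_low h s i l j x * ?P k m x))" for i j
      unfolding S2_def riemann_raise[OF assms] by (simp add: sum_distrib_left sum_distrib_right)
    show ?thesis
      unfolding S2'[of i j] S2'[of j i]
      by (subst sum_swap_pairs, subst riemann_low_pair[OF assms]) (simp add: P ac_simps)
  qed
  \<comment> \<open>This is the commutator of two derivatives acting on the trace of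
    \<open>P\<close>: the curvature is skew in the two indices in which it is contracted with the
    symmetric \<open>P\<close>.\<close>
  have S3: "(\<Sum>k\<in>UNIV. \<Sum>l\<in>UNIV. ?u k l * (?N j k l i - ?N i k l j)) = 0"
  proof -
    have q: "(\<Sum>k\<in>UNIV. \<Sum>l\<in>UNIV. ?u k l * (\<Sum>m\<in>UNIV. ?R m k j i * ?P m l x)) = 0" (is "?q = 0")
    proof -
      have "?q = (\<Sum>k\<in>UNIV. \<Sum>l\<in>UNIV. \<Sum>m\<in>UNIV. \<Sum>s\<in>UNIV. ?u k l * (?u m s * riemann_low h s k j i x * ?P m l x))"
        unfolding riemann_raise[OF assms] by (simp add: sum_distrib_left sum_distrib_right)
      also have "\<dots> = (\<Sum>k\<in>UNIV. \<Sum>l\<in>UNIV. \<Sum>m\<in>UNIV. \<Sum>s\<in>UNIV. ?u s m * (?u l k * riemann_low h k s j i x * ?P l m x))"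
        by (rule sum_reverse4)
      also have "\<dots> = - (\<Sum>k\<in>UNIV. \<Sum>l\<in>UNIV. \<Sum>m\<in>UNIV. \<Sum>s\<in>UNIV. ?u k l * (?u m s * riemann_low h s k j i x * ?P m l x))"
        by (subst riemann_low_skew1[OF assms]) (simp add: sum_negf u P ac_simps)
      also have "(\<Sum>k\<in>UNIV. \<Sum>l\<in>UNIV. \<Sum>m\<in>UNIV. \<Sum>s\<in>UNIV. ?u k l * (?u m s * riemann_low h s k j i x * ?P m l x)) = ?q"
        unfolding riemann_raise[OF assms] by (simp add: sum_distrib_left sum_distrib_right)
      finally show ?thesis by simp
    qed
    have "(\<Sum>k\<in>UNIV. \<Sum>l\<in>UNIV. ?u k l * (?N j k l i - ?N i k l j))
       = - (\<Sum>k\<in>UNIV. \<Sum>l\<in>UNIV. ?u k l * (\<Sum>m\<in>UNIV. ?R m k j i * ?P m l x))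
         - (\<Sum>k\<in>UNIV. \<Sum>l\<in>UNIV. ?u k l * (\<Sum>m\<in>UNIV. ?R m l j i * ?P k m x))"
      unfolding ri[of j] by (simp add: right_diff_distrib sum_subtractf sum_negf)
    also have "(\<Sum>k\<in>UNIV. \<Sum>l\<in>UNIV. ?u k l * (\<Sum>m\<in>UNIV. ?R m l j i * ?P k m x)) = ?q"
      by (subst sum.swap) (simp add: u P)
    finally show ?thesis using q by simp
  qed
  have sw: "?N l k i j = ?N j k i l - (\<Sum>m\<in>UNIV. ?R m k l j * ?P m i x) - (\<Sum>m\<in>UNIV. ?R m i l j * ?P k m x)" for k i j l
    using ri[of l k i j] by simp
  \<comment> \<open>Second derivatives of the trace of \<open>P\<close> in \<open>i\<close> and
    \<open>j\<close> are added and subtracted; they complete the commuted terms to derivatives of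
    the trace of the Cotton tensor.\<close>
  have "(\<Sum>k\<in>UNIV. \<Sum>l\<in>UNIV. ?u k l * (?N l k i j - ?N l k j i))
     = (\<Sum>k\<in>UNIV. \<Sum>l\<in>UNIV. ?u k l * (?N j k i l - ?N j k l i)) - (\<Sum>k\<in>UNIV. \<Sum>l\<in>UNIV. ?u k l * (?N i k j l - ?N i k l j))
       + (\<Sum>k\<in>UNIV. \<Sum>l\<in>UNIV. ?u k l * (?N j k l i - ?N i k l j)) - S1 i j - S2 i j + S1 j i + S2 j i"
    unfolding S1_def S2_def sw[where i=i and j=j] sw[where i=j and j=i] sum.distrib[symmetric] sum_subtractf[symmetric]
    by (intro sum.cong refl) (simp add: algebra_simps)
  then show ?thesis unfolding C tr S3 using S1[of i j] S2[of i j] by simp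
qed

lemma V_tensor_sym:
  assumes "x \<in> U"
  shows "V_tensor h i j x = V_tensor h j i x"
proof -
  have c: "nabla3 h l (cotton h) k i j x = nabla3 h l (\<lambda>k i j. cotton h j i k) k i j x - nabla3 h l (\<lambda>k i j. cotton h i j k) k i j x" for k l
  proof (rule nabla3_diff[OF assms smooth_cotton smooth_cotton])
    fix y i j k assume "y \<in> U"
    then show "cotton h i j k y = cotton h k j i y - cotton h j k i y"
      using cotton_cyclic[of y i j k] cotton_skew[of h k j i y] by simp
  qed
  have "nabla3 h l (cotton h) k i j x = nabla3 h l (cotton h) j i k x - nabla3 h l (cotton h) i j k x" for k l
    unfolding c unfolding nabla3_def by simp
  then show ?thesis
    using cotton_div[OF assms, of i j] unfolding V_tensor_def
    by (simp add: right_diff_distrib sum_subtractf)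
qed

end

section \<open>The dual of the Cotton tensor\<close>

lemma sum_rotate3:
  fixes f :: "3 \<Rightarrow> 3 \<Rightarrow> 3 \<Rightarrow> real"
  shows "(\<Sum>i\<in>UNIV. \<Sum>j\<in>UNIV. \<Sum>m\<in>UNIV. f i j m) = (\<Sum>m\<in>UNIV. \<Sum>i\<in>UNIV. \<Sum>j\<in>UNIV. f i j m)"
  unfolding sum_3 by (simp only: ac_simps)

lemma sum_levi_rows:
  fixes u :: "3 \<Rightarrow> 3 \<Rightarrow> real"
  shows "(\<Sum>i\<in>UNIV. (\<Sum>a\<in>UNIV. \<Sum>b\<in>UNIV. u k a * u l b * levi i a b) * u c i) = det (\<chi> i j. u i j) * levi k l c"
proof -
  have "\<forall>k l c. (\<Sum>i\<in>UNIV. (\<Sum>a\<in>UNIV. \<Sum>b\<in>UNIV. u k a * u l b * levi i a b) * u c i) = det (\<chi> i j. u i j) * levi k l c"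
    unfolding forall_3 sum_3 det_3 by (simp add: algebra_simps)
  then show ?thesis by blast
qed

text \<open>Up to \<open>vol_factor\<close> this is \<open>\<C>\<close> with its first index raised.
  The permutation symbol in place of the volume form makes its components twice those of the Cotton
  tensor.\<close>

definition cotton_dual :: "local_metric \<Rightarrow> tensor2" where
  "cotton_dual h c j x = (\<Sum>k\<in>UNIV. \<Sum>l\<in>UNIV. levi k l c * cotton h j k l x)"

lemma cotton_diag: "cotton h i j j x = 0"
  by (simp add: cotton_def)

lemma cotton_dual_values:
  "cotton_dual h 1 j x = 2 * cotton h j 2 3 x" "cotton_dual h 2 j x = 2 * cotton h j 3 1 x"
  "cotton_dual h 3 j x = 2 * cotton h j 1 2 x"
  unfolding cotton_dual_def sum_3 using cotton_skew[of h j 3 2 x] cotton_skew[of h j 1 3 x] cotton_skew[of h j 2 1 x]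
  by (simp_all add: cotton_diag)

definition cotton_dual_upper :: "local_metric \<Rightarrow> tensor2" where
  "cotton_dual_upper h m k x = (\<Sum>j\<in>UNIV. cotton_dual h m j x * upper h j k x)"

context local_riemannian begin

text \<open>For positive definite \<open>h\<close> this is 1 / sqrt (det h), the factor of the
  permutation symbol in the volume form with raised indices.\<close>

definition vol_factor :: "real^3 \<Rightarrow> real" where
  "vol_factor x = sqrt (det (h x)) * det (\<chi> i j. upper h i j x)"

text \<open>Raising two indices of the volume form amounts to raising all three and lowering one
  again; with all three raised it is a multiple of the permutation symbol by
  \<open>sum_levi_rows\<close>.\<close>

lemma C_tensor_dual:
  assumes "x \<in> U"
  shows "C_tensor h i j x = vol_factor x * (\<Sum>c\<in>UNIV. lower h c i x * cotton_dual h c j x)"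
proof -
  let ?X = "\<lambda>k l i. \<Sum>a\<in>UNIV. \<Sum>b\<in>UNIV. upper h k a x * upper h l b x * levi i a b"
  let ?D = "det (\<chi> i j. upper h i j x)"
  have X: "?X k l i = ?D * (\<Sum>c\<in>UNIV. levi k l c * lower h c i x)" for k l
  proof -
    have "?X k l i = (\<Sum>c\<in>UNIV. (\<Sum>a\<in>UNIV. ?X k l a * upper h a c x) * lower h c i x)"
      by (rule contract_upper_lower[OF assms, of "?X k l" i, symmetric])
    also have "\<dots> = (\<Sum>c\<in>UNIV. (?D * levi k l c) * lower h c i x)"
      unfolding sum_levi_rows[symmetric] by (simp only: upper_sym[OF assms])
    finally show ?thesis by (simp add: sum_distrib_left mult.assoc)
  qed
  have "C_tensor h i j x = (\<Sum>k\<in>UNIV. \<Sum>l\<in>UNIV. sqrt (det (h x)) * ?X k l i * cotton h j k l x)"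
    unfolding C_tensor_def volume_form_def levi_def[symmetric] sum_distrib_left
    by (simp only: ac_simps)
  also have "\<dots> = vol_factor x * (\<Sum>k\<in>UNIV. \<Sum>l\<in>UNIV. (\<Sum>c\<in>UNIV. levi k l c * lower h c i x) * cotton h j k l x)"
    unfolding X vol_factor_def by (simp add: sum_distrib_left ac_simps)
  also have "(\<Sum>k\<in>UNIV. \<Sum>l\<in>UNIV. (\<Sum>c\<in>UNIV. levi k l c * lower h c i x) * cotton h j k l x)
      = (\<Sum>c\<in>UNIV. lower h c i x * cotton_dual h c j x)"
    unfolding cotton_dual_def sum_3 by (simp add: algebra_simps)
  finally show ?thesis .
qed

lemma cotton_dual_upper_sym:
  assumes "x \<in> U"
  shows "cotton_dual_upper h m k x = cotton_dual_upper h k m x"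
proof -
  have t: "(\<Sum>j\<in>UNIV. \<Sum>k\<in>UNIV. upper h j k x * cotton h j k l x) = 0" for l
    using cotton_trace[OF assms, of l] cotton_skew[of h _ _ l x]
    by (simp add: sum_negf)
  \<comment> \<open>Each off-diagonal difference is, up to sign, twice a component of the trace of
    the Cotton tensor: for m = 1 and k = 2 it is twice the trace in \<open>t\<close> for l =
    3.\<close>
  have "\<forall>m k. cotton_dual_upper h m k x = cotton_dual_upper h k m x"
    unfolding forall_3 cotton_dual_upper_def cotton_dual_values sum_3
    using t[of 1] t[of 2] t[of 3] cotton_skew[of h _ 3 2 x] cotton_skew[of h _ 1 3 x] cotton_skew[of h _ 2 1 x]
    by (simp add: sum_3 cotton_diag mult.commute)
  then show ?thesis by blast
qed

lemma cotton_dual_lower: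
  assumes "x \<in> U"
  shows "cotton_dual h m j x = (\<Sum>k\<in>UNIV. cotton_dual_upper h m k x * lower h k j x)"
  unfolding cotton_dual_upper_def by (rule contract_upper_lower[OF assms, symmetric])

lemma C_tensor_sym:
  assumes "x \<in> U"
  shows "C_tensor h i j x = C_tensor h j i x"
proof -
  have "(\<Sum>c\<in>UNIV. lower h c i x * cotton_dual h c j x)
      = (\<Sum>c\<in>UNIV. \<Sum>k\<in>UNIV. lower h c i x * (cotton_dual_upper h c k x * lower h k j x))" for i j
    unfolding cotton_dual_lower[OF assms] by (simp add: sum_distrib_left)
  then show ?thesis
    unfolding C_tensor_dual[OF assms]
    by simp (subst sum.swap, simp add: cotton_dual_upper_sym[OF assms] ac_simps)
qed

lemma C_tensor_raise:
  assumes "x \<in> U"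
  shows "(\<Sum>a\<in>UNIV. \<Sum>b\<in>UNIV. upper h i a x * upper h j b x * C_tensor h a b x) = vol_factor x * cotton_dual_upper h i j x"
proof -
  have "(\<Sum>a\<in>UNIV. \<Sum>b\<in>UNIV. upper h i a x * upper h j b x * C_tensor h a b x)
      = vol_factor x * (\<Sum>b\<in>UNIV. upper h b j x * (\<Sum>a\<in>UNIV. (\<Sum>c\<in>UNIV. cotton_dual h c b x * lower h c a x) * upper h a i x))"
    unfolding C_tensor_dual[OF assms] upper_sym[OF assms, of i] upper_sym[OF assms, of j] sum_3
    by (simp only: algebra_simps)
  then show ?thesis
    unfolding contract_lower_upper[OF assms] cotton_dual_upper_def by (simp add: mult.commute)
qed

lemma cotton_inner_C:
  assumes "x \<in> U"
  shows "(\<Sum>i\<in>UNIV. \<Sum>j\<in>UNIV. cotton h i j m x * cotton_dual_upper h i j x) = 0"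
proof -
  let ?B = "\<lambda>i j. cotton_dual_upper h i j x" and ?g = "\<lambda>i j. lower h i j x"
  define r :: real where "r = 1 / 2"
  \<comment> \<open>Inverting the duality writes C_ijm as half of epsilon_jmc (B g)_ci, so that the
    contraction with B_ij pairs epsilon with the symmetric matrix B g B.\<close>
  have c: "cotton h i 2 3 x = r * (\<Sum>k\<in>UNIV. ?B 1 k * ?g k i)" "cotton h i 3 2 x = - r * (\<Sum>k\<in>UNIV. ?B 1 k * ?g k i)"
    "cotton h i 3 1 x = r * (\<Sum>k\<in>UNIV. ?B 2 k * ?g k i)" "cotton h i 1 3 x = - r * (\<Sum>k\<in>UNIV. ?B 2 k * ?g k i)"
    "cotton h i 1 2 x = r * (\<Sum>k\<in>UNIV. ?B 3 k * ?g k i)" "cotton h i 2 1 x = - r * (\<Sum>k\<in>UNIV. ?B 3 k * ?g k i)" for i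
    using cotton_dual_lower[OF assms, of 1 i] cotton_dual_lower[OF assms, of 2 i] cotton_dual_lower[OF assms, of 3 i]
      cotton_skew[of h i 3 2 x] cotton_skew[of h i 1 3 x] cotton_skew[of h i 2 1 x]
    unfolding cotton_dual_values r_def by simp_all
  have s: "?B 2 1 = ?B 1 2" "?B 3 1 = ?B 1 3" "?B 3 2 = ?B 2 3" "?g 2 1 = ?g 1 2" "?g 3 1 = ?g 1 3" "?g 3 2 = ?g 2 3"
    using cotton_dual_upper_sym[OF assms] lower_sym[OF assms] by blast+
  have "\<forall>m. (\<Sum>i\<in>UNIV. \<Sum>j\<in>UNIV. cotton h i j m x * ?B i j) = 0"
    unfolding forall_3 sum_3 cotton_diag c s by (simp add: algebra_simps)
  then show ?thesis by blast
qed

text \<open>The array has the form of the correction that \<open>V\<close> receives under a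
  conformal change. Both of its halves give the same contraction, because the dual is
  symmetric.\<close>

lemma inner_C_zero:
  assumes "x \<in> U"
  shows "tensor_inner h (\<lambda>i j x. \<Sum>m\<in>UNIV. Y m * (cotton h i j m x + cotton h j i m x)) (C_tensor h) x = 0"
proof -
  have z: "(\<Sum>i\<in>UNIV. \<Sum>j\<in>UNIV. cotton h j i m x * cotton_dual_upper h i j x) = 0" for m
    using cotton_inner_C[OF assms, of m] by (subst sum.swap) (simp add: cotton_dual_upper_sym[OF assms])
  have "tensor_inner h (\<lambda>i j x. \<Sum>m\<in>UNIV. Y m * (cotton h i j m x + cotton h j i m x)) (C_tensor h) x
     = (\<Sum>m\<in>UNIV. vol_factor x * Y m * ((\<Sum>i\<in>UNIV. \<Sum>j\<in>UNIV. cotton h i j m x * cotton_dual_upper h i j x)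
       + (\<Sum>i\<in>UNIV. \<Sum>j\<in>UNIV. cotton h j i m x * cotton_dual_upper h i j x)))"
    unfolding tensor_inner_def C_tensor_raise[OF assms] sum_distrib_right sum_distrib_left sum.distrib[symmetric]
    by (subst sum_rotate3) (simp add: algebra_simps)
  then show ?thesis by (simp add: z cotton_inner_C[OF assms])
qed

end

section \<open>Conformal change in a chart\<close>

context local_riemannian begin

text \<open>The traced Christoffel symbols are isolated because a conformal change only adds a
  multiple of dw to them.\<close>

lemma ricci_expand:
  assumes "x \<in> U"
  shows "ricci h j k x = (\<Sum>i\<in>UNIV. partial i (christoffel h i j k) x)
    - partial j (\<lambda>x. \<Sum>i\<in>UNIV. christoffel h i i k x) x
    + (\<Sum>m\<in>UNIV. (\<Sum>i\<in>UNIV. christoffel h i i m x) * christoffel h m j k x)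
    - (\<Sum>i\<in>UNIV. \<Sum>m\<in>UNIV. christoffel h i j m x * christoffel h m i k x)"
proof -
  have "partial j (\<lambda>x. \<Sum>i\<in>UNIV. christoffel h i i k x) x = (\<Sum>i\<in>UNIV. partial j (christoffel h i i k) x)"
    using assms by (simp add: partial_simps smooth_all)
  then show ?thesis
    unfolding ricci_def riemann_def sum_3 by (simp only: algebra_simps)
qed

end

text \<open>Separates the Kronecker terms in a product of two changed Christoffel symbols. The
  coefficient 6 is 1 + 1 + 3 + 1, with 3 the trace of the identity.\<close>

lemma sum_delta_product:
  fixes A B :: "3 \<Rightarrow> 3 \<Rightarrow> real"
  shows "(\<Sum>i\<in>UNIV. \<Sum>m\<in>UNIV. (A i m + (if i = j then Y m else 0) + (if i = m then Y j else 0))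
       * (B m i + (if m = i then Y k else 0) + (if m = k then Y i else 0)))
   = (\<Sum>i\<in>UNIV. \<Sum>m\<in>UNIV. A i m * B m i) + Y k * (\<Sum>i\<in>UNIV. A i i) + (\<Sum>i\<in>UNIV. A i k * Y i)
     + (\<Sum>m\<in>UNIV. Y m * B m j) + Y j * (\<Sum>m\<in>UNIV. B m m) + 6 * Y j * Y k"
proof -
  have "\<forall>j k. (\<Sum>i\<in>UNIV. \<Sum>m\<in>UNIV. (A i m + (if i = j then Y m else 0) + (if i = m then Y j else 0))
       * (B m i + (if m = i then Y k else 0) + (if m = k then Y i else 0)))
   = (\<Sum>i\<in>UNIV. \<Sum>m\<in>UNIV. A i m * B m i) + Y k * (\<Sum>i\<in>UNIV. A i i) + (\<Sum>i\<in>UNIV. A i k * Y i)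
     + (\<Sum>m\<in>UNIV. Y m * B m j) + Y j * (\<Sum>m\<in>UNIV. B m m) + 6 * Y j * Y k"
    unfolding forall_3 sum_3 by (simp add: algebra_simps)
  then show ?thesis by blast
qed

lemma partial_if: "partial i (\<lambda>x. if b then f x else 0) x = (if b then partial i f x else 0)"
  by (cases b) auto

lemma smooth_on_if: "smooth_on S f \<Longrightarrow> smooth_on S (\<lambda>x. if b then f x else 0)"
  by (cases b) auto

section \<open>Change of the connection and of the Ricci tensor\<close>

locale conformal_pair = local_riemannian U h + tilde: local_riemannian U k
  for U and h k :: local_metric +
  fixes w :: "real^3 \<Rightarrow> real"
  assumes smooth_w: "smooth_on U w"
    and conformal: "x \<in> U \<Longrightarrow> k x = exp (2 * w x) *\<^sub>R h x"
begin

definition Y :: "3 \<Rightarrow> real^3 \<Rightarrow> real" where "Y i = partial i w"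

definition Yup :: "3 \<Rightarrow> real^3 \<Rightarrow> real" where "Yup m x = (\<Sum>l\<in>UNIV. upper h m l x * Y l x)"

definition Ysq :: "real^3 \<Rightarrow> real" where "Ysq x = (\<Sum>i\<in>UNIV. \<Sum>j\<in>UNIV. upper h i j x * (Y i x * Y j x))"

definition Hess :: tensor2 where "Hess i j = nabla1 h j Y i"

lemma smooth_Y: "smooth_on U (Y i)"
  unfolding Y_def by (rule smooth_on_partial[OF smooth_w])

lemma smooth_Yup: "smooth_on U (Yup i)"
  unfolding Yup_def by (intro smooth_simps smooth_all smooth_Y)

lemma smooth_Ysq: "smooth_on U Ysq"
  unfolding Ysq_def by (intro smooth_simps smooth_all smooth_Y)

lemma smooth_Hess: "smooth_on U (Hess i j)"
  unfolding Hess_def by (rule smooth_nabla1[OF smooth_Y])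

lemmas smooth_conf = smooth_all smooth_Y smooth_Yup smooth_Ysq smooth_Hess

lemma partial_Y_sym: "x \<in> U \<Longrightarrow> partial i (Y j) x = partial j (Y i) x"
  unfolding Y_def by (rule partial_commute[OF open_U smooth_w])

lemma Hess_sym: "x \<in> U \<Longrightarrow> Hess i j x = Hess j i x"
  unfolding Hess_def nabla1_def by (simp add: partial_Y_sym[of x i j] christoffel_sym[of x _ i j])

lemma lower_Yup: "x \<in> U \<Longrightarrow> (\<Sum>m\<in>UNIV. lower h j m x * Yup m x) = Y j x"
  using contract_upper_lower[of x "\<lambda>l. Y l x" j] unfolding Yup_def
  by (simp add: lower_sym[of x j] upper_sym mult.commute)

lemma Ysq_Yup: "Ysq x = (\<Sum>m\<in>UNIV. Y m x * Yup m x)"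
  unfolding Ysq_def Yup_def by (simp add: sum_distrib_left ac_simps)

lemma lower_conf: "x \<in> U \<Longrightarrow> lower k i j x = exp (2 * w x) * lower h i j x"
  unfolding lower_def by (simp add: conformal)

lemma upper_conf:
  assumes "x \<in> U"
  shows "upper k i j x = exp (- 2 * w x) * upper h i j x"
proof -
  have "matrix_inv (k x) = exp (- 2 * w x) *\<^sub>R matrix_inv (h x)"
  proof (rule matrix_inv_unique[OF tilde.metric_nondeg[OF assms]])
    show "k x ** (exp (- 2 * w x) *\<^sub>R matrix_inv (h x)) = mat 1"
      unfolding conformal[OF assms] using matrix_inv_mult(1)[OF metric_nondeg[OF assms]]
      by (simp add: matrix_scalar_ac scalar_matrix_assoc[symmetric] scalar_mult_eq_scaleR[symmetric] exp_minus)
  qed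
  then show ?thesis unfolding upper_def by simp
qed

lemma partial_lower_conf:
  assumes "x \<in> U"
  shows "partial a (lower k i j) x = exp (2 * w x) * (partial a (lower h i j) x + 2 * Y a x * lower h i j x)"
proof -
  have d: "w differentiable (at x)" using differentiable_U[OF smooth_w assms] .
  have "partial a (lower k i j) x = partial a (\<lambda>x. exp (2 * w x) * lower h i j x) x"
    by (rule partial_cong_U[OF assms lower_conf])
  also have "\<dots> = partial a (\<lambda>x. exp (2 * w x)) x * lower h i j x + exp (2 * w x) * partial a (lower h i j) x"
    by (intro partial_mult differentiable_U[OF smooth_lower assms])
       (use d in \<open>auto intro!: derivative_eq_intros simp: differentiable_def\<close>)
  also have "partial a (\<lambda>x. exp (2 * w x)) x = exp (2 * w x) * (2 * Y a x)"
    using d by (simp add: partial_exp[of "\<lambda>x. 2 * w x"] partial_mult[of "\<lambda>_. 2" x w] Y_def)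
  finally show ?thesis by (simp add: algebra_simps)
qed

text \<open>The exponentials of metric and inverse cancel. Differentiating e^(2 w) leaves 2 dw in
  each of the three metric derivatives, and the factor 1/2 of the Christoffel formula absorbs the
  2.\<close>

lemma christoffel_conf:
  assumes "x \<in> U"
  shows "christoffel k m i j x = christoffel h m i j x + (if m = i then Y j x else 0)
     + (if m = j then Y i x else 0) - lower h i j x * Yup m x"
proof -
  have e: "exp (- (2 * w x)) * exp (2 * w x) = 1" by (simp add: exp_minus)
  have u: "(\<Sum>l\<in>UNIV. upper h m l x * lower h a l x) = (if m = a then 1 else 0)" for a
    using upper_lower[OF assms, of m a] by (simp add: lower_sym[OF assms, of a])
  have "christoffel k m i j x = (1/2) * (\<Sum>l\<in>UNIV. (exp (- (2 * w x)) * exp (2 * w x)) * (upper h m l x *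
      ((partial i (lower h j l) x + partial j (lower h i l) x - partial l (lower h i j) x)
       + 2 * Y i x * lower h j l x + 2 * Y j x * lower h i l x - 2 * Y l x * lower h i j x)))"
    unfolding christoffel_def upper_conf[OF assms] partial_lower_conf[OF assms]
    by (simp add: algebra_simps)
  also have "\<dots> = christoffel h m i j x + Y i x * (\<Sum>l\<in>UNIV. upper h m l x * lower h j l x)
       + Y j x * (\<Sum>l\<in>UNIV. upper h m l x * lower h i l x) - lower h i j x * Yup m x"
    unfolding e christoffel_def Yup_def sum_3 by (simp add: algebra_simps)
  finally show ?thesis unfolding u by simp
qed

lemma christoffel_conf_apply:
  assumes "x \<in> U"
  shows "(\<Sum>m\<in>UNIV. christoffel k m i j x * F m) = (\<Sum>m\<in>UNIV. christoffel h m i j x * F m)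
    + Y j x * F i + Y i x * F j - lower h i j x * (\<Sum>m\<in>UNIV. Yup m x * F m)"
proof -
  have "(\<Sum>m\<in>UNIV. christoffel k m i j x * F m) = (\<Sum>m\<in>UNIV. christoffel h m i j x * F m
     + (if m = i then Y j x * F m else 0) + (if m = j then Y i x * F m else 0) - lower h i j x * (Yup m x * F m))"
    unfolding christoffel_conf[OF assms] by (intro sum.cong refl) (simp add: algebra_simps)
  then show ?thesis by (simp add: sum.distrib sum_subtractf sum_distrib_left)
qed

lemma trace_christoffel_conf:
  assumes "x \<in> U"
  shows "(\<Sum>i\<in>UNIV. christoffel k i i m x) = (\<Sum>i\<in>UNIV. christoffel h i i m x) + 3 * Y m x"
proof -
  have "(\<Sum>i\<in>UNIV. christoffel k i i m x) = (\<Sum>i\<in>UNIV. christoffel h i i m x) + 3 * Y m x + Y m x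
      - (\<Sum>i\<in>UNIV. lower h m i x * Yup i x)"
    unfolding christoffel_conf[OF assms] by (simp add: sum.distrib sum_subtractf lower_sym[OF assms, of m])
  then show ?thesis unfolding lower_Yup[OF assms] by simp
qed

lemma div_Yup:
  assumes "x \<in> U"
  shows "(\<Sum>i\<in>UNIV. partial i (Yup i) x) = (\<Sum>i\<in>UNIV. \<Sum>l\<in>UNIV. upper h i l x * Hess l i x)
     - (\<Sum>m\<in>UNIV. (\<Sum>i\<in>UNIV. christoffel h i i m x) * Yup m x)"
proof -
  have "(\<Sum>i\<in>UNIV. partial i (Yup i) x) = (\<Sum>i\<in>UNIV. \<Sum>l\<in>UNIV. partial i (upper h i l) x * Y l x + upper h i l x * partial i (Y l) x)"
    unfolding Yup_def[abs_def] using assms by (simp add: partial_simps smooth_simps smooth_conf)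
  then show ?thesis
    unfolding partial_upper[OF assms] Hess_def nabla1_def Yup_def sum_3 by (simp add: algebra_simps)
qed

text \<open>In dimension n the Hessian, dw dw and |dw|^2 g carry the factor n - 2, here 1. The
  pieces \<open>?P\<close>, \<open>?Q\<close>, \<open>?GY\<close> and the traced symbols are not
  tensorial: they cancel between \<open>T1\<close> to \<open>T4\<close>, except for one
  \<open>?GY\<close>, which completes the partial derivative of dw to the Hessian.\<close>

lemma ricci_conf:
  assumes "x \<in> U"
  shows "ricci k j l x = ricci h j l x - Hess j l x + Y j x * Y l x
     - ((\<Sum>a\<in>UNIV. \<Sum>b\<in>UNIV. upper h a b x * Hess a b x) + Ysq x) * lower h j l x"
proof -
  let ?G = "\<lambda>m i j. christoffel h m i j x" and ?g = "\<lambda>i j. lower h i j x" and ?y = "\<lambda>i. Y i x" and ?Y = "\<lambda>i. Yup i x"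
  let ?t = "\<lambda>m. \<Sum>i\<in>UNIV. ?G i i m"
  let ?trH = "\<Sum>a\<in>UNIV. \<Sum>b\<in>UNIV. upper h a b x * Hess a b x"
  let ?GG = "\<Sum>i\<in>UNIV. \<Sum>m\<in>UNIV. ?G i j m * ?G m i l"
  let ?P = "\<Sum>i\<in>UNIV. \<Sum>m\<in>UNIV. ?G m i j * ?g m l * ?Y i"
  let ?Q = "\<Sum>i\<in>UNIV. \<Sum>m\<in>UNIV. ?G m i l * ?g m j * ?Y i"
  let ?GY = "\<Sum>m\<in>UNIV. ?G m j l * ?y m"
  have T1: "(\<Sum>i\<in>UNIV. partial i (christoffel k i j l) x) = (\<Sum>i\<in>UNIV. partial i (christoffel h i j l) x)
    + partial j (Y l) x + partial l (Y j) x - ?P - ?Q - ?g j l * ?trH + ?g j l * (\<Sum>m\<in>UNIV. ?t m * ?Y m)"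
  proof -
    have "partial i (christoffel k i j l) x = partial i (christoffel h i j l) x + (if i = j then partial i (Y l) x else 0)
        + (if i = l then partial i (Y j) x else 0) - (partial i (lower h j l) x * ?Y i + ?g j l * partial i (Yup i) x)" for i
    proof -
      have "partial i (christoffel k i j l) x = partial i (\<lambda>x. christoffel h i j l x + (if i = j then Y l x else 0)
        + (if i = l then Y j x else 0) - lower h j l x * Yup i x) x"
        by (rule partial_cong_U[OF assms christoffel_conf])
      then show ?thesis
        using assms by (simp add: partial_simps smooth_simps smooth_conf smooth_on_if partial_if)
    qed
    then have "(\<Sum>i\<in>UNIV. partial i (christoffel k i j l) x) = (\<Sum>i\<in>UNIV. partial i (christoffel h i j l) x)
      + partial j (Y l) x + partial l (Y j) x - (\<Sum>i\<in>UNIV. partial i (lower h j l) x * ?Y i) - ?g j l * (\<Sum>i\<in>UNIV. partial i (Yup i) x)"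
      by (simp add: sum.distrib sum_subtractf sum_distrib_left)
    also have "(\<Sum>i\<in>UNIV. partial i (lower h j l) x * ?Y i) = ?P + ?Q"
      unfolding partial_lower[OF assms] by (simp add: distrib_right sum.distrib sum_distrib_right)
    also have "(\<Sum>i\<in>UNIV. partial i (Yup i) x) = ?trH - (\<Sum>m\<in>UNIV. ?t m * ?Y m)"
      unfolding div_Yup[OF assms] by (simp add: Hess_sym[OF assms])
    finally show ?thesis by (simp add: algebra_simps)
  qed
  have T2: "partial j (\<lambda>x. \<Sum>i\<in>UNIV. christoffel k i i l x) x = partial j (\<lambda>x. \<Sum>i\<in>UNIV. christoffel h i i l x) x + 3 * partial j (Y l) x"
  proof -
    have "partial j (\<lambda>x. \<Sum>i\<in>UNIV. christoffel k i i l x) x = partial j (\<lambda>x. (\<Sum>i\<in>UNIV. christoffel h i i l x) + 3 * Y l x) x"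
      by (rule partial_cong_U[OF assms trace_christoffel_conf])
    then show ?thesis using assms by (simp add: partial_simps smooth_simps smooth_conf)
  qed
  have T3: "(\<Sum>m\<in>UNIV. (\<Sum>i\<in>UNIV. christoffel k i i m x) * christoffel k m j l x) = (\<Sum>m\<in>UNIV. ?t m * ?G m j l)
      + ?t j * ?y l + ?t l * ?y j - ?g j l * (\<Sum>m\<in>UNIV. ?t m * ?Y m) + 3 * ?GY + 6 * ?y j * ?y l - 3 * ?g j l * Ysq x"
  proof -
    have "(\<Sum>m\<in>UNIV. (\<Sum>i\<in>UNIV. christoffel k i i m x) * christoffel k m j l x)
      = (\<Sum>m\<in>UNIV. christoffel k m j l x * (?t m + 3 * ?y m))"
      unfolding trace_christoffel_conf[OF assms] by (simp add: mult.commute)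
    also have "\<dots> = (\<Sum>m\<in>UNIV. ?t m * ?G m j l)
      + ?t j * ?y l + ?t l * ?y j - ?g j l * (\<Sum>m\<in>UNIV. ?t m * ?Y m) + 3 * ?GY + 6 * ?y j * ?y l - 3 * ?g j l * Ysq x"
      unfolding christoffel_conf_apply[OF assms] Ysq_Yup sum_3 by (simp add: algebra_simps)
    finally show ?thesis .
  qed
  have T4: "(\<Sum>i\<in>UNIV. \<Sum>m\<in>UNIV. christoffel k i j m x * christoffel k m i l x)
      = ?GG - ?P - ?Q + ?y l * ?t j + ?y j * ?t l + 2 * ?GY + 5 * ?y j * ?y l - 2 * ?g j l * Ysq x"
  proof -
    \<comment> \<open>The changed symbols without their Kronecker terms. Their two traces contribute
      -1 each and their product +1 to the coefficient of dw dw, turning 6 into 5.\<close>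
    let ?A = "\<lambda>i m. ?G i j m - ?g j m * ?Y i" and ?B = "\<lambda>m i. ?G m i l - ?g i l * ?Y m"
    have ly: "(\<Sum>m\<in>UNIV. ?g j m * ?Y m) = ?y j" "(\<Sum>m\<in>UNIV. ?g l m * ?Y m) = ?y l"
      using lower_Yup[OF assms] by auto
    have "(\<Sum>i\<in>UNIV. \<Sum>m\<in>UNIV. christoffel k i j m x * christoffel k m i l x) =
       (\<Sum>i\<in>UNIV. \<Sum>m\<in>UNIV. (?A i m + (if i = j then ?y m else 0) + (if i = m then ?y j else 0))
       * (?B m i + (if m = i then ?y l else 0) + (if m = l then ?y i else 0)))"
      unfolding christoffel_conf[OF assms] by (intro sum.cong refl) (simp add: algebra_simps)
    also have "\<dots> = (\<Sum>i\<in>UNIV. \<Sum>m\<in>UNIV. ?A i m * ?B m i) + ?y l * (\<Sum>i\<in>UNIV. ?A i i) + (\<Sum>i\<in>UNIV. ?A i l * ?y i)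
     + (\<Sum>m\<in>UNIV. ?y m * ?B m j) + ?y j * (\<Sum>m\<in>UNIV. ?B m m) + 6 * ?y j * ?y l"
      by (rule sum_delta_product)
    also have "(\<Sum>i\<in>UNIV. ?A i i) = ?t j - ?y j"
      by (simp add: sum_subtractf ly christoffel_sym[OF assms, of _ j])
    also have "(\<Sum>m\<in>UNIV. ?B m m) = ?t l - ?y l"
      by (simp add: sum_subtractf ly lower_sym[OF assms, of _ l])
    also have "(\<Sum>i\<in>UNIV. ?A i l * ?y i) = ?GY - ?g j l * Ysq x"
      unfolding Ysq_Yup sum_3 by (simp add: algebra_simps)
    also have "(\<Sum>m\<in>UNIV. ?y m * ?B m j) = ?GY - ?g j l * Ysq x"
      unfolding Ysq_Yup sum_3 by (simp add: algebra_simps)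
    also have "(\<Sum>i\<in>UNIV. \<Sum>m\<in>UNIV. ?A i m * ?B m i) = ?GG - ?P - ?Q
        + (\<Sum>m\<in>UNIV. ?g j m * ?Y m) * (\<Sum>m\<in>UNIV. ?g l m * ?Y m)"
      unfolding christoffel_sym[OF assms, of _ _ j] lower_sym[OF assms, of j] lower_sym[OF assms, of l] sum_3
      by (simp add: algebra_simps)
    finally show ?thesis unfolding ly by (simp add: algebra_simps)
  qed
  have H: "Hess j l x = partial j (Y l) x - ?GY"
    unfolding Hess_def nabla1_def by (simp add: partial_Y_sym[OF assms, of l] christoffel_sym[OF assms, of _ l])
  show ?thesis
    unfolding ricci_expand[OF assms] tilde.ricci_expand[OF assms] T1 T2 T3 T4 H partial_Y_sym[OF assms, of l j]
    by (simp add: algebra_simps)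
qed

end

section \<open>Conformal invariance of the Cotton tensor\<close>

context local_riemannian begin

lemma nabla2_cong:
  assumes "x \<in> U" "\<And>y i j. y \<in> U \<Longrightarrow> S i j y = T i j y"
  shows "nabla2 h k S i j x = nabla2 h k T i j x"
  unfolding nabla2_def using assms partial_cong_U[OF assms(1), of "S i j" "T i j" k] by simp

lemma nabla3_cong:
  assumes "x \<in> U" "\<And>y i j k. y \<in> U \<Longrightarrow> S i j k y = T i j k y"
  shows "nabla3 h l S i j k x = nabla3 h l T i j k x"
  unfolding nabla3_def using assms partial_cong_U[OF assms(1), of "S i j k" "T i j k" l] by simp

lemma nabla2_add:
  assumes "x \<in> U" "\<And>i j. smooth_on U (S i j)" "\<And>i j. smooth_on U (T i j)"
  shows "nabla2 h k (\<lambda>i j x. S i j x + T i j x) i j x = nabla2 h k S i j x + nabla2 h k T i j x"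
  unfolding nabla2_def using assms by (simp add: partial_simps distrib_left sum.distrib)

lemma nabla2_product:
  assumes "x \<in> U" "\<And>i. smooth_on U (Y i)"
  shows "nabla2 h k (\<lambda>i j x. Y i x * Y j x) i j x = nabla1 h k Y i x * Y j x + Y i x * nabla1 h k Y j x"
  unfolding nabla2_def nabla1_def sum_3 using assms by (simp add: partial_simps algebra_simps)

lemma nabla2_scaled_metric:
  assumes "x \<in> U" "smooth_on U q"
  shows "nabla2 h k (\<lambda>i j x. q x * lower h i j x) i j x = partial k q x * lower h i j x"
proof -
  have "nabla2 h k (\<lambda>i j x. q x * lower h i j x) i j x = partial k q x * lower h i j x + q x * nabla2 h k (lower h) i j x"
    unfolding nabla2_def sum_3 using assms by (simp add: partial_simps smooth_all algebra_simps)
  then show ?thesis by (simp add: nabla2_lower[OF assms(1)])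
qed

end

context conformal_pair begin

text \<open>The last term is a scalar function times the metric, and added rather than subtracted,
  so that \<open>nabla2_add\<close> and \<open>nabla2_scaled_metric\<close> differentiate it
  directly.\<close>

definition Adiff :: tensor2 where
  "Adiff i j x = - Hess i j x + Y i x * Y j x + (- (1/2) * Ysq x) * lower h i j x"

lemma smooth_Adiff: "smooth_on U (Adiff i j)"
  unfolding Adiff_def by (intro smooth_simps smooth_conf)

lemma scalar_curv_conf:
  assumes "x \<in> U"
  shows "scalar_curv k x = exp (- 2 * w x) * (scalar_curv h x
     - 4 * (\<Sum>a\<in>UNIV. \<Sum>b\<in>UNIV. upper h a b x * Hess a b x) - 2 * Ysq x)"
proof -
  let ?H = "\<Sum>a\<in>UNIV. \<Sum>b\<in>UNIV. upper h a b x * Hess a b x"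
  have tr: "(\<Sum>i\<in>UNIV. \<Sum>j\<in>UNIV. upper h i j x * lower h i j x) = 3"
    using upper_lower[OF assms] by (simp add: lower_sym[OF assms])
  have ric: "(\<Sum>i\<in>UNIV. \<Sum>j\<in>UNIV. upper h i j x *
      (ricci h i j x - Hess i j x + Y i x * Y j x - c * lower h i j x))
    = scalar_curv h x - ?H + Ysq x - c * 3" for c
    unfolding scalar_curv_def Ysq_def tr[symmetric]
    by (simp add: algebra_simps sum.distrib sum_subtractf sum_distrib_left)
  have "scalar_curv k x = exp (- 2 * w x) * (\<Sum>i\<in>UNIV. \<Sum>j\<in>UNIV. upper h i j x *
      (ricci h i j x - Hess i j x + Y i x * Y j x - (?H + Ysq x) * lower h i j x))"
    unfolding scalar_curv_def ricci_conf[OF assms] upper_conf[OF assms] by (simp add: sum_distrib_left mult.assoc)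
  also have "\<dots> = exp (- 2 * w x) * (scalar_curv h x - ?H + Ysq x - (?H + Ysq x) * 3)"
    unfolding ric ..
  finally show ?thesis by (simp add: algebra_simps)
qed

text \<open>A quarter of the changed scalar curvature removes the whole Laplacian term of Ricci and
  half of its |dw|^2 term.\<close>

lemma schouten_conf:
  assumes "x \<in> U"
  shows "schouten k i j x = schouten h i j x + Adiff i j x"
proof -
  have e: "exp (- 2 * w x) * exp (2 * w x) = 1" by (simp add: exp_minus)
  have "scalar_curv k x / 4 * lower k i j x = (exp (- 2 * w x) * exp (2 * w x)) * ((scalar_curv h x
     - 4 * (\<Sum>a\<in>UNIV. \<Sum>b\<in>UNIV. upper h a b x * Hess a b x) - 2 * Ysq x) / 4 * lower h i j x)"
    unfolding scalar_curv_conf[OF assms] lower_conf[OF assms] by simp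
  then show ?thesis
    unfolding schouten_def e ricci_conf[OF assms] Adiff_def by (simp add: field_simps)
qed

lemma nabla2_conf:
  assumes "x \<in> U"
  shows "nabla2 k l T i j x = nabla2 h l T i j x
    - (Y i x * T l j x + Y l x * T i j x - lower h l i x * (\<Sum>m\<in>UNIV. Yup m x * T m j x))
    - (Y j x * T i l x + Y l x * T i j x - lower h l j x * (\<Sum>m\<in>UNIV. Yup m x * T i m x))"
  unfolding nabla2_def christoffel_conf_apply[OF assms] by simp

lemma nabla3_conf:
  assumes "x \<in> U"
  shows "nabla3 k p T i j l x = nabla3 h p T i j l x
    - (Y i x * T p j l x + Y p x * T i j l x - lower h p i x * (\<Sum>m\<in>UNIV. Yup m x * T m j l x))
    - (Y j x * T i p l x + Y p x * T i j l x - lower h p j x * (\<Sum>m\<in>UNIV. Yup m x * T i m l x))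
    - (Y l x * T i j p x + Y p x * T i j l x - lower h p l x * (\<Sum>m\<in>UNIV. Yup m x * T i j m x))"
  unfolding nabla3_def christoffel_conf_apply[OF assms] by simp

lemma partial_Ysq:
  assumes "x \<in> U"
  shows "partial l Ysq x = 2 * (\<Sum>m\<in>UNIV. Yup m x * Hess m l x)"
proof -
  have "partial l Ysq x = (\<Sum>i\<in>UNIV. \<Sum>j\<in>UNIV. upper h i j x * nabla2 h l (\<lambda>i j x. Y i x * Y j x) i j x)"
    unfolding Ysq_def[abs_def]
    by (rule partial_trace[where T = "\<lambda>i j x. Y i x * Y j x", OF assms]) (intro smooth_simps smooth_Y)
  also have "\<dots> = (\<Sum>i\<in>UNIV. \<Sum>j\<in>UNIV. upper h i j x * (Hess i l x * Y j x)) + (\<Sum>i\<in>UNIV. \<Sum>j\<in>UNIV. upper h j i x * (Y i x * Hess j l x))"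
    unfolding nabla2_product[OF assms smooth_Y] Hess_def
    by (simp add: distrib_left sum.distrib upper_sym[OF assms])
  also have "(\<Sum>i\<in>UNIV. \<Sum>j\<in>UNIV. upper h j i x * (Y i x * Hess j l x)) = (\<Sum>m\<in>UNIV. Yup m x * Hess m l x)"
    unfolding Yup_def by (subst sum.swap) (simp add: sum_distrib_right mult.assoc)
  also have "(\<Sum>i\<in>UNIV. \<Sum>j\<in>UNIV. upper h i j x * (Hess i l x * Y j x)) = (\<Sum>m\<in>UNIV. Yup m x * Hess m l x)"
    unfolding Yup_def by (simp add: sum_distrib_left sum_distrib_right ac_simps)
  finally show ?thesis by simp
qed

lemma nabla2_Adiff:
  assumes "x \<in> U"
  shows "nabla2 h l Adiff i j x = - nabla2 h l Hess i j x + Hess i l x * Y j x + Y i x * Hess j l x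
    - (\<Sum>m\<in>UNIV. Yup m x * Hess m l x) * lower h i j x"
proof -
  let ?q = "\<lambda>x. - (1/2) * Ysq x"
  have sq: "smooth_on U ?q" by (intro smooth_simps smooth_Ysq)
  have m: "nabla2 h l (\<lambda>i j x. - Hess i j x) i j x = - nabla2 h l Hess i j x"
    unfolding nabla2_def using assms by (simp add: partial_simps smooth_Hess sum_negf)
  have "nabla2 h l Adiff i j x = nabla2 h l (\<lambda>i j x. - Hess i j x + Y i x * Y j x) i j x
      + nabla2 h l (\<lambda>i j x. ?q x * lower h i j x) i j x"
    unfolding Adiff_def[abs_def]
    by (rule nabla2_add[OF assms]) (intro smooth_simps smooth_conf)+
  also have "nabla2 h l (\<lambda>i j x. - Hess i j x + Y i x * Y j x) i j x
      = nabla2 h l (\<lambda>i j x. - Hess i j x) i j x + nabla2 h l (\<lambda>i j x. Y i x * Y j x) i j x"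
    by (rule nabla2_add[OF assms]) (intro smooth_simps smooth_conf)+
  finally show ?thesis
    unfolding m nabla2_product[OF assms smooth_Y] nabla2_scaled_metric[OF assms sq]
    using assms by (simp add: partial_simps smooth_simps smooth_conf partial_Ysq Hess_def[symmetric])
qed

text \<open>With the Riemann tensor written through \<open>P\<close>, the curvature applied to dw
  takes the form of the terms that the change of connection produces from \<open>P\<close>.\<close>

lemma riemann_Y:
  assumes "x \<in> U"
  shows "(\<Sum>m\<in>UNIV. riemann h m i l j x * Y m x) = Y l x * schouten h i j x - Y j x * schouten h i l x
    - lower h i l x * (\<Sum>m\<in>UNIV. Yup m x * schouten h m j x) + lower h i j x * (\<Sum>m\<in>UNIV. Yup m x * schouten h m l x)"
proof -
  have "(\<Sum>m\<in>UNIV. riemann h m i l j x * Y m x) = (\<Sum>s\<in>UNIV. Yup s x * riemann_low h s i l j x)"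
    unfolding riemann_raise[OF assms] Yup_def sum_distrib_right
    by (subst sum.swap) (simp add: upper_sym[OF assms] ac_simps)
  also have "\<dots> = (\<Sum>s\<in>UNIV. lower h l s x * Yup s x) * schouten h i j x - (\<Sum>s\<in>UNIV. lower h j s x * Yup s x) * schouten h i l x
    - lower h i l x * (\<Sum>m\<in>UNIV. Yup m x * schouten h m j x) + lower h i j x * (\<Sum>m\<in>UNIV. Yup m x * schouten h m l x)"
    unfolding riemann_low_schouten[OF assms] lower_sym[OF assms, of l] lower_sym[OF assms, of j _] sum_3
    by (simp add: algebra_simps)
  finally show ?thesis unfolding lower_Yup[OF assms] .
qed

lemma cotton_conf:
  assumes "x \<in> U"
  shows "cotton k i j l x = cotton h i j l x"
proof -
  let ?P = "\<lambda>i j. schouten h i j x" and ?H = "\<lambda>i j. Hess i j x" and ?y = "\<lambda>i. Y i x" and ?g = "\<lambda>i j. lower h i j x"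
  let ?q = "Ysq x"
  let ?T = "\<lambda>i j x. schouten h i j x + Adiff i j x"
  let ?YH = "\<lambda>j. \<Sum>m\<in>UNIV. Yup m x * ?H m j" and ?YP = "\<lambda>j. \<Sum>m\<in>UNIV. Yup m x * ?P m j"
  have YA: "(\<Sum>m\<in>UNIV. Yup m x * Adiff m j x) = - ?YH j + ?q / 2 * ?y j" for j
  proof -
    have "(\<Sum>m\<in>UNIV. Yup m x * Adiff m j x) = - ?YH j + (\<Sum>m\<in>UNIV. ?y m * Yup m x) * ?y j - ?q / 2 * (\<Sum>m\<in>UNIV. ?g j m * Yup m x)"
      unfolding Adiff_def lower_sym[OF assms, of j] sum_3 by (simp add: field_simps)
    then show ?thesis unfolding lower_Yup[OF assms] Ysq_Yup[symmetric] by simp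
  qed
  have YT: "(\<Sum>m\<in>UNIV. Yup m x * ?T m j x) = ?YP j - ?YH j + ?q / 2 * ?y j" for j
    using YA[of j] by (simp add: distrib_left sum.distrib)
  have N: "nabla2 k l (schouten k) i j x = nabla2 h l (schouten h) i j x + nabla2 h l Adiff i j x
      - (?y i * ?T l j x + ?y l * ?T i j x - ?g l i * (?YP j - ?YH j + ?q / 2 * ?y j))
      - (?y j * ?T i l x + ?y l * ?T i j x - ?g l j * (\<Sum>m\<in>UNIV. Yup m x * ?T i m x))" for i j l
  proof -
    have "nabla2 k l (schouten k) i j x = nabla2 k l ?T i j x"
      by (rule tilde.nabla2_cong[OF assms schouten_conf])
    then show ?thesis
      unfolding nabla2_conf[OF assms] nabla2_add[OF assms smooth_schouten smooth_Adiff] YT .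
  qed
  have R: "nabla2 h l Hess i j x - nabla2 h j Hess i l x = - (?y l * ?P i j - ?y j * ?P i l - ?g i l * ?YP j + ?g i j * ?YP l)"
    using ricci_identity1[where Y = Y, OF assms smooth_Y, of l i j]
    unfolding Hess_def[abs_def, symmetric] riemann_Y[OF assms] .
  have s: "?P l j = ?P j l" "Hess l j x = Hess j l x" "?g l j = ?g j l" "?g l i = ?g i l" "?g j i = ?g i j"
    using schouten_sym[OF assms] Hess_sym[OF assms] lower_sym[OF assms] by blast+
  have A: "Adiff a b x = - ?H a b + ?y a * ?y b - ?q / 2 * ?g a b" for a b by (simp add: Adiff_def)
  \<comment> \<open>The connection terms acting on the second index of the Schouten tensor are
    symmetric in \<open>j\<close> and \<open>l\<close> and have dropped out. The rest cancels in two
    groups: \<open>R\<close> against the terms linear in \<open>P\<close>, and the terms in dw and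
    its Hessian among themselves.\<close>
  have "cotton k i j l x - cotton h i j l x = - (nabla2 h l Hess i j x - nabla2 h j Hess i l x)
     + (?H i l * ?y j + ?y i * ?H j l - ?YH l * ?g i j) - (?H i j * ?y l + ?y i * ?H l j - ?YH j * ?g i l)
     - (?y i * ?T l j x + ?y l * ?T i j x - ?g l i * (?YP j - ?YH j + ?q / 2 * ?y j))
     + (?y i * ?T j l x + ?y j * ?T i l x - ?g j i * (?YP l - ?YH l + ?q / 2 * ?y l))"
    unfolding cotton_def N nabla2_Adiff[OF assms] s(3) by simp
  also have "\<dots> = 0"
    unfolding R A s by (simp add: algebra_simps)
  finally show ?thesis by simp
qed

section \<open>Conformal weights of the tensors and of the integrand\<close>

lemma V_tensor_conf:
  assumes "x \<in> U"
  shows "V_tensor k i j x = exp (- 2 * w x) * (V_tensor h i j x - (\<Sum>m\<in>UNIV. Yup m x * (cotton h i j m x + cotton h j i m x)))"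
proof -
  let ?C = "\<lambda>i j m. cotton h i j m x" and ?u = "\<lambda>a b. upper h a b x" and ?g = "\<lambda>a b. lower h a b x"
  let ?YC = "\<lambda>i j. \<Sum>m\<in>UNIV. Yup m x * ?C i j m"
  define YC where "YC = ?YC i j"
  have "nabla3 k b (cotton k) i j a x = nabla3 k b (cotton h) i j a x" for a b
    by (rule tilde.nabla3_cong[OF assms cotton_conf])
  then have "V_tensor k i j x = exp (- 2 * w x) * (\<Sum>a\<in>UNIV. \<Sum>b\<in>UNIV. ?u a b * nabla3 k b (cotton h) i j a x)"
    unfolding V_tensor_def upper_conf[OF assms]
    by (simp add: sum_distrib_left mult.assoc)
  \<comment> \<open>In multiples of \<open>YC\<close>, the direction of differentiation gives 3 and
    the last index gives 1 - 3, where this 3 is the trace of the metric. The indices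
    \<open>i\<close> and \<open>j\<close> give two vanishing traces of the Cotton tensor and two
    contractions, which cyclicity and skewness express through \<open>?YC\<close>.\<close>
  also have "(\<Sum>a\<in>UNIV. \<Sum>b\<in>UNIV. ?u a b * nabla3 k b (cotton h) i j a x) = V_tensor h i j x
     - (Y i x * (\<Sum>a\<in>UNIV. \<Sum>b\<in>UNIV. ?u b a * ?C b j a)
        + 3 * (\<Sum>a\<in>UNIV. \<Sum>b\<in>UNIV. ?u a b * Y b x * ?C i j a)
        - (\<Sum>a\<in>UNIV. \<Sum>b\<in>UNIV. ?u b a * (?g b i * (\<Sum>m\<in>UNIV. Yup m x * ?C m j a)))
        + Y j x * (\<Sum>a\<in>UNIV. \<Sum>b\<in>UNIV. ?u a b * ?C i b a)
        - (\<Sum>a\<in>UNIV. \<Sum>b\<in>UNIV. ?u b a * (?g b j * (\<Sum>m\<in>UNIV. Yup m x * ?C i m a)))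
        + (\<Sum>a\<in>UNIV. \<Sum>b\<in>UNIV. ?u b a * Y a x * ?C i j b)
        - (\<Sum>a\<in>UNIV. \<Sum>b\<in>UNIV. ?u a b * ?g b a) * YC)"
    unfolding nabla3_conf[OF assms] V_tensor_def YC_def[symmetric]
    by (simp add: algebra_simps sum.distrib sum_subtractf sum_distrib_left upper_sym[OF assms])
  also have "(\<Sum>a\<in>UNIV. \<Sum>b\<in>UNIV. ?u b a * ?C b j a) = 0"
    using cotton_trace[OF assms, of j] by (subst sum.swap)
  also have "(\<Sum>a\<in>UNIV. \<Sum>b\<in>UNIV. ?u a b * ?C i b a) = 0"
  proof -
    have "(\<Sum>a\<in>UNIV. \<Sum>b\<in>UNIV. ?u a b * ?C i b a) = - (\<Sum>a\<in>UNIV. \<Sum>b\<in>UNIV. ?u a b * ?C i b a)"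
      by (subst (1) sum.swap, subst cotton_skew) (simp add: sum_negf upper_sym[OF assms])
    then show ?thesis by simp
  qed
  also have "(\<Sum>a\<in>UNIV. \<Sum>b\<in>UNIV. ?u a b * Y b x * ?C i j a) = ?YC i j"
    unfolding Yup_def by (simp add: sum_distrib_right)
  also have "(\<Sum>a\<in>UNIV. \<Sum>b\<in>UNIV. ?u b a * Y a x * ?C i j b) = ?YC i j"
    unfolding Yup_def by (subst sum.swap) (simp add: sum_distrib_right)
  also have "(\<Sum>a\<in>UNIV. \<Sum>b\<in>UNIV. ?u b a * (?g b i * (\<Sum>m\<in>UNIV. Yup m x * ?C m j a))) = (\<Sum>m\<in>UNIV. Yup m x * ?C m j i)"
    by (subst sum.swap) (rule sum_upper_lower_apply[OF assms])
  also have "(\<Sum>a\<in>UNIV. \<Sum>b\<in>UNIV. ?u b a * (?g b j * (\<Sum>m\<in>UNIV. Yup m x * ?C i m a))) = (\<Sum>m\<in>UNIV. Yup m x * ?C i m j)"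
    by (subst sum.swap) (rule sum_upper_lower_apply[OF assms])
  also have "(\<Sum>a\<in>UNIV. \<Sum>b\<in>UNIV. ?u a b * ?g b a) = 3"
    by (simp add: upper_lower[OF assms])
  also have "(\<Sum>m\<in>UNIV. Yup m x * ?C m j i) = ?YC i j - ?YC j i"
  proof -
    have "?C m j i = ?C i j m - ?C j i m" for m
      using cotton_cyclic[OF assms, of m j i] cotton_skew[of h i j m x] cotton_skew[of h j m i x] by (simp add: cotton_skew[of h i j m x])
    then show ?thesis by (simp add: right_diff_distrib sum_subtractf)
  qed
  also have "(\<Sum>m\<in>UNIV. Yup m x * ?C i m j) = - ?YC i j"
    by (subst cotton_skew) (simp add: sum_negf)
  finally show ?thesis by (simp add: YC_def distrib_left sum.distrib)
qed

lemma det_conf: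
  assumes "x \<in> U"
  shows "det (k x) = exp (6 * w x) * det (h x)"
proof -
  have "det (c *\<^sub>R M) = c * c * c * det M" for c and M :: "real^3^3"
    unfolding det_3 by (simp add: algebra_simps)
  then show ?thesis
    unfolding conformal[OF assms] by (simp flip: exp_add)
qed

lemma sqrt_det_conf:
  assumes "x \<in> U"
  shows "sqrt (det (k x)) = exp (3 * w x) * sqrt (det (h x))"
proof -
  have "sqrt (exp (6 * w x)) = exp (3 * w x)"
    by (rule real_sqrt_unique) (simp_all add: power2_eq_square flip: exp_add)
  then show ?thesis unfolding det_conf[OF assms] real_sqrt_mult by simp
qed

text \<open>The weight is -2 for each of the two raised indices, 3 for the volume form and 0 for the
  Cotton tensor.\<close>

lemma C_tensor_conf:
  assumes "x \<in> U"
  shows "C_tensor k i j x = exp (- w x) * C_tensor h i j x"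
proof -
  have e: "exp (- 2 * w x) * (exp (- 2 * w x) * exp (3 * w x)) = exp (- w x)"
    by (simp flip: exp_add)
  have "C_tensor k i j x = (exp (- 2 * w x) * (exp (- 2 * w x) * exp (3 * w x))) * C_tensor h i j x"
    unfolding C_tensor_def volume_form_def sqrt_det_conf[OF assms] upper_conf[OF assms] cotton_conf[OF assms]
      sum_distrib_left sum_distrib_right by (simp only: ac_simps)
  then show ?thesis unfolding e .
qed

lemma tensor_inner_conf:
  assumes "x \<in> U"
  shows "tensor_inner k S T x = exp (- 4 * w x) * tensor_inner h S T x"
proof -
  have e: "exp (- 2 * w x) * exp (- 2 * w x) = exp (- 4 * w x)" by (simp flip: exp_add)
  have "tensor_inner k S T x = (exp (- 2 * w x) * exp (- 2 * w x)) * tensor_inner h S T x"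
    unfolding tensor_inner_def upper_conf[OF assms] sum_distrib_left by (simp only: ac_simps)
  then show ?thesis unfolding e .
qed

lemma tensor_inner_cong:
  "(\<And>i j. S i j x = S' i j x) \<Longrightarrow> (\<And>i j. T i j x = T' i j x) \<Longrightarrow> tensor_inner h S T x = tensor_inner h S' T' x"
  unfolding tensor_inner_def by simp

lemma tensor_inner_scale:
  "tensor_inner h (\<lambda>i j x. a * S i j x) (\<lambda>i j x. b * T i j x) x = (a * b) * tensor_inner h S T x"
  unfolding tensor_inner_def sum_distrib_left by (simp only: ac_simps)

lemma C_norm_sq_conf:
  assumes "x \<in> U"
  shows "C_norm_sq k x = exp (- 6 * w x) * C_norm_sq h x"
proof -
  have "C_norm_sq k x = exp (- 4 * w x) * ((exp (- w x) * exp (- w x)) * C_norm_sq h x)"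
    unfolding C_norm_sq_def tensor_inner_conf[OF assms] tensor_inner_scale[symmetric]
    by (intro arg_cong2[where f = "(*)"] refl tensor_inner_cong C_tensor_conf[OF assms])
  then show ?thesis by (simp flip: exp_add mult.assoc)
qed

lemma V_inner_C_conf:
  assumes "x \<in> U"
  shows "V_inner_C k x = exp (- 7 * w x) * V_inner_C h x"
proof -
  let ?X = "\<lambda>i j y. \<Sum>m\<in>UNIV. Yup m x * (cotton h i j m y + cotton h j i m y)"
  have "V_inner_C k x = exp (- 4 * w x) * ((exp (- 2 * w x) * exp (- w x)) *
      tensor_inner h (\<lambda>i j y. V_tensor h i j y - ?X i j y) (C_tensor h) x)"
    unfolding V_inner_C_def tensor_inner_conf[OF assms] tensor_inner_scale[symmetric]
    by (intro arg_cong2[where f = "(*)"] refl tensor_inner_cong C_tensor_conf[OF assms] V_tensor_conf[OF assms])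
  also have "tensor_inner h (\<lambda>i j y. V_tensor h i j y - ?X i j y) (C_tensor h) x
      = V_inner_C h x - tensor_inner h ?X (C_tensor h) x"
    unfolding tensor_inner_def V_inner_C_def by (simp add: left_diff_distrib sum_subtractf)
  finally show ?thesis
    unfolding inner_C_zero[OF assms] by (simp flip: exp_add mult.assoc)
qed

text \<open>The norm has weight -3, so its power contributes 4 against the -7 of the numerator. Both
  metrics fall into the same case of the definition, because \<open>\<C>\<close> is multiplied by a
  positive factor.\<close>

lemma local_integrand_conf:
  assumes "x \<in> U"
  shows "local_integrand k x = exp (- 3 * w x) * local_integrand h x"
proof -
  have s: "sqrt (exp (- 6 * w x)) = exp (- 3 * w x)"
    by (rule real_sqrt_unique) (simp_all add: power2_eq_square flip: exp_add)
  have p: "(exp (- 3 * w x) * a) powr (4/3) = exp (- 4 * w x) * a powr (4/3)" for a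
    unfolding powr_mult by (simp add: powr_def)
  have d: "exp (- 7 * w x) / exp (- 4 * w x) = exp (- 3 * w x)"
    by (simp flip: exp_diff)
  have "V_inner_C k x / sqrt (C_norm_sq k x) powr (4/3)
     = (exp (- 7 * w x) / exp (- 4 * w x)) * (V_inner_C h x / sqrt (C_norm_sq h x) powr (4/3))"
    unfolding V_inner_C_conf[OF assms] C_norm_sq_conf[OF assms] real_sqrt_mult s p by simp
  then show ?thesis
    unfolding local_integrand_def d C_tensor_conf[OF assms] by simp
qed

end

section \<open>The Riemannian measure\<close>

text \<open>Connects nonnegative integrals with the absolutely integrable functions of the change of
  variables theorem: a nonnegative Borel integrand fails to be absolutely integrable exactly when
  its integral is infinite.\<close>

lemma nn_integral_eq_absolutely_integrable:
  fixes f :: "'a::euclidean_space \<Rightarrow> real"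
  assumes "S \<in> sets borel" "\<And>x. x \<in> S \<Longrightarrow> 0 \<le> f x" "(\<lambda>x. indicator S x *\<^sub>R f x) \<in> borel_measurable borel"
  shows "(\<integral>\<^sup>+x\<in>S. ennreal (f x) \<partial>lborel)
    = (if f absolutely_integrable_on S then ennreal (integral S f) else \<infinity>)"
proof -
  let ?F = "\<lambda>x. indicator S x *\<^sub>R f x"
  have eq: "(\<integral>\<^sup>+x\<in>S. ennreal (f x) \<partial>lborel) = (\<integral>\<^sup>+x. ennreal (?F x) \<partial>lborel)"
    by (rule nn_integral_cong) (simp split: split_indicator)
  have nn: "0 \<le> ?F x" for x using assms(2) by (simp split: split_indicator)
  \<comment> \<open>Absolute integrability refers to Lebesgue measure, the completion of
    \<open>lborel\<close>; for Borel functions the two notions agree.\<close>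
  have i: "integrable lborel ?F \<longleftrightarrow> f absolutely_integrable_on S"
    unfolding set_integrable_def using assms(3) by (subst integrable_completion) auto
  show ?thesis
  proof (cases "f absolutely_integrable_on S")
    case True
    have "(\<integral>\<^sup>+x. ennreal (?F x) \<partial>lborel) = ennreal (integral\<^sup>L lborel ?F)"
      by (rule nn_integral_eq_integral) (use True i nn in auto)
    also have "integral\<^sup>L lborel ?F = integral S f"
      using set_lebesgue_integral_eq_integral(2)[OF True] assms(3)
      unfolding set_lebesgue_integral_def by (subst (asm) integral_completion) auto
    finally show ?thesis using True eq by simp
  next
    case False
    then have "\<not> (\<integral>\<^sup>+x. ennreal (norm (?F x)) \<partial>lborel) < \<infinity>"
      using i assms(3) unfolding integrable_iff_bounded by simp
    then show ?thesis using False eq nn by (simp add: less_top[symmetric])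
  qed
qed

lemma nn_integral_change_of_variables:
  fixes f :: "real^'n::{finite,wellorder} \<Rightarrow> real" and T :: "real^'n::_ \<Rightarrow> real^'n::_"
  assumes "S \<in> sets borel" "T ` S \<in> sets borel"
    and der: "\<And>x. x \<in> S \<Longrightarrow> (T has_derivative T' x) (at x)" and inj: "inj_on T S"
    and nn: "\<And>y. y \<in> T ` S \<Longrightarrow> 0 \<le> f y"
    and eq: "\<And>x. x \<in> S \<Longrightarrow> F x = \<bar>det (matrix (T' x))\<bar> * f (T x)"
    and "(\<lambda>y. indicator (T ` S) y *\<^sub>R f y) \<in> borel_measurable borel"
    and "(\<lambda>x. indicator S x *\<^sub>R F x) \<in> borel_measurable borel"
  shows "(\<integral>\<^sup>+x\<in>S. ennreal (F x) \<partial>lborel) = (\<integral>\<^sup>+y\<in>T ` S. ennreal (f y) \<partial>lborel)"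
proof -
  let ?F = "\<lambda>x. \<bar>det (matrix (T' x))\<bar> *\<^sub>R f (T x)"
  have cv: "?F absolutely_integrable_on S \<and> integral S ?F = b \<longleftrightarrow> f absolutely_integrable_on (T ` S) \<and> integral (T ` S) f = b" for b
  proof -
    have "(T has_derivative T' x) (at x within S)" if "x \<in> S" for x
      using der[OF that] by (rule has_derivative_at_withinI)
    \<comment> \<open>A real function is regarded as one with values in
      \<open>real^1\<close>.\<close>
    from has_absolute_integral_change_of_variables[of S T T' "\<lambda>x. vec (f x) :: real^1" "vec b", OF _ this inj]
    show ?thesis
      using assms(1) unfolding absolutely_integrable_on_1_iff integral_on_1_eq
      by (simp add: vec_eq_iff)
  qed
  have F: "F absolutely_integrable_on S \<longleftrightarrow> ?F absolutely_integrable_on S" "integral S F = integral S ?F"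
  proof -
    have F: "F x = ?F x" if "x \<in> S" for x using eq[OF that] by simp
    show "F absolutely_integrable_on S \<longleftrightarrow> ?F absolutely_integrable_on S"
      by (rule set_integrable_cong) (simp_all add: F)
    show "integral S F = integral S ?F"
      by (rule Henstock_Kurzweil_Integration.integral_cong) (rule F)
  qed
  have nnF: "0 \<le> F x" if "x \<in> S" for x using eq[OF that] nn that by simp
  have "F absolutely_integrable_on S \<longleftrightarrow> f absolutely_integrable_on (T ` S)"
    "F absolutely_integrable_on S \<Longrightarrow> integral S F = integral (T ` S) f"
    using cv[of "integral S ?F"] cv[of "integral (T ` S) f"] F by auto
  then show ?thesis
    using nn_integral_eq_absolutely_integrable[of S F, OF assms(1) nnF assms(8)]
      nn_integral_eq_absolutely_integrable[of "T ` S" f, OF assms(2) nn assms(7)] by auto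
qed

text \<open>Summation over \<open>n\<close> is integration against counting measure, so countable
  additivity is an interchange of integral and series.\<close>

lemma countable_sum_measure:
  fixes N :: "nat \<Rightarrow> 'a::topological_space measure"
  assumes "\<And>n. sets (N n) = sets borel"
  obtains \<mu> where "sets \<mu> = sets borel" "\<And>B. B \<in> sets borel \<Longrightarrow> emeasure \<mu> B = (\<Sum>n. emeasure (N n) B)"
proof -
  let ?f = "\<lambda>B. \<integral>\<^sup>+n. emeasure (N n) B \<partial>count_space UNIV"
  let ?\<mu> = "measure_of UNIV (sets borel) ?f :: 'a measure"
  have sp: "sigma_algebra (UNIV :: 'a set) (sets borel)"
    by (metis sets.sigma_algebra_axioms space_borel)
  have s: "sets ?\<mu> = sets borel"
    using sigma_algebra.sets_measure_of_eq[OF sp] .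
  have "emeasure ?\<mu> B = ?f B" if "B \<in> sets borel" for B
  proof (rule emeasure_measure_of_sigma[OF sp _ _ that])
    show "positive (sets borel) ?f" by (simp add: positive_def)
    show "countably_additive (sets borel) ?f"
    proof (rule countably_additiveI)
      fix B :: "nat \<Rightarrow> 'a set" assume B: "range B \<subseteq> sets borel" "disjoint_family B"
      have "(\<Sum>i. ?f (B i)) = (\<integral>\<^sup>+n. (\<Sum>i. emeasure (N n) (B i)) \<partial>count_space UNIV)"
        by (rule nn_integral_suminf[symmetric]) simp
      also have "\<dots> = ?f (\<Union>i. B i)"
        by (rule nn_integral_cong, rule suminf_emeasure) (use B assms in auto)
      finally show "(\<Sum>i. ?f (B i)) = ?f (\<Union>i. B i)" .
    qed
  qed
  with s show ?thesis
    by (intro that[of ?\<mu>]) (simp_all add: nn_integral_count_space_nat)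
qed

section \<open>Charts and the measures they carry\<close>

locale chart_maps =
  fixes c :: "'a::topological_space chart"
  assumes is_chart: "is_chart c"
begin

lemma open_dom: "open (chart_dom c)" and open_image: "open (chart_image c)"
  and continuous_coord: "continuous_on (chart_dom c) (coord c)"
  and continuous_inv: "continuous_on (chart_image c) (chart_inv c)"
  and inv_coord: "p \<in> chart_dom c \<Longrightarrow> chart_inv c (coord c p) = p"
  and coord_inv: "x \<in> chart_image c \<Longrightarrow> coord c (chart_inv c x) = x"
  and inv_dom: "x \<in> chart_image c \<Longrightarrow> chart_inv c x \<in> chart_dom c"
  and coord_image: "p \<in> chart_dom c \<Longrightarrow> coord c p \<in> chart_image c"
  using is_chart unfolding is_chart_def homeomorphism_def by auto

text \<open>A total Borel extension of the inverse chart, so that measures on coordinate space can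
  be pushed forward to the manifold.\<close>

definition inv_total :: "real^3 \<Rightarrow> 'a" where
  "inv_total x = (if x \<in> chart_image c then chart_inv c x else undefined)"

lemma measurable_inv_total [measurable]: "inv_total \<in> borel_measurable borel"
proof -
  have "(\<lambda>x. if x \<in> chart_image c then chart_inv c x else undefined) \<in> borel_measurable borel"
    using borel_measurable_continuous_on_restrict[OF continuous_inv]
    by (subst (asm) measurable_restrict_space_iff[of _ _ undefined]) (auto simp: borel_open open_image)
  then show ?thesis unfolding inv_total_def[abs_def] .
qed

text \<open>Exhibits the image of a set as a preimage, hence as Borel if the set is. Points off the
  chart image all go to \<open>undefined\<close>, which may lie in \<open>B\<close>; the
  intersection removes them.\<close>

lemma coord_image_eq:
  "B \<subseteq> chart_dom c \<Longrightarrow> coord c ` B = chart_image c \<inter> inv_total -` B"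
  unfolding inv_total_def using inv_coord coord_inv coord_image by (force simp: image_iff)

lemma borel_coord_image:
  assumes "B \<in> sets borel" "B \<subseteq> chart_dom c" shows "coord c ` B \<in> sets borel"
  unfolding coord_image_eq[OF assms(2)]
  using measurable_sets[OF measurable_inv_total assms(1)] open_image by auto

end

locale riemannian_atlas =
  fixes A :: "'a::{t2_space, second_countable_topology} chart set" and g :: "'a metric"
  assumes atlas: "oriented_atlas A" and metric: "riemannian_metric A g"
begin

lemma chart_maps: "c \<in> A \<Longrightarrow> chart_maps c"
  using atlas unfolding oriented_atlas_def chart_maps_def by blast

lemma local_riemannian:
  assumes "c \<in> A"
  shows "local_riemannian (chart_image c) (g c)"
proof
  show "open (chart_image c)" by (rule chart_maps.open_image[OF chart_maps[OF assms]])
  show "smooth_on (chart_image c) (\<lambda>x. g c x $ i $ j)" for i j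
    using metric assms unfolding riemannian_metric_def by blast
  fix x assume x: "x \<in> chart_image c"
  show "transpose (g c x) = g c x"
    using metric assms x unfolding riemannian_metric_def by blast
  have pos: "v \<bullet> (g c x *v v) > 0" if "v \<noteq> 0" for v
    using metric assms x that unfolding riemannian_metric_def by blast
  have "v = 0" if "g c x *v v = 0" for v
    using pos[of v] that by auto
  then show "det (g c x) \<noteq> 0"
    by (metis invertible_det_nz invertible_left_inverse matrix_left_invertible_ker)
qed

definition vol_density :: "'a chart \<Rightarrow> real^3 \<Rightarrow> real" where
  "vol_density c x = sqrt (det (g c x))"

lemma continuous_vol_density:
  assumes "c \<in> A" shows "continuous_on (chart_image c) (vol_density c)"
proof -
  interpret local_riemannian "chart_image c" "g c" by (rule local_riemannian[OF assms])
  show ?thesis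
    unfolding vol_density_def det_3
    by (intro continuous_on_real_sqrt continuous_on_add continuous_on_diff continuous_on_mult
        smooth_on_continuous[OF smooth_metric])
qed

lemma measurable_vol_density:
  assumes "c \<in> A" "S \<in> sets borel" "S \<subseteq> chart_image c"
  shows "(\<lambda>x. indicator S x *\<^sub>R vol_density c x) \<in> borel_measurable borel"
  by (rule borel_measurable_continuous_on_indicator[OF assms(2) continuous_on_subset[OF continuous_vol_density[OF assms(1)] assms(3)]])

text \<open>The Riemannian measure of one chart, as a measure on the whole manifold that is
  concentrated on \<open>chart_dom c\<close>.\<close>

definition chart_measure :: "'a chart \<Rightarrow> 'a measure" where
  "chart_measure c = distr (density lborel (\<lambda>x. ennreal (indicator (chart_image c) x *\<^sub>R vol_density c x)))
     borel (chart_maps.inv_total c)"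

lemma sets_chart_measure [simp]: "sets (chart_measure c) = sets borel"
  by (simp add: chart_measure_def)

lemma nn_integral_chart_measure:
  assumes c: "c \<in> A" and f: "f \<in> borel_measurable borel"
  shows "(\<integral>\<^sup>+p. f p \<partial>chart_measure c)
    = (\<integral>\<^sup>+x\<in>chart_image c. f (chart_inv c x) * ennreal (vol_density c x) \<partial>lborel)"
proof -
  interpret chart_maps c by (rule chart_maps[OF c])
  have d: "(\<lambda>x. ennreal (indicator (chart_image c) x *\<^sub>R vol_density c x)) \<in> borel_measurable lborel"
    using measurable_vol_density[OF c] open_image by (simp add: borel_open)
  have "(\<integral>\<^sup>+p. f p \<partial>chart_measure c)
    = (\<integral>\<^sup>+x. ennreal (indicator (chart_image c) x *\<^sub>R vol_density c x) * f (inv_total x) \<partial>lborel)"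
    unfolding chart_measure_def using f d measurable_inv_total
    by (simp add: nn_integral_distr nn_integral_density)
  also have "\<dots> = (\<integral>\<^sup>+x\<in>chart_image c. f (chart_inv c x) * ennreal (vol_density c x) \<partial>lborel)"
    by (rule nn_integral_cong) (simp add: inv_total_def mult.commute split: split_indicator)
  finally show ?thesis .
qed

lemma emeasure_chart_measure:
  assumes c: "c \<in> A" and B: "B \<in> sets borel" "B \<subseteq> chart_dom c"
  shows "emeasure (chart_measure c) B = (\<integral>\<^sup>+x\<in>coord c ` B. ennreal (vol_density c x) \<partial>lborel)"
proof -
  interpret chart_maps c by (rule chart_maps[OF c])
  have "emeasure (chart_measure c) B = (\<integral>\<^sup>+p. indicator B p \<partial>chart_measure c)"
    using B by simp
  also have "\<dots> = (\<integral>\<^sup>+x\<in>chart_image c. indicator B (chart_inv c x) * ennreal (vol_density c x) \<partial>lborel)"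
    using B by (intro nn_integral_chart_measure c) simp
  also have "\<dots> = (\<integral>\<^sup>+x\<in>coord c ` B. ennreal (vol_density c x) \<partial>lborel)"
    unfolding coord_image_eq[OF B(2)]
    by (rule nn_integral_cong) (simp add: inv_total_def split: split_indicator)
  finally show ?thesis .
qed

text \<open>Determinants of the transformation law of \<open>g\<close> show that sqrt (det g) picks
  up |det J|, the factor in the change of variables along the transition map.\<close>

lemma chart_measure_compat:
  assumes c: "c \<in> A" and d: "d \<in> A" and B: "B \<in> sets borel" "B \<subseteq> chart_dom c" "B \<subseteq> chart_dom d"
  shows "emeasure (chart_measure c) B = emeasure (chart_measure d) B"
proof -
  interpret c: chart_maps c by (rule chart_maps[OF c])
  interpret d: chart_maps d by (rule chart_maps[OF d])
  let ?S = "coord c ` B" and ?T = "transition c d"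
  have S: "?S \<subseteq> overlap c d" "?S \<subseteq> chart_image c"
    using B c.coord_image unfolding overlap_def by auto
  have TS: "?T ` ?S = coord d ` B"
    unfolding transition_def image_image using B c.inv_coord by (auto simp: image_iff subset_iff)
  have inj: "inj_on ?T ?S"
  proof (rule inj_onI)
    fix x y assume "x \<in> ?S" "y \<in> ?S" "?T x = ?T y"
    then obtain p q where "p \<in> B" "q \<in> B" "x = coord c p" "y = coord c q" "coord d p = coord d q"
      unfolding transition_def using B c.inv_coord by (auto simp: subset_iff)
    then show "x = y" using B d.inv_coord by (metis subsetD)
  qed
  have der: "(?T has_derivative frechet_derivative ?T (at x)) (at x)" if "x \<in> ?S" for x
  proof -
    have "\<forall>a. smooth_on (overlap c d) (\<lambda>x. ?T x $ a)"
      using atlas c d unfolding oriented_atlas_def by blast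
    then have "(\<lambda>x. ?T x $ a) differentiable (at x)" for a
      using smooth_on_differentiable that S by blast
    then have "?T differentiable (at x)"
      by (subst differentiable_componentwise_within) (auto simp: Basis_vec_def inner_axis)
    then show ?thesis using frechet_derivative_works by blast
  qed
  text \<open>Truncating at \<open>0\<close> avoids proving \<open>det g > 0\<close>; \<^const>\<open>ennreal\<close> truncates anyway.\<close>
  have eq: "max 0 (vol_density c x) = \<bar>det (matrix (frechet_derivative ?T (at x)))\<bar> * max 0 (vol_density d (?T x))" if "x \<in> ?S" for x
  proof -
    let ?J = "jacobian c d x"
    have "g c x = transpose ?J ** g d (?T x) ** ?J"
      using metric c d S that unfolding riemannian_metric_def by blast
    then have "det (g c x) = (det ?J)\<^sup>2 * det (g d (?T x))"
      by (simp add: det_mul det_transpose power2_eq_square)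
    then have "vol_density c x = \<bar>det ?J\<bar> * vol_density d (?T x)"
      unfolding vol_density_def by (simp add: real_sqrt_mult)
    then show ?thesis
      unfolding jacobian_def by (simp add: max_mult_distrib_left)
  qed
  have meas: "(\<lambda>x. indicator (coord b ` B) x *\<^sub>R max 0 (vol_density b x)) \<in> borel_measurable borel"
    if b: "b \<in> A" "B \<subseteq> chart_dom b" for b
  proof -
    interpret b: chart_maps b by (rule chart_maps[OF b(1)])
    have "coord b ` B \<subseteq> chart_image b" using b b.coord_image by auto
    then have "(\<lambda>x. max 0 (indicator (coord b ` B) x *\<^sub>R vol_density b x)) \<in> borel_measurable borel"
      using measurable_vol_density[OF b(1) b.borel_coord_image[OF B(1) b(2)]]
      by (intro borel_measurable_max) auto
    then show ?thesis
      by (rule measurable_cong[THEN iffD1, rotated]) (simp split: split_indicator)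
  qed
  have "(\<integral>\<^sup>+x\<in>?S. ennreal (max 0 (vol_density c x)) \<partial>lborel) = (\<integral>\<^sup>+y\<in>?T ` ?S. ennreal (max 0 (vol_density d y)) \<partial>lborel)"
    by (rule nn_integral_change_of_variables[OF _ _ der inj _ eq])
       (use meas[OF c B(2)] meas[OF d B(3)] c.borel_coord_image[OF B(1,2)] d.borel_coord_image[OF B(1,3)] in \<open>simp_all add: TS\<close>)
  then show ?thesis
    unfolding emeasure_chart_measure[OF c B(1,2)] emeasure_chart_measure[OF d B(1,3)] TS
    by (simp add: ennreal_max_0)
qed

section \<open>Existence and uniqueness of the Riemannian measure\<close>

definition is_volume :: "'a measure \<Rightarrow> bool" where
  "is_volume \<mu> \<longleftrightarrow> sets \<mu> = sets borel \<and>
     (\<forall>c\<in>A. \<forall>B\<in>sets borel. B \<subseteq> chart_dom c \<longrightarrow> emeasure \<mu> B = emeasure (chart_measure c) B)"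

lemma volume_measure_THE: "volume_measure A g = (THE \<mu>. is_volume \<mu>)"
proof -
  have "is_volume = (\<lambda>\<mu>. sets \<mu> = sets borel \<and>
     (\<forall>c\<in>A. \<forall>B\<in>sets borel. B \<subseteq> chart_dom c \<longrightarrow>
        emeasure \<mu> B = (\<integral>\<^sup>+x\<in>coord c ` B. ennreal (sqrt (det (g c x))) \<partial>lborel)))"
    by (rule ext) (auto simp: is_volume_def emeasure_chart_measure vol_density_def)
  then show ?thesis unfolding volume_measure_def by simp
qed

lemma chart_sequence:
  "\<exists>e :: nat \<Rightarrow> 'a chart. range e \<subseteq> A \<and> (\<Union>n. chart_dom (e n)) = UNIV"
proof -
  have op: "open S" if "S \<in> chart_dom ` A" for S
    using that chart_maps.open_dom[OF chart_maps] by auto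
  obtain F where F: "F \<subseteq> chart_dom ` A" "countable F" "\<Union>F = \<Union>(chart_dom ` A)"
    using Lindelof[of "chart_dom ` A"] op by blast
  then obtain C where C: "countable C" "C \<subseteq> A" "F = chart_dom ` C"
    using countable_subset_image by metis
  have U: "(\<Union>c\<in>C. chart_dom c) = UNIV"
    using F C atlas unfolding oriented_atlas_def by auto
  then have "C \<noteq> {}" by auto
  then have "range (from_nat_into C) = C" using C by (simp add: range_from_nat_into)
  then have "(\<Union>n. chart_dom (from_nat_into C n)) = (\<Union>c\<in>C. chart_dom c)"
    by (metis image_image)
  with C U \<open>range (from_nat_into C) = C\<close> show ?thesis by (intro exI[of _ "from_nat_into C"]) simp
qed

text \<open>On the disjoint Borel pieces \<open>D n\<close>, each inside one chart domain, a volume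
  measure is prescribed by a chart measure; hence uniqueness. For existence the chart measures are
  restricted to their pieces and summed; agreement on overlaps makes the sum correct in every
  chart.\<close>

lemma is_volume_ex1: "\<exists>!\<mu>. is_volume \<mu>"
proof -
  obtain e :: "nat \<Rightarrow> 'a chart" where e: "range e \<subseteq> A" "(\<Union>n. chart_dom (e n)) = UNIV" using chart_sequence by auto
  define D where "D = disjointed (\<lambda>n. chart_dom (e n))"
  have D: "D n \<subseteq> chart_dom (e n)" "D n \<in> sets borel" "disjoint_family D" "(\<Union>n. D n) = UNIV" "e n \<in> A" for n
  proof -
    have "range (\<lambda>n. chart_dom (e n)) \<subseteq> sets borel"
      using e(1) by (auto intro!: borel_open chart_maps.open_dom chart_maps)
    from sets.range_disjointed_sets[OF this] show "D n \<in> sets borel" unfolding D_def by auto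
    show "D n \<subseteq> chart_dom (e n)" unfolding D_def by (rule disjointed_subset)
    show "disjoint_family D" unfolding D_def by (rule disjoint_family_disjointed)
    show "(\<Union>n. D n) = UNIV" unfolding D_def UN_disjointed_eq by (rule e)
    show "e n \<in> A" using e by auto
  qed
  have split: "emeasure \<mu> B = (\<Sum>n. emeasure \<mu> (B \<inter> D n))" if "sets \<mu> = sets borel" "B \<in> sets borel" for \<mu> B
  proof -
    have "B = (\<Union>n. B \<inter> D n)" using D(4) by auto
    then have "emeasure \<mu> B = emeasure \<mu> (\<Union>n. B \<inter> D n)" by simp
    also have "\<dots> = (\<Sum>n. emeasure \<mu> (B \<inter> D n))"
    proof (rule suminf_emeasure[symmetric])
      show "range (\<lambda>n. B \<inter> D n) \<subseteq> sets \<mu>" using D(2) that by auto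
      show "disjoint_family (\<lambda>n. B \<inter> D n)" using D(3) unfolding disjoint_family_on_def by blast
    qed
    finally show ?thesis .
  qed
  have uniq: "emeasure \<mu> B = (\<Sum>n. emeasure (chart_measure (e n)) (B \<inter> D n))" if "is_volume \<mu>" "B \<in> sets borel" for \<mu> B
  proof -
    have "emeasure \<mu> (B \<inter> D n) = emeasure (chart_measure (e n)) (B \<inter> D n)" for n
    proof -
      have "B \<inter> D n \<in> sets borel" "B \<inter> D n \<subseteq> chart_dom (e n)" using that(2) D(1,2) by blast+
      then show ?thesis using that(1) D(5) unfolding is_volume_def by blast
    qed
    then show ?thesis using split[of \<mu> B] that unfolding is_volume_def by simp
  qed
  let ?N = "\<lambda>n. density (chart_measure (e n)) (indicator (D n))"
  obtain \<mu> where \<mu>: "sets \<mu> = sets borel" "\<And>B. B \<in> sets borel \<Longrightarrow> emeasure \<mu> B = (\<Sum>n. emeasure (?N n) B)"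
    by (rule countable_sum_measure[of ?N]) auto
  have N: "emeasure (?N n) B = emeasure (chart_measure (e n)) (B \<inter> D n)" if "B \<in> sets borel" for n B
    using that D(2)[of n] by (subst emeasure_restricted) (simp_all add: Int_commute)
  have "is_volume \<mu>"
    unfolding is_volume_def
  proof (intro conjI ballI impI)
    fix c B assume c: "c \<in> A" and B: "B \<in> sets borel" "B \<subseteq> chart_dom c"
    have "emeasure \<mu> B = (\<Sum>n. emeasure (chart_measure (e n)) (B \<inter> D n))"
      using \<mu>(2)[OF B(1)] N[OF B(1)] by simp
    also have "\<dots> = (\<Sum>n. emeasure (chart_measure c) (B \<inter> D n))"
      by (intro suminf_cong chart_measure_compat) (use D B c in auto)
    also have "\<dots> = emeasure (chart_measure c) B"
      using split[of "chart_measure c" B] B by simp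
    finally show "emeasure \<mu> B = emeasure (chart_measure c) B" .
  qed (rule \<mu>)
  moreover have "\<mu>' = \<mu>" if "is_volume \<mu>'" for \<mu>'
  proof (rule measure_eqI)
    show "sets \<mu>' = sets \<mu>" using that \<open>is_volume \<mu>\<close> unfolding is_volume_def by simp
    fix B assume "B \<in> sets \<mu>'"
    then have "B \<in> sets borel" using that unfolding is_volume_def by simp
    then show "emeasure \<mu>' B = emeasure \<mu> B" using uniq[OF that] uniq[OF \<open>is_volume \<mu>\<close>] by simp
  qed
  ultimately show ?thesis by blast
qed

lemma is_volume_volume_measure: "is_volume (volume_measure A g)"
  unfolding volume_measure_THE by (rule theI'[OF is_volume_ex1])

lemma volume_measure_eqI: "is_volume \<mu> \<Longrightarrow> volume_measure A g = \<mu>"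
  using is_volume_ex1 is_volume_volume_measure by blast

lemma sets_volume_measure [simp]: "sets (volume_measure A g) = sets borel"
  using is_volume_volume_measure unfolding is_volume_def by blast

text \<open>Equality of the restricted measures, rather than of their values on sets, so that
  integrals over a chart domain can be transferred at once.\<close>

lemma density_volume_measure_chart:
  assumes "c \<in> A"
  shows "density (volume_measure A g) (indicator (chart_dom c)) = density (chart_measure c) (indicator (chart_dom c))"
proof (rule measure_eqI)
  fix B assume "B \<in> sets (density (volume_measure A g) (indicator (chart_dom c)))"
  then have B: "B \<in> sets borel" by simp
  have o: "chart_dom c \<in> sets borel" using chart_maps.open_dom[OF chart_maps[OF assms]] by (rule borel_open)
  have "emeasure (density \<nu> (indicator (chart_dom c))) B = emeasure \<nu> (B \<inter> chart_dom c)"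
    if "sets \<nu> = sets borel" for \<nu> :: "'a measure"
    using B o that by (subst emeasure_restricted) (simp_all add: Int_commute)
  then show "emeasure (density (volume_measure A g) (indicator (chart_dom c))) B
      = emeasure (density (chart_measure c) (indicator (chart_dom c))) B"
    using is_volume_volume_measure B o assms unfolding is_volume_def by simp
qed simp

lemma nn_integral_volume_measure_chart:
  assumes "c \<in> A" "f \<in> borel_measurable borel"
  shows "(\<integral>\<^sup>+p\<in>chart_dom c. f p \<partial>volume_measure A g) = (\<integral>\<^sup>+p\<in>chart_dom c. f p \<partial>chart_measure c)"
proof -
  have o: "chart_dom c \<in> sets borel" using chart_maps.open_dom[OF chart_maps[OF assms(1)]] by (rule borel_open)
  have m: "f \<in> borel_measurable \<nu>" "(indicator (chart_dom c) :: 'a \<Rightarrow> ennreal) \<in> borel_measurable \<nu>" if "sets \<nu> = sets borel" for \<nu> :: "'a measure"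
    using assms(2) o that measurable_cong_sets[OF that refl] by auto
  have "(\<integral>\<^sup>+p. f p \<partial>density \<nu> (indicator (chart_dom c))) = (\<integral>\<^sup>+p\<in>chart_dom c. f p \<partial>\<nu>)"
    if "sets \<nu> = sets borel" for \<nu> :: "'a measure"
    using m[OF that] by (simp add: nn_integral_density mult.commute)
  then show ?thesis
    by (metis density_volume_measure_chart[OF assms(1)] sets_chart_measure sets_volume_measure)
qed

end

section \<open>Conformal invariance of the integral\<close>

locale conformal_atlas = g: riemannian_atlas A g + h: riemannian_atlas A h
  for A :: "'a::{t2_space, second_countable_topology} chart set" and g h :: "'a metric" +
  fixes w :: "'a \<Rightarrow> real"
  assumes smooth_w: "smooth_function A w" and conformal: "conformal_change A w g h"
begin

lemma conformal_pair:
  assumes "c \<in> A"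
  shows "conformal_pair (chart_image c) (g c) (h c) (\<lambda>x. w (chart_inv c x))"
proof (intro conformal_pair.intro conformal_pair_axioms.intro)
  show "local_riemannian (chart_image c) (g c)" "local_riemannian (chart_image c) (h c)"
    using assms by (auto intro: g.local_riemannian h.local_riemannian)
  show "smooth_on (chart_image c) (\<lambda>x. w (chart_inv c x))"
    using smooth_w assms unfolding smooth_function_def by blast
  show "h c x = exp (2 * w (chart_inv c x)) *\<^sub>R g c x" if "x \<in> chart_image c" for x
    using conformal assms that unfolding conformal_change_def by blast
qed

lemma ex_chart: "\<exists>c. c \<in> A \<and> p \<in> chart_dom c"
  using g.atlas unfolding oriented_atlas_def by blast

lemma measurable_w: "w \<in> borel_measurable borel"
proof (intro borel_measurable_continuous_onI continuous_at_imp_continuous_on ballI)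
  fix p
  obtain c where c: "c \<in> A" "p \<in> chart_dom c" using ex_chart by blast
  interpret chart_maps c by (rule g.chart_maps[OF c(1)])
  have "continuous_on (chart_image c) (\<lambda>x. w (chart_inv c x))"
    using smooth_w c unfolding smooth_function_def by (intro smooth_on_continuous) blast
  then have "continuous_on (chart_dom c) (\<lambda>p. w (chart_inv c (coord c p)))"
    by (rule continuous_on_compose2[OF _ continuous_coord]) (auto intro: coord_image)
  then have "continuous_on (chart_dom c) w"
    by (rule continuous_on_cong[THEN iffD1, rotated -1]) (simp_all add: inv_coord)
  then show "isCont w p"
    using c(2) open_dom by (simp add: continuous_on_eq_continuous_at)
qed

text \<open>The chart chosen in \<open>integrand\<close> depends on the atlas and the point but not
  on the metric, so both sides are evaluated in the same chart.\<close>

lemma integrand_conf: "integrand A h p = exp (- 3 * w p) * integrand A g p"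
proof -
  define c where "c = (SOME c. c \<in> A \<and> p \<in> chart_dom c)"
  have c: "c \<in> A" "p \<in> chart_dom c"
    using someI_ex[OF ex_chart[of p]] unfolding c_def by auto
  interpret chart_maps c by (rule g.chart_maps[OF c(1)])
  show ?thesis
    using conformal_pair.local_integrand_conf[OF conformal_pair[OF c(1)] coord_image[OF c(2)]]
    unfolding integrand_def Let_def c_def[symmetric] inv_coord[OF c(2)] .
qed

text \<open>By uniqueness it suffices to compare on Borel sets inside one chart domain, where sqrt
  (det g) acquires the factor e^(3 w).\<close>

lemma volume_measure_conf:
  "volume_measure A h = density (volume_measure A g) (\<lambda>p. ennreal (exp (3 * w p)))"
proof (rule h.volume_measure_eqI, unfold h.is_volume_def, intro conjI ballI impI)
  let ?\<mu> = "volume_measure A g" and ?f = "\<lambda>p. ennreal (exp (3 * w p))"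
  have f: "?f \<in> borel_measurable borel" using measurable_w by measurable
  fix c B assume c: "c \<in> A" and B: "B \<in> sets borel" "B \<subseteq> chart_dom c"
  interpret chart_maps c by (rule g.chart_maps[OF c])
  have fB: "(\<lambda>p. ?f p * indicator B p) \<in> borel_measurable borel"
    using f B(1) by measurable
  have o: "chart_dom c \<in> sets borel" using open_dom by (rule borel_open)
  have fBo: "(\<lambda>p. ?f p * indicator B p * indicator (chart_dom c) p) \<in> borel_measurable borel"
    using fB o by measurable
  have "?f \<in> borel_measurable ?\<mu>"
    using f measurable_cong_sets[OF g.sets_volume_measure refl] by blast
  then have "emeasure (density ?\<mu> ?f) B = (\<integral>\<^sup>+p. ?f p * indicator B p \<partial>?\<mu>)"
    using B(1) by (simp add: emeasure_density)
  also have "\<dots> = (\<integral>\<^sup>+p\<in>chart_dom c. ?f p * indicator B p \<partial>?\<mu>)"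
    by (rule nn_integral_cong) (use B(2) in \<open>auto split: split_indicator\<close>)
  also have "\<dots> = (\<integral>\<^sup>+p\<in>chart_dom c. ?f p * indicator B p \<partial>g.chart_measure c)"
    by (rule g.nn_integral_volume_measure_chart[OF c fB])
  also have "\<dots> = (\<integral>\<^sup>+x\<in>chart_image c. ?f (chart_inv c x) * indicator B (chart_inv c x)
      * indicator (chart_dom c) (chart_inv c x) * ennreal (g.vol_density c x) \<partial>lborel)"
    by (rule g.nn_integral_chart_measure[OF c fBo])
  also have "\<dots> = (\<integral>\<^sup>+x\<in>coord c ` B. ennreal (h.vol_density c x) \<partial>lborel)"
  proof (rule nn_integral_cong)
    fix x :: "real^3"
    have "ennreal (h.vol_density c x) = ?f (chart_inv c x) * ennreal (g.vol_density c x)" if "x \<in> chart_image c"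
      unfolding h.vol_density_def g.vol_density_def
        conformal_pair.sqrt_det_conf[OF conformal_pair[OF c] that]
      by (simp add: ennreal_mult')
    moreover have "x \<in> coord c ` B \<longleftrightarrow> x \<in> chart_image c \<and> chart_inv c x \<in> B"
      unfolding coord_image_eq[OF B(2)] by (auto simp: inv_total_def)
    ultimately show "?f (chart_inv c x) * indicator B (chart_inv c x) * indicator (chart_dom c) (chart_inv c x)
        * ennreal (g.vol_density c x) * indicator (chart_image c) x
        = ennreal (h.vol_density c x) * indicator (coord c ` B) x"
      using inv_dom[of x] by (auto split: split_indicator)
  qed
  also have "\<dots> = emeasure (h.chart_measure c) B"
    by (rule h.emeasure_chart_measure[OF c B, symmetric])
  finally show "emeasure (density ?\<mu> ?f) B = emeasure (h.chart_measure c) B" .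
qed simp

text \<open>The factor e^(3 w) of the density cancels that of the integrand. The two integrands are
  measurable or not together, as they differ by a positive measurable factor; in the nonmeasurable
  case neither integral converges and both take the default value 0.\<close>

lemma integral_conf:
  "I_converges A h \<longleftrightarrow> I_converges A g" "I_integral A h = I_integral A g"
proof -
  let ?\<mu> = "volume_measure A g" and ?e = "\<lambda>p. exp (3 * w p)"
  have w: "w \<in> borel_measurable ?\<mu>"
    using measurable_w measurable_cong_sets[OF g.sets_volume_measure refl] by blast
  then have e: "?e \<in> borel_measurable ?\<mu>" by measurable
  have gh: "integrand A g = (\<lambda>p. ?e p *\<^sub>R integrand A h p)"
    by (rule ext) (simp add: integrand_conf flip: mult.assoc exp_add)
  have m: "integrand A h \<in> borel_measurable ?\<mu> \<longleftrightarrow> integrand A g \<in> borel_measurable ?\<mu>"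
  proof
    show "integrand A g \<in> borel_measurable ?\<mu>" if "integrand A h \<in> borel_measurable ?\<mu>"
      unfolding gh using that e by measurable
    have "integrand A h = (\<lambda>p. exp (- 3 * w p) * integrand A g p)"
      by (rule ext) (rule integrand_conf)
    then show "integrand A h \<in> borel_measurable ?\<mu>" if "integrand A g \<in> borel_measurable ?\<mu>"
      using that w by simp
  qed
  show "I_converges A h \<longleftrightarrow> I_converges A g"
  proof (cases "integrand A h \<in> borel_measurable ?\<mu>")
    case True
    then show ?thesis
      unfolding I_converges_def volume_measure_conf gh using e by (intro integrable_density) auto
  next
    case False
    then show ?thesis
      unfolding I_converges_def volume_measure_conf using m by (auto dest: borel_measurable_integrable)
  qed
  show "I_integral A h = I_integral A g"
  proof (cases "integrand A h \<in> borel_measurable ?\<mu>")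
    case True
    then show ?thesis
      unfolding I_integral_def volume_measure_conf gh using e by (intro integral_density) auto
  next
    case False
    then have "\<not> integrable (volume_measure A h) (integrand A h)" "\<not> integrable ?\<mu> (integrand A g)"
      unfolding volume_measure_conf using m by (auto dest: borel_measurable_integrable)
    then show ?thesis unfolding I_integral_def by (simp add: not_integrable_integral_eq)
  qed
qed

end

text \<open>A divergent integral has the default value 0, so equality of the integrals alone would
  not express that convergence depends only on the conformal class; the equivalence is a conjunct of
  its own.\<close>

theorem theorem1p1:
  fixes A :: "'a::{t2_space, second_countable_topology} chart set"
    and g :: "'a metric"
  assumes "oriented_atlas A"
    and "riemannian_metric A g"
  shows "(\<forall>c\<in>A. \<forall>x\<in>chart_image c. \<forall>i j.
            V_tensor (g c) i j x = V_tensor (g c) j i x \<and>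
            C_tensor (g c) i j x = C_tensor (g c) j i x) \<and>
         (\<forall>w0 h. smooth_function A w0 \<and> riemannian_metric A h \<and> conformal_change A w0 g h \<longrightarrow>
            (\<forall>c\<in>A. \<forall>p\<in>chart_dom c.
               V_inner_C (h c) (coord c p) = exp (- 7 * w0 p) * V_inner_C (g c) (coord c p) \<and>
               C_norm_sq (h c) (coord c p) = exp (- 6 * w0 p) * C_norm_sq (g c) (coord c p)) \<and>
            (I_converges A h \<longleftrightarrow> I_converges A g) \<and>
            I_integral A h = I_integral A g)"
proof -
  interpret riemannian_atlas A g using assms by unfold_locales
  show ?thesis
  proof (intro conjI ballI allI impI; (elim conjE)?)
    fix c x i j assume "c \<in> A" "x \<in> chart_image c"
    then show "V_tensor (g c) i j x = V_tensor (g c) j i x" "C_tensor (g c) i j x = C_tensor (g c) j i x"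
      using local_riemannian.V_tensor_sym[OF local_riemannian] local_riemannian.C_tensor_sym[OF local_riemannian]
      by blast+
  next
    fix w0 h assume wh: "smooth_function A w0" "riemannian_metric A h" "conformal_change A w0 g h"
    interpret conformal_atlas A g h w0 using assms wh by unfold_locales
    show "I_converges A h \<longleftrightarrow> I_converges A g" "I_integral A h = I_integral A g"
      by (fact integral_conf)+
    fix c p assume cp: "c \<in> A" "p \<in> chart_dom c"
    interpret chart_maps c by (rule chart_maps[OF cp(1)])
    note coord = coord_image[OF cp(2)] and inv = inv_coord[OF cp(2)]
    show "V_inner_C (h c) (coord c p) = exp (- 7 * w0 p) * V_inner_C (g c) (coord c p)"
      using conformal_pair.V_inner_C_conf[OF conformal_pair[OF cp(1)] coord] unfolding inv .
    show "C_norm_sq (h c) (coord c p) = exp (- 6 * w0 p) * C_norm_sq (g c) (coord c p)"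
      using conformal_pair.C_norm_sq_conf[OF conformal_pair[OF cp(1)] coord] unfolding inv .
  qed
qed

end
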